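(* Let $a,b>0$ be such that $a^{\frac{N-4s}{2s}}b\ge L_{N,s}$ and, for any $\lambda>0$, set $$\iota_\lambda^s:=\inf\{\mathcal{I}_{a,b}^\lambda(u)\mid u\in X_0^s(\Omega)\setminus\{0\}\}.$$ Then there exists $\overline{\lambda}_0^s\ge0$ such that for any $\lambda>\overline{\lambda}_0^s$ there is $u_\lambda^s\in X_0^s(\Omega)\setminus\{0\}$ with $\mathcal{I}_{a,b}^\lambda(u_\lambda^s)=\iota_\lambda^s<0$.
   Context: Throughout, $s\in(0,1)$, $N$ is a positive integer with $N>4s$, $\Omega\subset\mathbb{R}^N$ is a bounded domain with Lipschitz boundary, and $2^*_s:=\frac{2N}{N-2s}$. Put $\mathcal{Q}:=\mathbb{R}^{2N}\setminus(\Omega^c\times\Omega^c)$, where $\Omega^c=\mathbb{R}^N\setminus\Omega$. $X_0^s(\Omega)$ is the space of (measurable) functions $u\colon\mathbb{R}^N\to\mathbb{R}$ with $u|_\Omega\in L^2(\Omega)$, $\int_{\mathcal{Q}}\frac{|u(x)-u(y)|^2}{|x-y|^{N+2s}}\,dx\,dy<\infty$ and $u=0$ a.e. in $\mathbb{R}^N\setminus\Omega$; it is a Hilbert space with norm $\|u\|=\left(\int_{\mathcal{Q}}\frac{|u(x)-u(y)|^2}{|x-y|^{N+2s}}\,dx\,dy\right)^{1/2}$. $\|\cdot\|_q$ is the norm of $L^q(\Omega)$. $S_{N,s}:=\inf_{u\in X_0^s(\Omega)\setminus\{0\}}\frac{\|u\|^2}{\|u\|_{2^*_s}^2}$ and $L_{N,s}:=\frac{4s(N-4s)^{\frac{N-4s}{2s}}}{N^{\frac{N-2s}{2s}}S_{N,s}^{\frac{N}{2s}}}$.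 Standing assumptions on $g$: (H1) $g\colon\Omega\times\mathbb{R}\to\mathbb{R}$ is a Carathéodory function with $g(x,0)=0$ for a.e. $x\in\Omega$; (H2) for a.e. $x\in\Omega$, $g(x,t)>0$ for every $t>0$ and $g(x,t)<0$ for every $t<0$; moreover there are $\mu>0$ and a nonempty open interval $I\subset(0,\infty)$ with $g(x,t)\ge\mu$ for a.e. $x\in\Omega$ and every $t\in I$; (H3) there are $c>0$ and $p\in(2,2^*_s)$ with $|g(x,t)|\le c(1+|t|^{p-1})$ for a.e. $x\in\Omega$ and all $t\in\mathbb{R}$; (H4) $\lim_{t\to0}g(x,t)/|t|=0$ uniformly with respect to $x\in\Omega$. Put $G(x,t)=\int_0^tg(x,\tau)\,d\tau$ and $\mathcal{I}_{a,b}^\lambda(u):=\frac a2\|u\|^2+\frac b4\|u\|^4-\frac1{2^*_s}\|u\|_{2^*_s}^{2^*_s}-\lambda\int_\Omega G(x,u)\,dx$ for $u\in X_0^s(\Omega)$. *)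

theory Defs
  imports "HOL-Analysis.Analysis"
begin

text \<open>
  The space \<open>\<real>\<^sup>N\<close> is \<open>real ^ 'n\<close> with \<open>N = CARD('n)\<close>. Elements of function spaces are functions
  rather than classes modulo a.e. equality, so being the zero element means vanishing almost
  everywhere.
\<close>

text \<open>
  Near each boundary point, the set is the strict epigraph of a Lipschitz function in suitable
  orthonormal coordinates. The unit vector \<open>\<nu>\<close> is the last coordinate direction, and the hyperplane
  orthogonal to \<open>\<nu>\<close> plays the role of \<open>\<real>\<^sup>N\<^sup>-\<^sup>1\<close> (it is a point if \<open>N = 1\<close>).
\<close>

definition lipschitz_boundary :: "(real ^ 'n) set \<Rightarrow> bool" where
  "lipschitz_boundary \<Omega> \<longleftrightarrow>
     (\<forall>x0\<in>frontier \<Omega>. \<exists>\<nu> \<phi> r C. norm \<nu> = 1 \<and> r > 0 \<and>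
        C-lipschitz_on {y. y \<bullet> \<nu> = 0} (\<phi> :: real ^ 'n \<Rightarrow> real) \<and>
        \<Omega> \<inter> ball x0 r = {x \<in> ball x0 r. \<phi> (x - (x \<bullet> \<nu>) *\<^sub>R \<nu>) < x \<bullet> \<nu>})"

definition bounded_lipschitz_domain :: "(real ^ 'n) set \<Rightarrow> bool" where
  "bounded_lipschitz_domain \<Omega> \<longleftrightarrow>
     \<Omega> \<noteq> {} \<and> open \<Omega> \<and> connected \<Omega> \<and> bounded \<Omega> \<and> lipschitz_boundary \<Omega>"

definition crit_exp :: "nat \<Rightarrow> real \<Rightarrow> real" where
  "crit_exp N s = 2 * real N / (real N - 2 * s)"

definition Q_set :: "(real ^ 'n) set \<Rightarrow> ((real ^ 'n) \<times> (real ^ 'n)) set" where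
  "Q_set \<Omega> = UNIV - (- \<Omega>) \<times> (- \<Omega>)"

text \<open>On the diagonal, which is a null set, this takes the value \<open>0\<close> since \<open>0 / 0 = 0\<close>.\<close>

definition gagliardo_kernel ::
    "real \<Rightarrow> (real ^ 'n \<Rightarrow> real) \<Rightarrow> (real ^ 'n) \<times> (real ^ 'n) \<Rightarrow> real" where
  "gagliardo_kernel s u =
     (\<lambda>(x, y). \<bar>u x - u y\<bar>\<^sup>2 / norm (x - y) powr (real CARD('n) + 2 * s))"

definition X0 :: "real \<Rightarrow> (real ^ 'n) set \<Rightarrow> (real ^ 'n \<Rightarrow> real) set" where
  "X0 s \<Omega> = {u. u \<in> borel_measurable lebesgue \<and>
     set_integrable lebesgue \<Omega> (\<lambda>x. (u x)\<^sup>2) \<and>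
     set_integrable lebesgue (Q_set \<Omega>) (gagliardo_kernel s u) \<and>
     (AE x in lebesgue. x \<notin> \<Omega> \<longrightarrow> u x = 0)}"

definition X0_nonzero :: "real \<Rightarrow> (real ^ 'n) set \<Rightarrow> (real ^ 'n \<Rightarrow> real) set" where
  "X0_nonzero s \<Omega> = {u \<in> X0 s \<Omega>. \<not> (AE x in lebesgue. u x = 0)}"

definition X0_norm :: "real \<Rightarrow> (real ^ 'n) set \<Rightarrow> (real ^ 'n \<Rightarrow> real) \<Rightarrow> real" where
  "X0_norm s \<Omega> u = sqrt (set_lebesgue_integral lebesgue (Q_set \<Omega>) (gagliardo_kernel s u))"

definition Lq_norm :: "real \<Rightarrow> (real ^ 'n) set \<Rightarrow> (real ^ 'n \<Rightarrow> real) \<Rightarrow> real" where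
  "Lq_norm q \<Omega> u = (LINT x:\<Omega>|lebesgue. \<bar>u x\<bar> powr q) powr (1 / q)"

definition sobolev_const :: "real \<Rightarrow> (real ^ 'n) set \<Rightarrow> real" where
  "sobolev_const s \<Omega> =
     (INF u \<in> X0_nonzero s \<Omega>. (X0_norm s \<Omega> u)\<^sup>2 / (Lq_norm (crit_exp CARD('n) s) \<Omega> u)\<^sup>2)"

definition L_const :: "real \<Rightarrow> (real ^ 'n) set \<Rightarrow> real" where
  "L_const s \<Omega> = (let N = real CARD('n) in
     4 * s * (N - 4 * s) powr ((N - 4 * s) / (2 * s)) /
     (N powr ((N - 2 * s) / (2 * s)) * sobolev_const s \<Omega> powr (N / (2 * s))))"

text \<open>A function on \<open>\<Omega> \<times> \<real>\<close> is a total function of which only the values at \<open>x \<in> \<Omega>\<close> are relevant.\<close>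

definition caratheodory :: "(real ^ 'n) set \<Rightarrow> (real ^ 'n \<Rightarrow> real \<Rightarrow> real) \<Rightarrow> bool" where
  "caratheodory \<Omega> g \<longleftrightarrow>
     (\<forall>t. (\<lambda>x. g x t) \<in> borel_measurable (lebesgue_on \<Omega>)) \<and>
     (AE x in lebesgue_on \<Omega>. continuous_on UNIV (g x))"

text \<open>The interval integral is oriented, so this is also the intended value for \<open>t < 0\<close>.\<close>

definition primitive :: "(real ^ 'n \<Rightarrow> real \<Rightarrow> real) \<Rightarrow> real ^ 'n \<Rightarrow> real \<Rightarrow> real" where
  "primitive g x t = (LBINT \<tau>=0..t. g x \<tau>)"

definition energy ::
    "real \<Rightarrow> (real ^ 'n) set \<Rightarrow> (real ^ 'n \<Rightarrow> real \<Rightarrow> real) \<Rightarrow> real \<Rightarrow> real \<Rightarrow> real \<Rightarrow>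
     (real ^ 'n \<Rightarrow> real) \<Rightarrow> real" where
  "energy s \<Omega> g a b lam u = (let q = crit_exp CARD('n) s in
     a / 2 * X0_norm s \<Omega> u ^ 2 + b / 4 * X0_norm s \<Omega> u ^ 4
     - 1 / q * Lq_norm q \<Omega> u powr q
     - lam * (LINT x:\<Omega>|lebesgue. primitive g x (u x)))"

text \<open>
  The infimum is taken in \<open>ereal\<close>, since a real-valued infimum would be unspecified for an energy
  that is not bounded below.
\<close>

definition iota ::
    "real \<Rightarrow> (real ^ 'n) set \<Rightarrow> (real ^ 'n \<Rightarrow> real \<Rightarrow> real) \<Rightarrow> real \<Rightarrow> real \<Rightarrow> real \<Rightarrow> ereal" where
  "iota s \<Omega> g a b lam = (INF u \<in> X0_nonzero s \<Omega>. ereal (energy s \<Omega> g a b lam u))"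

end

theory Submission
  imports Defs "HOL-Complex_Analysis.Great_Picard"
begin

text \<open>
  The energy is minimized by the direct method. A minimizing sequence \<open>v\<^sub>n\<close> with negative energies is bounded
  in \<open>X\<^sub>0\<close>, because \<open>N > 4s\<close> means \<open>2\<^sup>* < 4\<close>, and a subsequence converges almost everywhere to some \<open>w\<close>: the
  averages of \<open>v\<^sub>n\<close> over the cubes of each grid converge along a subsequence, and the Gagliardo
  energy controls the distance to these averages in \<open>L\<^sup>1\<close>. The Brezis--Lieb lemma, applied to the difference
  quotients and to the functions themselves, splits off the energy of \<open>v\<^sub>n - w\<close> up to \<open>o(1)\<close>. What
  remains of \<open>v\<^sub>n - w\<close> is \<open>a/2 B + b/4 B\<^sup>2 - V/2\<^sup>*\<close>, with \<open>B\<close> its squared norm and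
  \<open>V \<le> (B/S)\<close> to the power \<open>2\<^sup>*/2\<close>, which is nonnegative by Young's inequality and the hypothesis on \<open>a\<close>, \<open>b\<close>.
  As the nonlinear term is subcritical, \<open>w\<close> is a minimizer. The infimum is negative for large \<open>\<lambda>\<close> since
  the primitive of \<open>g\<close> is positive away from \<open>0\<close>.
\<close>

section \<open>The Brezis--Lieb lemma\<close>

text \<open>The obstacle is the critical exponent q = \<open>crit_exp\<close>: \<open>X0\<close>
  does not embed compactly into L^q, so along a minimizing sequence part of the L^q mass may vanish
  in the limit, and the critical term enters the energy with a minus sign. Lower semicontinuity
  therefore cannot hold term by term; the a- and b-terms of the lost part have to pay for its
  critical term. The quartic term splits as (A + B)^2, with A and B the squared norms of the limit
  and the remainder; the cross term 2AB is nonnegative and can be discarded. The splitting asks only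
  for convergence almost everywhere, so the pointwise limit built from cube averages takes the place
  of a weak limit. The Sobolev inequality is established first because S > 0 has to be known: S is
  divided by in \<open>L_const\<close> and in the bound on V. Functions are replaced by Borel
  representatives that vanish everywhere off \<Omega>. For them the integral over Q is an integral
  over the whole product space, so Fubini applies directly, and membership in \<open>X0\<close>
  reduces to finite energy.\<close>

lemma abs_powr_diff_le:
  fixes x y p :: real
  assumes p: "1 < p" and "0 \<le> x" "0 \<le> y"
  shows "\<bar>x powr p - y powr p\<bar> \<le> p * (max x y) powr (p - 1) * \<bar>x - y\<bar>"
proof -
  have *: "u powr p - v powr p \<le> p * u powr (p - 1) * (u - v)" "v powr p \<le> u powr p"
    if v: "0 \<le> v" and vu: "v < u" for u v :: real
  proof -
    have c: "continuous_on {v..u} (\<lambda>t. t powr p)"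
      using that p by (intro continuous_on_powr' continuous_intros) auto
    obtain z where z: "v < z" "z < u" "u powr p - v powr p = (u - v) * (p * z powr (p - 1))"
    proof -
      have d: "((\<lambda>t. t powr p) has_real_derivative p * t powr (p - 1)) (at t)" if "v < t" for t
        using \<open>0 \<le> v\<close> that by (intro has_real_derivative_powr) auto
      have "\<exists>l z. v < z \<and> z < u \<and> ((\<lambda>t. t powr p) has_real_derivative l) (at z) \<and>
              u powr p - v powr p = (u - v) * l"
        using vu c by (rule MVT) (use d real_differentiable_def in blast)
      then obtain l z where "v < z" "z < u" "((\<lambda>t. t powr p) has_real_derivative l) (at z)"
        "u powr p - v powr p = (u - v) * l" by blast
      moreover have "l = p * z powr (p - 1)"
        using calculation d DERIV_unique by blast
      ultimately show ?thesis using that by blast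
    qed
    have "z powr (p - 1) \<le> u powr (p - 1)"
      using z that p by (intro powr_mono2) auto
    then have "(u - v) * (p * z powr (p - 1)) \<le> (u - v) * (p * u powr (p - 1))"
      using that p by (intro mult_left_mono) auto
    then show "u powr p - v powr p \<le> p * u powr (p - 1) * (u - v)"
      using z by (simp add: mult_ac)
    show "v powr p \<le> u powr p" using that p by (intro powr_mono2) auto
  qed
  show ?thesis
    using *[of y x] *[of x y] assms by (cases x y rule: linorder_cases) (auto simp: max_def)
qed

text \<open>The ratio of \<open>b\<close> to \<open>a\<close> decides. If \<bar>b\<bar> is at most
  \<eta>\<bar>a\<bar>, the mean value bound makes the difference a small multiple of
  \<bar>a\<bar>^p. Otherwise \<bar>a\<bar> is at most \<bar>b\<bar>/\<eta>, and every term goes into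
  C\<bar>b\<bar>^p.\<close>

lemma brezis_lieb_pointwise:
  fixes p \<epsilon> :: real
  assumes p: "1 < p" and e: "0 < \<epsilon>"
  obtains C where "0 \<le> C"
    "\<And>a b::real. \<bar>\<bar>a + b\<bar> powr p - \<bar>a\<bar> powr p - \<bar>b\<bar> powr p\<bar> \<le> \<epsilon> * \<bar>a\<bar> powr p + C * \<bar>b\<bar> powr p"
proof -
  \<comment> \<open>In the first case max(\<bar>a + b\<bar>, \<bar>a\<bar>) is at most
    2\<bar>a\<bar>, which yields p 2^(p-1) \<eta>; the summand 1 pays for \<bar>b\<bar>^p, since
    \<eta>^p \<le> \<eta> for \<eta> \<le> 1.\<close>
  define \<eta> where "\<eta> = min 1 (\<epsilon> / (p * 2 powr (p - 1) + 1))"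
  have den: "p * 2 powr (p - 1) + 1 > 0" using p by (intro add_pos_pos mult_pos_pos) auto
  have \<eta>: "0 < \<eta>" "\<eta> \<le> 1" "(p * 2 powr (p - 1) + 1) * \<eta> \<le> \<epsilon>"
  proof -
    show "0 < \<eta>" "\<eta> \<le> 1" using e den by (auto simp: \<eta>_def)
    have "\<eta> \<le> \<epsilon> / (p * 2 powr (p - 1) + 1)" by (simp add: \<eta>_def)
    then show "(p * 2 powr (p - 1) + 1) * \<eta> \<le> \<epsilon>" using den by (simp add: field_simps)
  qed
  define C where "C = (1 / \<eta> + 1) powr p + (1 / \<eta>) powr p + 1"
  have "\<bar>\<bar>a + b\<bar> powr p - \<bar>a\<bar> powr p - \<bar>b\<bar> powr p\<bar> \<le> \<epsilon> * \<bar>a\<bar> powr p + C * \<bar>b\<bar> powr p" for a b :: real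
  proof (cases "\<bar>b\<bar> \<le> \<eta> * \<bar>a\<bar>")
    case True
    have ba: "\<bar>b\<bar> \<le> \<bar>a\<bar>" using True \<eta> mult_right_mono[of \<eta> 1 "\<bar>a\<bar>"] by auto
    have *: "\<bar>a\<bar> powr (p - 1) * \<bar>a\<bar> = \<bar>a\<bar> powr p"
      by (cases "a = 0") (auto simp: powr_diff)
    have "\<bar>\<bar>a + b\<bar> powr p - \<bar>a\<bar> powr p\<bar> \<le> p * (max \<bar>a + b\<bar> \<bar>a\<bar>) powr (p - 1) * \<bar>\<bar>a + b\<bar> - \<bar>a\<bar>\<bar>"
      using p by (intro abs_powr_diff_le) auto
    also have "\<dots> \<le> p * (2 * \<bar>a\<bar>) powr (p - 1) * (\<eta> * \<bar>a\<bar>)"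
      using p ba True by (intro mult_mono mult_left_mono powr_mono2) auto
    also have "\<dots> = p * 2 powr (p - 1) * \<eta> * \<bar>a\<bar> powr p"
      using * by (simp add: powr_mult mult_ac)
    finally have 1: "\<bar>\<bar>a + b\<bar> powr p - \<bar>a\<bar> powr p\<bar> \<le> p * 2 powr (p - 1) * \<eta> * \<bar>a\<bar> powr p" .
    have "\<bar>b\<bar> powr p \<le> (\<eta> * \<bar>a\<bar>) powr p" using p True by (intro powr_mono2) auto
    also have "\<dots> = \<eta> powr p * \<bar>a\<bar> powr p" using \<eta> by (simp add: powr_mult)
    also have "\<eta> powr p \<le> \<eta> powr 1" using \<eta> p by (intro powr_mono') auto
    finally have 2: "\<bar>b\<bar> powr p \<le> \<eta> * \<bar>a\<bar> powr p"
      using \<eta> by (auto simp: mult_right_mono)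
    have "(p * 2 powr (p - 1) + 1) * \<eta> * \<bar>a\<bar> powr p \<le> \<epsilon> * \<bar>a\<bar> powr p"
      using \<eta> by (intro mult_right_mono) auto
    moreover have "0 \<le> C * \<bar>b\<bar> powr p" using \<eta> unfolding C_def by (intro mult_nonneg_nonneg add_nonneg_nonneg) auto
    moreover have "(p * 2 powr (p - 1) + 1) * \<eta> * \<bar>a\<bar> powr p =
        p * 2 powr (p - 1) * \<eta> * \<bar>a\<bar> powr p + \<eta> * \<bar>a\<bar> powr p"
      by (simp add: algebra_simps)
    moreover have "0 \<le> \<bar>b\<bar> powr p" by simp
    moreover have "\<bar>X - Y - Z\<bar> \<le> E + F"
      if "\<bar>X - Y\<bar> \<le> T" "Z \<le> U" "0 \<le> Z" "T + U \<le> E" "0 \<le> F" for X Y Z T U E F :: real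
      using that by linarith
    ultimately show ?thesis using 1 2 by metis
  next
    case False
    have ab: "\<bar>a\<bar> \<le> 1 / \<eta> * \<bar>b\<bar>" using False \<eta> by (simp add: field_simps)
    have "\<bar>a + b\<bar> powr p \<le> ((1 / \<eta> + 1) * \<bar>b\<bar>) powr p"
      using p ab by (intro powr_mono2) (auto simp: algebra_simps)
    then have 1: "\<bar>a + b\<bar> powr p \<le> (1 / \<eta> + 1) powr p * \<bar>b\<bar> powr p"
      using \<eta> by (simp add: powr_mult)
    have "\<bar>a\<bar> powr p \<le> (1 / \<eta> * \<bar>b\<bar>) powr p"
      using p ab by (intro powr_mono2) (auto simp: algebra_simps)
    also have "\<dots> = (1 / \<eta>) powr p * \<bar>b\<bar> powr p" using \<eta> by (subst powr_mult) auto
    finally have 2: "\<bar>a\<bar> powr p \<le> (1 / \<eta>) powr p * \<bar>b\<bar> powr p" .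
    have "0 \<le> \<epsilon> * \<bar>a\<bar> powr p" using e by simp
    moreover have "0 \<le> \<bar>a\<bar> powr p" "0 \<le> \<bar>b\<bar> powr p" "0 \<le> \<bar>a + b\<bar> powr p" by auto
    moreover have "C * \<bar>b\<bar> powr p = (1 / \<eta> + 1) powr p * \<bar>b\<bar> powr p + (1 / \<eta>) powr p * \<bar>b\<bar> powr p + \<bar>b\<bar> powr p"
      by (simp add: C_def algebra_simps)
    moreover have "\<bar>X - Y - Z\<bar> \<le> E + F"
      if "0 \<le> E" "0 \<le> X" "0 \<le> Y" "0 \<le> Z" "F = T + U + Z" "X \<le> T" "Y \<le> U" for X Y Z T U E F :: real
      using that by linarith
    ultimately show ?thesis using 1 2 by metis
  qed
  moreover have "0 \<le> C" using \<eta> unfolding C_def by (intro add_nonneg_nonneg) auto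
  ultimately show ?thesis using that by blast
qed

lemma abs_diff_powr_le:
  fixes x y p :: real
  assumes "0 < p"
  shows "\<bar>x - y\<bar> powr p \<le> 2 powr p * (\<bar>x\<bar> powr p + \<bar>y\<bar> powr p)"
proof -
  have "\<bar>x - y\<bar> powr p \<le> (2 * max \<bar>x\<bar> \<bar>y\<bar>) powr p" using assms by (intro powr_mono2) auto
  also have "\<dots> = 2 powr p * (max \<bar>x\<bar> \<bar>y\<bar>) powr p" by (simp add: powr_mult)
  also have "(max \<bar>x\<bar> \<bar>y\<bar>) powr p \<le> \<bar>x\<bar> powr p + \<bar>y\<bar> powr p" by (simp add: max_def)
  finally show ?thesis by simp
qed

text \<open>Fatou's lemma for Bochner integrals. The bound is asked for only infinitely often, which
  is what the negation of an eventual estimate supplies; 0 \<le> K follows from the nonnegative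
  integrands.\<close>

lemma fatou_real:
  fixes f :: "nat \<Rightarrow> 'a \<Rightarrow> real"
  assumes [measurable]: "\<And>n. f n \<in> borel_measurable M" "g \<in> borel_measurable M"
    and lim: "AE x in M. (\<lambda>n. f n x) \<longlonglongrightarrow> g x"
    and nonneg: "\<And>n. AE x in M. 0 \<le> f n x" 
    and int: "\<And>n. integrable M (f n)" and bound: "frequently (\<lambda>n. integral\<^sup>L M (f n) \<le> K) sequentially"
  shows "integrable M g" "integral\<^sup>L M g \<le> K"
proof -
  have nn: "AE x in M. \<forall>n. 0 \<le> f n x" using nonneg by (simp add: AE_all_countable)
  have gn: "AE x in M. 0 \<le> g x"
    using lim nn by eventually_elim (rule LIMSEQ_le_const, auto)
  have "(\<integral>\<^sup>+x. ennreal (g x) \<partial>M) = (\<integral>\<^sup>+x. liminf (\<lambda>n. ennreal (f n x)) \<partial>M)"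
  proof (intro nn_integral_cong_AE, use lim in eventually_elim)
    case (elim x)
    then have "(\<lambda>n. ennreal (f n x)) \<longlonglongrightarrow> ennreal (g x)" by (rule tendsto_ennrealI)
    then show ?case by (simp add: lim_imp_Liminf)
  qed
  also have "\<dots> \<le> liminf (\<lambda>n. \<integral>\<^sup>+x. ennreal (f n x) \<partial>M)"
    by (rule nn_integral_liminf) auto
  also have "\<dots> = liminf (\<lambda>n. ennreal (integral\<^sup>L M (f n)))"
    by (simp add: nn_integral_eq_integral int nonneg)
  also have "\<dots> \<le> ennreal K"
  proof (rule ccontr)
    assume "\<not> ?thesis"
    then have "eventually (\<lambda>n. ennreal K < ennreal (integral\<^sup>L M (f n))) sequentially"
      by (auto intro: less_LiminfD simp: not_le)
    then have "frequently (\<lambda>n. False) sequentially"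
      using bound by (rule_tac frequently_rev_mp[OF bound]) (auto elim!: eventually_mono simp: ennreal_leI leD)
    then show False by simp
  qed
  finally have le: "(\<integral>\<^sup>+x. ennreal (g x) \<partial>M) \<le> ennreal K" .
  show "integrable M g"
    using le gn by (intro integrableI_nonneg) (auto intro: le_less_trans)
  then have "ennreal (integral\<^sup>L M g) \<le> ennreal K"
    using le gn by (simp add: nn_integral_eq_integral)
  moreover obtain n where "integral\<^sup>L M (f n) \<le> K" using bound frequently_ex by blast
  then have "0 \<le> K" using integral_nonneg_AE[OF nonneg[of n]] by linarith
  ultimately show "integral\<^sup>L M g \<le> K" by simp
qed

text \<open>The pointwise inequality with a = f n - g and b = g bounds the defect \<open>D\<close>
  by \<epsilon>\<bar>f n - g\<bar>^p, whose integral is at most \<epsilon>K' for all n, plus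
  C\<bar>g\<bar>^p, which does not depend on n and so can serve as a dominating function. That
  \<open>g\<close> is in L^p comes from Fatou.\<close>

lemma brezis_lieb:
  fixes f :: "nat \<Rightarrow> 'a \<Rightarrow> real"
  assumes p: "1 < p"
    and [measurable]: "\<And>n. f n \<in> borel_measurable M" "g \<in> borel_measurable M"
    and lim: "AE x in M. (\<lambda>n. f n x) \<longlonglongrightarrow> g x"
    and int: "\<And>n. integrable M (\<lambda>x. \<bar>f n x\<bar> powr p)"
    and bound: "\<And>n. (\<integral>x. \<bar>f n x\<bar> powr p \<partial>M) \<le> K"
  shows "integrable M (\<lambda>x. \<bar>g x\<bar> powr p)"
    and "\<And>n. integrable M (\<lambda>x. \<bar>f n x - g x\<bar> powr p)"
    and "(\<lambda>n. (\<integral>x. \<bar>f n x\<bar> powr p \<partial>M) - (\<integral>x. \<bar>f n x - g x\<bar> powr p \<partial>M))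
           \<longlonglongrightarrow> (\<integral>x. \<bar>g x\<bar> powr p \<partial>M)"
proof -
  have limp: "AE x in M. (\<lambda>n. \<bar>f n x\<bar> powr p) \<longlonglongrightarrow> \<bar>g x\<bar> powr p"
    using lim
  proof eventually_elim
    case (elim x)
    show ?case using p by (intro tendsto_powr' tendsto_rabs tendsto_const elim) auto
  qed
  have gK: "integrable M (\<lambda>x. \<bar>g x\<bar> powr p)" "(\<integral>x. \<bar>g x\<bar> powr p \<partial>M) \<le> K"
    by (rule fatou_real[OF _ _ limp _ int, where K = K]; use bound in auto)+
  show g: "integrable M (\<lambda>x. \<bar>g x\<bar> powr p)" by fact
  have dle: "\<bar>f n x - g x\<bar> powr p \<le> 2 powr p * (\<bar>f n x\<bar> powr p + \<bar>g x\<bar> powr p)" for n x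
    using p by (intro abs_diff_powr_le) auto
  have int2: "integrable M (\<lambda>x. 2 powr p * (\<bar>f n x\<bar> powr p + \<bar>g x\<bar> powr p))" for n
    using int g by auto
  show d: "\<And>n. integrable M (\<lambda>x. \<bar>f n x - g x\<bar> powr p)"
    by (rule Bochner_Integration.integrable_bound[OF int2]) (use dle in auto)
  define K' where "K' = 2 powr p * (K + K)"
  have dK: "(\<integral>x. \<bar>f n x - g x\<bar> powr p \<partial>M) \<le> K'" for n
  proof -
    have "(\<integral>x. \<bar>f n x - g x\<bar> powr p \<partial>M) \<le> (\<integral>x. 2 powr p * (\<bar>f n x\<bar> powr p + \<bar>g x\<bar> powr p) \<partial>M)"
      by (intro integral_mono d int2 dle)
    also have "\<dots> = 2 powr p * ((\<integral>x. \<bar>f n x\<bar> powr p \<partial>M) + (\<integral>x. \<bar>g x\<bar> powr p \<partial>M))"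
      using int g by simp
    also have "\<dots> \<le> K'" unfolding K'_def using bound[of n] gK by (intro mult_left_mono add_mono) auto
    finally show ?thesis .
  qed
  have "0 \<le> (\<integral>x. \<bar>f 0 x - g x\<bar> powr p \<partial>M)"
    by (intro Bochner_Integration.integral_nonneg) auto
  then have K': "0 \<le> K'" using dK[of 0] by linarith
  define D where "D n x = \<bar>f n x\<bar> powr p - \<bar>f n x - g x\<bar> powr p - \<bar>g x\<bar> powr p" for n x
  have [measurable]: "D n \<in> borel_measurable M" for n unfolding D_def by measurable
  have Dint: "integrable M (D n)" for n unfolding D_def using int d g by auto
  have D0: "(\<lambda>n. integral\<^sup>L M (D n)) \<longlonglongrightarrow> 0"
  proof (rule LIMSEQ_I)
    fix e :: real assume e: "0 < e"
    define \<epsilon> where "\<epsilon> = e / (2 * (K' + 1))"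
    have \<epsilon>: "0 < \<epsilon>" "\<epsilon> * K' \<le> e / 2" using e K' by (auto simp: \<epsilon>_def field_simps)
    obtain C where C: "0 \<le> C"
      "\<And>a b::real. \<bar>\<bar>a + b\<bar> powr p - \<bar>a\<bar> powr p - \<bar>b\<bar> powr p\<bar> \<le> \<epsilon> * \<bar>a\<bar> powr p + C * \<bar>b\<bar> powr p"
      using brezis_lieb_pointwise[OF p \<epsilon>(1)] by blast
    \<comment> \<open>The part of the defect not covered by the \<epsilon>-term: it is dominated by
      C\<bar>g\<bar>^p and tends to 0 a.e., so dominated convergence applies to it although it does
      not apply to \<open>D\<close>.\<close>
    define W where "W n x = max 0 (\<bar>D n x\<bar> - \<epsilon> * \<bar>f n x - g x\<bar> powr p)" for n x
    have [measurable]: "W n \<in> borel_measurable M" for n unfolding W_def by measurable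
    have Wle: "W n x \<le> C * \<bar>g x\<bar> powr p" for n x
      using C(2)[of "f n x - g x" "g x"] C(1) by (auto simp: W_def D_def)
    have Wnn: "0 \<le> W n x" for n x by (simp add: W_def)
    have Wlim: "AE x in M. (\<lambda>n. W n x) \<longlonglongrightarrow> 0"
      using lim limp
    proof eventually_elim
      case (elim x)
      have "(\<lambda>n. \<bar>f n x - g x\<bar> powr p) \<longlonglongrightarrow> \<bar>g x - g x\<bar> powr p"
        using p by (intro tendsto_powr' tendsto_rabs tendsto_const tendsto_diff elim) auto
      then have d0: "(\<lambda>n. \<bar>f n x - g x\<bar> powr p) \<longlonglongrightarrow> 0" using p by simp
      have "(\<lambda>n. W n x) \<longlonglongrightarrow> max 0 (\<bar>\<bar>g x\<bar> powr p - 0 - \<bar>g x\<bar> powr p\<bar> - \<epsilon> * 0)"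
        unfolding W_def D_def using elim d0
        by (intro tendsto_max tendsto_diff tendsto_rabs tendsto_mult tendsto_const)
      then show ?case by simp
    qed
    have Wi: "(\<lambda>n. integral\<^sup>L M (W n)) \<longlonglongrightarrow> (\<integral>x. 0 \<partial>M)"
      by (rule integral_dominated_convergence[where w = "\<lambda>x. C * \<bar>g x\<bar> powr p"])
        (use g Wlim Wle Wnn in auto)
    have Wint: "integrable M (W n)" for n
      by (rule Bochner_Integration.integrable_bound[where f = "\<lambda>x. C * \<bar>g x\<bar> powr p"])
        (use g Wle Wnn C(1) in auto)
    have "\<forall>\<^sub>F n in sequentially. integral\<^sup>L M (W n) < e / 2"
      using Wi e by (intro order_tendstoD(2)[OF Wi]) auto
    then have "\<forall>\<^sub>F n in sequentially. \<bar>integral\<^sup>L M (D n)\<bar> < e"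
    proof eventually_elim
      case (elim n)
      have "\<bar>integral\<^sup>L M (D n)\<bar> \<le> (\<integral>x. \<bar>D n x\<bar> \<partial>M)" by (rule integral_abs_bound)
      also have "\<dots> \<le> (\<integral>x. W n x + \<epsilon> * \<bar>f n x - g x\<bar> powr p \<partial>M)"
        using Dint Wint d by (intro integral_mono) (auto simp: W_def)
      also have "\<dots> = integral\<^sup>L M (W n) + \<epsilon> * (\<integral>x. \<bar>f n x - g x\<bar> powr p \<partial>M)"
        using Wint d by simp
      also have "\<dots> \<le> integral\<^sup>L M (W n) + \<epsilon> * K'"
        using dK[of n] \<epsilon> by (intro add_left_mono mult_left_mono) auto
      finally show ?case using elim \<epsilon> by linarith
    qed
    then show "\<exists>no. \<forall>n\<ge>no. norm (integral\<^sup>L M (D n) - 0) < e"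
      by (auto simp: eventually_sequentially)
  qed
  have "integral\<^sup>L M (D n) + (\<integral>x. \<bar>g x\<bar> powr p \<partial>M) =
      (\<integral>x. \<bar>f n x\<bar> powr p \<partial>M) - (\<integral>x. \<bar>f n x - g x\<bar> powr p \<partial>M)" for n
    unfolding D_def using int d g by simp
  then show "(\<lambda>n. (\<integral>x. \<bar>f n x\<bar> powr p \<partial>M) - (\<integral>x. \<bar>f n x - g x\<bar> powr p \<partial>M))
           \<longlonglongrightarrow> (\<integral>x. \<bar>g x\<bar> powr p \<partial>M)"
    using tendsto_add[OF D0 tendsto_const[of "\<integral>x. \<bar>g x\<bar> powr p \<partial>M"]] by simp
qed

section \<open>The fractional Sobolev inequality\<close>

text \<open>Integrated over the whole product space and valued in \<open>ennreal\<close>, so that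
  finite energy is a statement about the value and Tonelli holds without integrability
  conditions.\<close>

definition gagliardo :: "real \<Rightarrow> (real ^ 'n \<Rightarrow> real) \<Rightarrow> ennreal" where
  "gagliardo s u = (\<integral>\<^sup>+ p. ennreal (gagliardo_kernel s u p) \<partial>lborel)"

lemma measurable_gagliardo_kernel [measurable]:
  fixes u :: "real ^ 'n \<Rightarrow> real"
  assumes [measurable]: "u \<in> borel_measurable borel"
  shows "gagliardo_kernel s u \<in> borel_measurable borel"
  unfolding gagliardo_kernel_def borel_prod[symmetric] by measurable

lemma gagliardo_kernel_nonneg [simp]: "0 \<le> gagliardo_kernel s u p"
  by (cases p) (simp add: gagliardo_kernel_def)

lemma gagliardo_iterated:
  fixes u :: "real ^ 'n \<Rightarrow> real"
  assumes [measurable]: "u \<in> borel_measurable borel"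
  shows "gagliardo s u = (\<integral>\<^sup>+ x. \<integral>\<^sup>+ y. ennreal (gagliardo_kernel s u (x, y)) \<partial>lborel \<partial>lborel)"
proof -
  have "(\<lambda>p. ennreal (gagliardo_kernel s u p)) \<in> borel_measurable (lborel \<Otimes>\<^sub>M lborel)"
    unfolding lborel_prod by measurable
  then show ?thesis
    unfolding gagliardo_def by (subst lborel.nn_integral_fst) (auto simp: lborel_prod)
qed

text \<open>q < 4 is a rewriting of N > 4s. The last identity is the scaling relation that makes the
  slice estimate homogeneous of degree q in \<bar>u x\<bar>; the third one turns m^(1 - 2s/N) into
  m^(2/q).\<close>

lemma crit_exp_facts:
  assumes "0 < s" "4 * s < real N"
  shows "2 < crit_exp N s" "crit_exp N s < 4" "1 - 2 * s / real N = 2 / crit_exp N s"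
    "2 + 2 * s * crit_exp N s / real N = crit_exp N s"
proof -
  define D where "D = real N - 2 * s"
  have D: "0 < D" "2 * s < D" "real N = D + 2 * s" using assms by (auto simp: D_def)
  have q: "crit_exp N s = 2 * (D + 2 * s) / D" by (simp add: crit_exp_def D_def)
  show "2 < crit_exp N s" "crit_exp N s < 4" unfolding q using D assms by (simp_all add: field_simps)
  have D2: "D + 2 * s \<noteq> 0" using D assms by simp
  show "1 - 2 * s / real N = 2 / crit_exp N s"
    unfolding q D(3) using D D2 by (simp add: field_simps)
  have "2 * (D + 2 * s) / D / (D + 2 * s) = 2 / D" 
  proof -
    have "2 * E / D / E = 2 / D" if "E \<noteq> 0" for E using that by simp
    from this[OF D2] show ?thesis .
  qed
  then have e: "crit_exp N s / real N = 2 / D" unfolding q D(3) .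
  have "2 + 2 * s * (crit_exp N s / real N) = crit_exp N s"
    unfolding e using D by (simp add: q field_simps)
  then show "2 + 2 * s * crit_exp N s / real N = crit_exp N s" by simp
qed

text \<open>
  With \<open>t = \<bar>u x\<bar>\<close>, Chebyshev bounds the measure of \<open>{\<bar>u\<bar> > t/2}\<close> by \<open>(2/t)\<^sup>q m\<close>. The radius \<open>R\<close> is chosen
  such that the ball about \<open>x\<close> has twice that measure; on at least half of it \<open>\<bar>u x - u y\<bar> \<ge> t/2\<close>.
\<close>

lemma gagliardo_slice_lower:
  fixes u :: "real ^ 'n \<Rightarrow> real" and s :: real
  defines "q \<equiv> crit_exp CARD('n) s" and "c \<equiv> unit_ball_vol (real CARD('n))" and "N \<equiv> real CARD('n)"
  assumes s: "0 < s" "4 * s < N"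
    and [measurable]: "u \<in> borel_measurable borel"
    and int: "integrable lborel (\<lambda>x. \<bar>u x\<bar> powr q)"
    and m: "m = (\<integral>x. \<bar>u x\<bar> powr q \<partial>lborel)" "0 < m"
    and ux: "u x \<noteq> 0"
  shows "ennreal (c / 8 * (2 powr (q + 1) / c) powr (- 2 * s / N) * m powr (- 2 * s / N) * \<bar>u x\<bar> powr q)
          \<le> (\<integral>\<^sup>+ y. ennreal (gagliardo_kernel s u (x, y)) \<partial>lborel)"
proof -
  define t where "t = \<bar>u x\<bar>"
  have t: "0 < t" using ux by (simp add: t_def)
  have c: "0 < c" by (simp add: c_def)
  have N: "0 < N" by (simp add: N_def)
  have q: "2 < q" "2 + 2 * s * q / N = q"
    using crit_exp_facts[of s "CARD('n)"] s by (auto simp: q_def N_def)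
  define A where "A = 2 powr (q + 1) * m * t powr (- q) / c"
  have A: "0 < A" using m t c by (simp add: A_def)
  define R where "R = A powr (1 / N)"
  have R: "0 < R" using A by (simp add: R_def)
  have RN: "R powr N = A" using A N by (simp add: R_def powr_powr)
  define E where "E = {y. t / 2 < \<bar>u y\<bar>}"
  have [measurable]: "E \<in> sets borel" unfolding E_def by measurable
  have "ennreal ((t / 2) powr q) * emeasure lborel E = (\<integral>\<^sup>+ y. ennreal ((t / 2) powr q) * indicator E y \<partial>lborel)"
    by (simp add: nn_integral_cmult_indicator)
  also have "\<dots> \<le> (\<integral>\<^sup>+ y. ennreal (\<bar>u y\<bar> powr q) \<partial>lborel)"
    using t q by (intro nn_integral_mono) (auto simp: E_def indicator_def intro!: ennreal_leI powr_mono2)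
  also have "\<dots> = ennreal m"
    using int m by (simp add: nn_integral_eq_integral)
  finally have E1: "ennreal ((t / 2) powr q) * emeasure lborel E \<le> ennreal m" .
  have E2: "emeasure lborel E \<le> ennreal (c * A / 2)"
  proof (cases "emeasure lborel E")
    case (real e)
    then have "(t / 2) powr q * e \<le> m" using E1 m by (simp flip: ennreal_mult')
    moreover have "(t / 2) powr q = t powr q / 2 powr q" using t by (simp add: powr_divide)
    moreover have "c * A / 2 = 2 powr q * m / t powr q"
      using c by (simp add: A_def powr_add powr_minus_divide)
    ultimately have "e \<le> c * A / 2"
      using t by (simp add: pos_le_divide_eq pos_divide_le_eq mult_ac)
    then show ?thesis using real by (simp add: ennreal_leI)
  next
    case top
    then show ?thesis using E1 t by (simp add: ennreal_mult_top top_unique)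
  qed
  have "ennreal (c * A) = emeasure lborel (ball x R)"
    using R RN by (simp add: emeasure_ball c_def N_def powr_realpow)
  also have "\<dots> \<le> emeasure lborel ((ball x R - E) \<union> E)"
    by (intro emeasure_mono) auto
  also have "\<dots> \<le> emeasure lborel (ball x R - E) + emeasure lborel E"
    by (intro emeasure_subadditive) auto
  also have "\<dots> \<le> emeasure lborel (ball x R - E) + ennreal (c * A / 2)"
    using E2 by (intro add_left_mono)
  finally have "ennreal (c * A) \<le> emeasure lborel (ball x R - E) + ennreal (c * A / 2)" .
  then have D: "ennreal (c * A / 2) \<le> emeasure lborel (ball x R - E)"
  proof (cases "emeasure lborel (ball x R - E)")
    case (real e)
    then have "ennreal (c * A) \<le> ennreal (e + c * A / 2)"
      using \<open>ennreal (c * A) \<le> _\<close> A c by simp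
    then have "c * A \<le> e + c * A / 2" using real A c by (subst (asm) ennreal_le_iff) auto
    then show ?thesis using real by (auto intro!: ennreal_leI)
  qed auto
  have ker: "(t / 2)\<^sup>2 / R powr (N + 2 * s) \<le> gagliardo_kernel s u (x, y)" if y: "y \<in> ball x R - E" for y
  proof -
    have "\<bar>u y\<bar> \<le> t / 2" using y by (simp add: E_def)
    then have uy: "t / 2 \<le> \<bar>u x - u y\<bar>" unfolding t_def by linarith
    then have ne: "x \<noteq> y" using t by auto
    have "(t / 2)\<^sup>2 \<le> \<bar>u x - u y\<bar>\<^sup>2" using uy t by (intro power_mono) auto
    moreover have "norm (x - y) powr (N + 2 * s) \<le> R powr (N + 2 * s)"
      using y N s by (intro powr_mono2) (auto simp: dist_norm)
    ultimately show ?thesis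
      using ne R unfolding gagliardo_kernel_def by (auto intro!: frac_le simp: N_def)
  qed
  \<comment> \<open>Criticality of \<open>q\<close> enters here: the powers of \<open>t\<close>
    combine to t^q, so integrating the slice bound over x reproduces \<open>m\<close>.\<close>
  have t2: "t\<^sup>2 * (t powr (- q)) powr (- 2 * s / N) = t powr q"
  proof -
    have "t\<^sup>2 * (t powr (- q)) powr (- 2 * s / N) = t powr 2 * t powr (2 * s * q / N)"
      using t by (simp add: powr_powr mult_ac powr_numeral)
    also have "\<dots> = t powr (2 + 2 * s * q / N)" by (simp add: powr_add)
    finally show ?thesis using q by simp
  qed
  have RA: "R powr (- 2 * s) = A powr (- 2 * s / N)" by (simp add: R_def powr_powr)
  have A2: "A powr (- 2 * s / N) =
     (2 powr (q + 1) / c) powr (- 2 * s / N) * m powr (- 2 * s / N) * (t powr (- q)) powr (- 2 * s / N)"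
  proof -
    have *: "(x * y * z) powr r = x powr r * y powr r * z powr r"
      if "0 < x" "0 < y" "0 < z" for x y z r :: real
      using that by (simp add: powr_mult)
    have "A = (2 powr (q + 1) / c) * m * t powr (- q)" by (simp add: A_def)
    then show ?thesis using c m t by (simp only:) (rule *, auto)
  qed
  \<comment> \<open>Lower bound of the kernel times lower bound of the measure. As A = R^N, the
    factor R^(-2s) is left, and 1/4 times 1/2 gives c/8.\<close>
  have "(t / 2)\<^sup>2 / R powr (N + 2 * s) * (c * A / 2) = c / 8 * t\<^sup>2 * R powr (- 2 * s)"
    using R A RN by (simp add: powr_add powr_minus_divide power_divide)
  also have "\<dots> = c / 8 * (2 powr (q + 1) / c) powr (- 2 * s / N) * m powr (- 2 * s / N) *
        (t\<^sup>2 * (t powr (- q)) powr (- 2 * s / N))"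
    unfolding RA A2 by (simp only: mult_ac)
  also have "\<dots> = c / 8 * (2 powr (q + 1) / c) powr (- 2 * s / N) * m powr (- 2 * s / N) * t powr q"
    unfolding t2 ..
  finally have eq: "(t / 2)\<^sup>2 / R powr (N + 2 * s) * (c * A / 2) =
      c / 8 * (2 powr (q + 1) / c) powr (- 2 * s / N) * m powr (- 2 * s / N) * t powr q" .
  have "ennreal (c / 8 * (2 powr (q + 1) / c) powr (- 2 * s / N) * m powr (- 2 * s / N) * t powr q) =
      ennreal ((t / 2)\<^sup>2 / R powr (N + 2 * s)) * ennreal (c * A / 2)"
    unfolding eq[symmetric] using A c by (intro ennreal_mult'') auto
  also have "\<dots> \<le> ennreal ((t / 2)\<^sup>2 / R powr (N + 2 * s)) * emeasure lborel (ball x R - E)"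
    by (intro mult_left_mono D) auto
  also have "\<dots> = (\<integral>\<^sup>+ y. ennreal ((t / 2)\<^sup>2 / R powr (N + 2 * s)) * indicator (ball x R - E) y \<partial>lborel)"
    by (intro nn_integral_cmult_indicator[symmetric]) auto
  also have "\<dots> \<le> (\<integral>\<^sup>+ y. ennreal (gagliardo_kernel s u (x, y)) \<partial>lborel)"
    using ker by (intro nn_integral_mono) (auto simp: indicator_def intro!: ennreal_leI)
  finally show ?thesis by (simp add: t_def)
qed

lemma gagliardo_mono:
  assumes "\<And>x y. \<bar>v x - v y\<bar> \<le> \<bar>u x - u y\<bar>"
  shows "gagliardo s v \<le> gagliardo s u"
proof -
  have "gagliardo_kernel s v p \<le> gagliardo_kernel s u p" for p
    unfolding gagliardo_kernel_def case_prod_beta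
    by (intro divide_right_mono power_mono assms) auto
  then show ?thesis unfolding gagliardo_def by (intro nn_integral_mono ennreal_leI)
qed

lemma abs_clip_diff_le:
  fixes a b k :: real
  assumes "0 \<le> k"
  shows "\<bar>max (- k) (min k a) - max (- k) (min k b)\<bar> \<le> \<bar>a - b\<bar>"
proof -
  have "max (- k) (min k a) - max (- k) (min k b) \<le> \<bar>a - b\<bar>" for a b
    unfolding max_def min_def by auto
  from this[of a b] this[of b a] show ?thesis by (simp add: abs_le_iff abs_minus_commute)
qed

text \<open>Integrating the slice bound over x gives \<kappa> m^(-2s/N) m = \<kappa> m^(2/q) below
  the energy. This presupposes finite \<open>m\<close>. Clipping at height k is 1-Lipschitz, hence
  does not raise the energy, and bounded \<Omega> puts the clipped functions into L^q.\<close>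

lemma fractional_sobolev:
  fixes s :: real and \<Omega> :: "(real ^ 'n) set"
  defines "q \<equiv> crit_exp CARD('n) s"
  assumes s: "0 < s" "4 * s < real CARD('n)" and \<Omega>: "bounded \<Omega>"
  obtains \<kappa> where "0 < \<kappa>"
    "\<And>u. u \<in> borel_measurable borel \<Longrightarrow> (\<And>x. x \<notin> \<Omega> \<Longrightarrow> u x = 0) \<Longrightarrow> gagliardo s u < \<infinity> \<Longrightarrow>
      integrable lborel (\<lambda>x. \<bar>u x\<bar> powr q) \<and>
      \<kappa> * (\<integral>x. \<bar>u x\<bar> powr q \<partial>lborel) powr (2 / q) \<le> enn2real (gagliardo s u)"
proof -
  define N c where "N = real CARD('n)" and "c = unit_ball_vol (real CARD('n))"
  define \<kappa> where "\<kappa> = c / 8 * (2 powr (q + 1) / c) powr (- 2 * s / N)"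
  have c: "0 < c" by (simp add: c_def)
  have N: "0 < N" by (simp add: N_def)
  have q: "2 < q" "1 - 2 * s / N = 2 / q"
    using crit_exp_facts[of s "CARD('n)"] s by (auto simp: q_def N_def)
  have \<kappa>: "0 < \<kappa>" using c by (simp add: \<kappa>_def)
  have *: "\<kappa> * (\<integral>x. \<bar>u x\<bar> powr q \<partial>lborel) powr (2 / q) \<le> enn2real (gagliardo s u)"
    if [measurable]: "u \<in> borel_measurable borel" and int: "integrable lborel (\<lambda>x. \<bar>u x\<bar> powr q)"
      and fin: "gagliardo s u < \<infinity>" for u :: "real ^ 'n \<Rightarrow> real"
  proof (cases "(\<integral>x. \<bar>u x\<bar> powr q \<partial>lborel) = 0")
    case False
    define m where "m = (\<integral>x. \<bar>u x\<bar> powr q \<partial>lborel)"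
    have "0 \<le> m" unfolding m_def by (intro Bochner_Integration.integral_nonneg) auto
    moreover have "m \<noteq> 0" using False by (simp add: m_def)
    ultimately have m: "0 < m" by simp
    have "ennreal (\<kappa> * m powr (2 / q)) = ennreal (\<kappa> * m powr (- 2 * s / N)) * ennreal m"
    proof -
      have "2 / q = 1 + (- 2 * s / N)" using q by simp
      then have "m powr (2 / q) = m powr 1 * m powr (- 2 * s / N)" by (simp only: powr_add)
      then show ?thesis using m \<kappa> by (simp add: ennreal_mult'[symmetric] mult_ac)
    qed
    also have "\<dots> = ennreal (\<kappa> * m powr (- 2 * s / N)) * (\<integral>\<^sup>+x. ennreal (\<bar>u x\<bar> powr q) \<partial>lborel)"
      using int by (simp add: nn_integral_eq_integral m_def)
    also have "\<dots> = (\<integral>\<^sup>+x. ennreal (\<kappa> * m powr (- 2 * s / N) * \<bar>u x\<bar> powr q) \<partial>lborel)"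
      using \<kappa> by (subst nn_integral_cmult[symmetric]) (auto simp: ennreal_mult'')
    also have "\<dots> \<le> (\<integral>\<^sup>+ x. \<integral>\<^sup>+ y. ennreal (gagliardo_kernel s u (x, y)) \<partial>lborel \<partial>lborel)"
    proof (intro nn_integral_mono)
      fix x
      show "ennreal (\<kappa> * m powr (- 2 * s / N) * \<bar>u x\<bar> powr q)
          \<le> (\<integral>\<^sup>+ y. ennreal (gagliardo_kernel s u (x, y)) \<partial>lborel)"
      proof (cases "u x = 0")
        case False
        show ?thesis
          using gagliardo_slice_lower[of s u m x] s int m_def m False
          by (simp add: \<kappa>_def c_def N_def q_def)
      qed simp
    qed
    also have "\<dots> = gagliardo s u" by (simp add: gagliardo_iterated)
    finally show ?thesis
      using fin \<kappa> unfolding m_def[symmetric]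
      by (cases "gagliardo s u") auto
  qed auto
  show ?thesis
  proof (rule that[OF \<kappa>])
    fix u :: "real ^ 'n \<Rightarrow> real"
    assume [measurable]: "u \<in> borel_measurable borel" and u0: "\<And>x. x \<notin> \<Omega> \<Longrightarrow> u x = 0"
      and fin: "gagliardo s u < \<infinity>"
    txt \<open>Truncation makes the \<open>L\<^sup>q\<close> norm finite a priori, so that it can be divided out.\<close>
    define v where "v k x = max (- real k) (min (real k) (u x))" for k x
    have [measurable]: "v k \<in> borel_measurable borel" for k unfolding v_def by measurable
    have gv: "gagliardo s (v k) \<le> gagliardo s u" for k
      unfolding v_def by (rule gagliardo_mono) (rule abs_clip_diff_le, simp)
    obtain B where B: "\<Omega> \<subseteq> cball 0 B" using bounded_subset_ballD[OF \<Omega>, of 0] ball_subset_cball by blast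
    have iv: "integrable lborel (\<lambda>x. \<bar>v k x\<bar> powr q)" for k
    proof (rule Bochner_Integration.integrable_bound)
      show "integrable lborel (\<lambda>x. real k powr q * indicator (cball 0 B) (x :: real ^ 'n) :: real)"
        using emeasure_lborel_cball_finite[of "0 :: real ^ 'n" B]
        by (intro integrable_mult_right integrable_real_indicator) auto
      show "AE x in lborel. norm (\<bar>v k x\<bar> powr q) \<le> norm (real k powr q * indicator (cball 0 B) (x :: real ^ 'n) :: real)"
      proof (intro AE_I2)
        fix x :: "real ^ 'n"
        have "\<bar>v k x\<bar> powr q \<le> real k powr q" using q by (intro powr_mono2) (auto simp: v_def)
        moreover have "v k x = 0" if "x \<notin> cball 0 B"
        proof -
          have "u x = 0" using that B by (intro u0) auto
          then show ?thesis by (simp add: v_def)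
        qed
        ultimately show "norm (\<bar>v k x\<bar> powr q) \<le> norm (real k powr q * indicator (cball 0 B) (x :: real ^ 'n) :: real)"
          by (auto simp: indicator_def)
      qed
    qed measurable
    define G where "G = enn2real (gagliardo s u)"
    have le: "(\<integral>x. \<bar>v k x\<bar> powr q \<partial>lborel) \<le> (G / \<kappa>) powr (q / 2)" for k
    proof -
      have "gagliardo s (v k) < \<infinity>" using gv[of k] fin by (rule le_less_trans)
      then have "\<kappa> * (\<integral>x. \<bar>v k x\<bar> powr q \<partial>lborel) powr (2 / q) \<le> enn2real (gagliardo s (v k))"
        by (intro * iv) auto
      also have "\<dots> \<le> G" unfolding G_def using gv fin by (intro enn2real_mono) auto
      finally have "(\<integral>x. \<bar>v k x\<bar> powr q \<partial>lborel) powr (2 / q) \<le> G / \<kappa>"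
        using \<kappa> by (simp add: field_simps)
      then have "((\<integral>x. \<bar>v k x\<bar> powr q \<partial>lborel) powr (2 / q)) powr (q / 2) \<le> (G / \<kappa>) powr (q / 2)"
        using q by (intro powr_mono2) auto
      moreover have "0 \<le> (\<integral>x. \<bar>v k x\<bar> powr q \<partial>lborel)"
        by (intro Bochner_Integration.integral_nonneg) auto
      ultimately show ?thesis using q by (simp add: powr_powr)
    qed
    have lim: "(\<lambda>k. \<bar>v k x\<bar> powr q) \<longlonglongrightarrow> \<bar>u x\<bar> powr q" for x
    proof (rule tendsto_eventually, rule eventually_sequentiallyI)
      fix k assume "nat \<lceil>\<bar>u x\<bar>\<rceil> \<le> k"
      then have "\<bar>u x\<bar> \<le> real k" by linarith
      then show "\<bar>v k x\<bar> powr q = \<bar>u x\<bar> powr q" by (simp add: v_def)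
    qed
    \<comment> \<open>The bound on the truncations does not depend on \<open>k\<close>, so Fatou
      makes \<open>m\<close> finite for \<open>u\<close> itself, and the finite case
      \<open>*\<close> then applies to \<open>u\<close>.\<close>
    have "integrable lborel (\<lambda>x. \<bar>u x\<bar> powr q)"
      by (rule fatou_real(1)[where f = "\<lambda>k x. \<bar>v k x\<bar> powr q" and K = "(G / \<kappa>) powr (q / 2)"]) (use le lim iv in auto)
    with *[OF _ this fin]
    show "integrable lborel (\<lambda>x. \<bar>u x\<bar> powr q) \<and>
      \<kappa> * (\<integral>x. \<bar>u x\<bar> powr q \<partial>lborel) powr (2 / q) \<le> enn2real (gagliardo s u)"
      by simp
  qed
qed

corollary integrable_crit_powr:
  fixes u :: "real ^ 'n \<Rightarrow> real"
  assumes "0 < s" "4 * s < real CARD('n)" "bounded \<Omega>" "u \<in> borel_measurable borel"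
    "\<And>x. x \<notin> \<Omega> \<Longrightarrow> u x = 0" "gagliardo s u < \<infinity>"
  shows "integrable lborel (\<lambda>x. \<bar>u x\<bar> powr crit_exp CARD('n) s)"
  using fractional_sobolev[OF assms(1-3)] assms(4-6) by metis

section \<open>Compactness of bounded sequences\<close>

lemma gagliardo_diff_le:
  fixes f g :: "real ^ 'n \<Rightarrow> real"
  assumes [measurable]: "f \<in> borel_measurable borel" "g \<in> borel_measurable borel"
  shows "gagliardo s (\<lambda>x. f x - g x) \<le> 2 * gagliardo s f + 2 * gagliardo s g"
proof -
  have "gagliardo_kernel s (\<lambda>x. f x - g x) p \<le> 2 * gagliardo_kernel s f p + 2 * gagliardo_kernel s g p"
    for p
  proof -
    obtain x y where p: "p = (x, y)" by (cases p)
    define a b D where "a = f x - f y" and "b = g x - g y"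
      and "D = norm (x - y) powr (real CARD('n) + 2 * s)"
    have "(a - b)\<^sup>2 \<le> 2 * a\<^sup>2 + 2 * b\<^sup>2"
      using zero_le_power2[of "a + b"] by (simp add: power2_eq_square algebra_simps)
    then have "(a - b)\<^sup>2 / D \<le> (2 * a\<^sup>2 + 2 * b\<^sup>2) / D"
      by (intro divide_right_mono) (auto simp: D_def)
    moreover have "f x - g x - (f y - g y) = a - b" by (simp add: a_def b_def)
    ultimately show ?thesis
      by (simp add: p gagliardo_kernel_def a_def[symmetric] b_def[symmetric] D_def[symmetric] add_divide_distrib)
  qed
  then have "gagliardo s (\<lambda>x. f x - g x) \<le>
      (\<integral>\<^sup>+ p. 2 * ennreal (gagliardo_kernel s f p) + 2 * ennreal (gagliardo_kernel s g p) \<partial>lborel)"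
    unfolding gagliardo_def
    by (intro nn_integral_mono) (simp add: ennreal_leI flip: ennreal_plus ennreal_numeral ennreal_mult')
  also have "\<dots> = 2 * gagliardo s f + 2 * gagliardo s g"
    unfolding gagliardo_def by (subst nn_integral_add) (auto simp: nn_integral_cmult)
  finally show ?thesis .
qed

section \<open>Grids of half-open cubes\<close>

definition cube_index :: "real \<Rightarrow> real ^ 'n \<Rightarrow> int ^ 'n" where
  "cube_index l x = (\<chi> i. \<lfloor>x $ i / l\<rfloor>)"

text \<open>As a fibre of \<open>cube_index\<close>, every point lies in exactly one cube, and the
  cubes that meet \<Omega> are indexed by the image of \<Omega>.\<close>

definition cube :: "real \<Rightarrow> int ^ 'n \<Rightarrow> (real ^ 'n) set" where
  "cube l z = {x. cube_index l x = z}"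

lemma sets_cube [measurable]: "cube l z \<in> sets borel"
proof -
  have "cube l z = {x. \<forall>i. \<lfloor>x $ i / l\<rfloor> = z $ i}"
    by (auto simp: cube_def cube_index_def vec_eq_iff)
  also have "\<dots> \<in> sets borel"
    by measurable
  finally show ?thesis .
qed

lemma norm_diff_cube:
  fixes x y :: "real ^ 'n"
  assumes "0 < l" "x \<in> cube l z" "y \<in> cube l z"
  shows "norm (x - y) \<le> real CARD('n) * l"
proof -
  have "\<bar>(x - y) $ i\<bar> \<le> l" for i
  proof -
    have "\<lfloor>x $ i / l\<rfloor> = \<lfloor>y $ i / l\<rfloor>"
      using assms by (auto simp: cube_def cube_index_def vec_eq_iff)
    then have "\<bar>x $ i / l - y $ i / l\<bar> \<le> 1" by linarith
    then have "\<bar>(x $ i - y $ i) / l\<bar> \<le> 1" by (simp add: diff_divide_distrib)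
    then show ?thesis using assms(1) by (simp add: abs_divide)
  qed
  then have "(\<Sum>i\<in>UNIV. \<bar>(x - y) $ i\<bar>) \<le> (\<Sum>i\<in>(UNIV :: 'n set). l)" by (intro sum_mono)
  then show ?thesis using norm_le_l1_cart[of "x - y"] by simp
qed

lemma ball_subset_cube:
  assumes "0 < l"
  shows "ball (\<chi> i. (real_of_int (z $ i) + 1 / 2) * l) (l / 2) \<subseteq> cube l z"
proof
  fix x assume x: "x \<in> ball (\<chi> i. (real_of_int (z $ i) + 1 / 2) * l) (l / 2)"
  have "\<lfloor>x $ i / l\<rfloor> = z $ i" for i
  proof -
    have "\<bar>x $ i - (real_of_int (z $ i) + 1 / 2) * l\<bar> < l / 2"
      using component_le_norm_cart[of "x - (\<chi> i. (real_of_int (z $ i) + 1 / 2) * l)" i] x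
      by (simp add: dist_norm norm_minus_commute)
    then have "\<bar>x $ i - (real_of_int (z $ i) * l + l / 2)\<bar> < l / 2"
      by (simp add: distrib_right)
    moreover have "t < u \<and> u < t + l" if "\<bar>u - (t + l / 2)\<bar> < l / 2" for t u :: real
      using that by linarith
    ultimately have "real_of_int (z $ i) * l < x $ i \<and> x $ i < real_of_int (z $ i) * l + l" by blast
    then have "real_of_int (z $ i) * l < x $ i" "x $ i < (real_of_int (z $ i) + 1) * l"
      by (simp_all add: distrib_right)
    then have "real_of_int (z $ i) < x $ i / l" "x $ i / l < real_of_int (z $ i) + 1"
      using assms by (simp_all add: field_simps)
    then show ?thesis by linarith
  qed
  then show "x \<in> cube l z" by (simp add: cube_def cube_index_def vec_eq_iff)
qed

text \<open>Only the order l^N of the measure matters later, so an inscribed ball of radius l/2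
  gives the lower bound and a ball around its centre shows finiteness.\<close>

lemma emeasure_cube:
  fixes z :: "int ^ 'n"
  assumes l: "0 < l"
  shows "ennreal (unit_ball_vol (real CARD('n)) * (l / 2) powr real CARD('n)) \<le> emeasure lborel (cube l z)"
    and "emeasure lborel (cube l z) < \<infinity>"
proof -
  define c :: "real ^ 'n" where "c = (\<chi> i. (real_of_int (z $ i) + 1 / 2) * l)"
  have sub: "ball c (l / 2) \<subseteq> cube l z" unfolding c_def by (rule ball_subset_cube[OF l])
  have "emeasure lborel (ball c (l / 2)) \<le> emeasure lborel (cube l z)"
    by (intro emeasure_mono sub) auto
  then show "ennreal (unit_ball_vol (real CARD('n)) * (l / 2) powr real CARD('n)) \<le> emeasure lborel (cube l z)"
    using l by (simp add: emeasure_ball powr_realpow)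
  have "c \<in> cube l z" using sub l by (auto intro: subsetD[OF sub])
  then have "cube l z \<subseteq> cball c (real CARD('n) * l)"
    using norm_diff_cube[OF l] by (auto simp: dist_norm)
  then have "emeasure lborel (cube l z) \<le> emeasure lborel (cball c (real CARD('n) * l))"
    by (intro emeasure_mono) auto
  also have "\<dots> < \<infinity>" using emeasure_lborel_cball_finite by simp
  finally show "emeasure lborel (cube l z) < \<infinity>" .
qed

lemma finite_cube_index_image:
  fixes \<Omega> :: "(real ^ 'n) set"
  assumes l: "0 < l" and \<Omega>: "bounded \<Omega>"
  shows "finite (cube_index l ` \<Omega>)"
proof -
  obtain B where B: "\<And>x. x \<in> \<Omega> \<Longrightarrow> norm x \<le> B" using \<Omega> by (auto simp: bounded_iff)
  define F where "F = {\<lfloor>- B / l\<rfloor>..\<lfloor>B / l\<rfloor>}"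
  have "cube_index l ` \<Omega> \<subseteq> vec_lambda ` (UNIV \<rightarrow>\<^sub>E F)"
  proof
    fix z assume "z \<in> cube_index l ` \<Omega>"
    then obtain x where x: "x \<in> \<Omega>" "z = cube_index l x" by auto
    have "z $ i \<in> F" for i
    proof -
      have "\<bar>x $ i\<bar> \<le> B" using B[OF x(1)] component_le_norm_cart[of x i] by simp
      then have "- B \<le> x $ i" "x $ i \<le> B" by auto
      then have "- B / l \<le> x $ i / l" "x $ i / l \<le> B / l"
        using l by (intro divide_right_mono; simp)+
      then show ?thesis
        unfolding F_def x(2) cube_index_def by (auto intro: floor_mono)
    qed
    then have "z = vec_lambda (\<lambda>i. z $ i)" "(\<lambda>i. z $ i) \<in> UNIV \<rightarrow>\<^sub>E F" by auto
    then show "z \<in> vec_lambda ` (UNIV \<rightarrow>\<^sub>E F)" by blast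
  qed
  moreover have "finite (vec_lambda ` ((UNIV :: 'n set) \<rightarrow>\<^sub>E F))"
    unfolding F_def by (intro finite_imageI finite_PiE) auto
  ultimately show ?thesis by (rule finite_subset)
qed

text \<open>Either e = \<bar>w x - w y\<bar> is at most \<delta>, or e \<le> e^2/\<delta>; and e^2
  is at most d^(N + 2s) times the kernel. This stands in for the Cauchy-Schwarz inequality with a
  bound linear in the kernel, ready to be integrated.\<close>

lemma abs_diff_le_gagliardo_kernel:
  fixes w :: "real ^ 'n \<Rightarrow> real"
  assumes d: "norm (x - y) \<le> d" "0 < d" and s: "0 < s" and \<delta>: "0 < \<delta>"
  shows "\<bar>w x - w y\<bar> \<le> \<delta> + d powr (real CARD('n) + 2 * s) / \<delta> * gagliardo_kernel s w (x, y)"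
proof (cases "x = y")
  case True
  then show ?thesis using \<delta> by (simp add: gagliardo_kernel_def)
next
  case False
  define e where "e = \<bar>w x - w y\<bar>"
  define \<alpha> where "\<alpha> = real CARD('n) + 2 * s"
  have \<alpha>: "0 < \<alpha>" using s by (simp add: \<alpha>_def)
  have n: "0 < norm (x - y) powr \<alpha>" using False by simp
  have "norm (x - y) powr \<alpha> \<le> d powr \<alpha>" using d \<alpha> by (intro powr_mono2) auto
  then have "e\<^sup>2 * norm (x - y) powr \<alpha> \<le> e\<^sup>2 * d powr \<alpha>" by (intro mult_left_mono) auto
  then have 1: "e\<^sup>2 \<le> d powr \<alpha> * (e\<^sup>2 / norm (x - y) powr \<alpha>)"
    using n by (simp add: pos_le_divide_eq mult_ac)
  have "e \<le> \<delta> + e\<^sup>2 / \<delta>"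
  proof (cases "e \<le> \<delta>")
    case True
    have "0 \<le> e\<^sup>2 / \<delta>" using \<delta> by simp
    then show ?thesis using True by linarith
  next
    case False
    then have "\<delta> * e \<le> e\<^sup>2" using \<delta> by (simp add: power2_eq_square)
    then have "e \<le> e\<^sup>2 / \<delta>" using \<delta> by (simp add: pos_le_divide_eq mult_ac)
    then show ?thesis using \<delta> by linarith
  qed
  also have "e\<^sup>2 / \<delta> \<le> d powr \<alpha> * (e\<^sup>2 / norm (x - y) powr \<alpha>) / \<delta>"
    using 1 \<delta> by (intro divide_right_mono) auto
  finally show ?thesis
    by (simp add: e_def \<alpha>_def gagliardo_kernel_def mult_ac)
qed

text \<open>A Poincare inequality on one cell. For x in Q, measure(Q) w x is the integral of w over
  Q plus that of w x - w y in y. The second one is estimated by the kernel; dividing by the measure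
  and integrating over x gives the three terms.\<close>

lemma integral_le_mean_plus_gagliardo:
  fixes w :: "real ^ 'n \<Rightarrow> real"
  assumes s: "0 < s" and [measurable]: "Q \<in> sets borel" "\<Omega> \<in> sets borel" "w \<in> borel_measurable borel"
    and w0: "\<And>x. x \<notin> \<Omega> \<Longrightarrow> w x = 0" and int: "integrable lborel w"
    and \<mu>0: "0 < \<mu>0" "ennreal \<mu>0 \<le> emeasure lborel Q" and Qfin: "emeasure lborel Q < \<infinity>"
    and d: "0 < d" "\<And>x y. x \<in> Q \<Longrightarrow> y \<in> Q \<Longrightarrow> norm (x - y) \<le> d" and \<delta>: "0 < \<delta>"
  shows "(\<integral>\<^sup>+ x. ennreal \<bar>w x\<bar> * indicator Q x \<partial>lborel) \<le>
     ennreal \<bar>\<integral>x. indicator Q x * w x \<partial>lborel\<bar> + ennreal \<delta> * emeasure lborel (Q \<inter> \<Omega>) +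
     ennreal (d powr (real CARD('n) + 2 * s) / (\<delta> * \<mu>0)) *
       (\<integral>\<^sup>+ x. (\<integral>\<^sup>+ y. ennreal (gagliardo_kernel s w (x, y)) \<partial>lborel) * indicator Q x \<partial>lborel)"
proof -
  define \<mu> where "\<mu> = measure lborel Q"
  have \<mu>e: "emeasure lborel Q = ennreal \<mu>" unfolding \<mu>_def using Qfin by (intro emeasure_eq_ennreal_measure) auto
  have "\<mu>0 \<le> \<mu>" using \<mu>0 \<mu>e by (simp add: \<mu>_def)
  with \<mu>0 have \<mu>: "0 < \<mu>" "\<mu>0 \<le> \<mu>" by auto
  define I where "I = (\<integral>x. indicator Q x * w x \<partial>lborel)"
  define A where "A = d powr (real CARD('n) + 2 * s) / \<delta>"
  have A: "0 \<le> A" using \<delta> by (simp add: A_def)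
  define D where "D x = (\<integral>\<^sup>+ y. ennreal (gagliardo_kernel s w (x, y)) \<partial>lborel)" for x
  have km: "(\<lambda>p. ennreal (gagliardo_kernel s w p)) \<in> borel_measurable (lborel \<Otimes>\<^sub>M lborel)"
    unfolding lborel_prod by measurable
  have Dm [measurable]: "D \<in> borel_measurable lborel"
    unfolding D_def using lborel.borel_measurable_nn_integral_fst[OF km] .
  have km1: "(\<lambda>y. ennreal (gagliardo_kernel s w (x, y))) \<in> borel_measurable lborel" for x
    using km by (rule measurable_Pair2) simp
  have intQ: "integrable lborel (\<lambda>x. indicator Q x :: real)"
    using Qfin by (intro integrable_real_indicator) auto
  have intQw: "integrable lborel (\<lambda>x. indicator Q x * w x)"
    using integrable_mult_indicator[OF _ int, of Q] by simp
  have key: "ennreal \<bar>w x\<bar> \<le> ennreal (\<bar>I\<bar> / \<mu> + \<delta>) + ennreal (A / \<mu>0) * D x" if x: "x \<in> Q" for x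
  proof -
    have eq: "indicator Q y * (w x - w y) = indicator Q y * w x - indicator Q y * w y" for y
      by (simp add: algebra_simps)
    have intd: "integrable lborel (\<lambda>y. indicator Q y * (w x - w y))"
      unfolding eq using intQ intQw by (intro Bochner_Integration.integrable_diff) auto
    have "(\<integral>y. indicator Q y * (w x - w y) \<partial>lborel) = \<mu> * w x - I"
      unfolding eq using intQ intQw by (subst Bochner_Integration.integral_diff) (auto simp: I_def \<mu>_def)
    then have "\<mu> * w x = I + (\<integral>y. indicator Q y * (w x - w y) \<partial>lborel)" by simp
    moreover have "\<bar>\<integral>y. indicator Q y * (w x - w y) \<partial>lborel\<bar> \<le> (\<integral>y. \<bar>indicator Q y * (w x - w y)\<bar> \<partial>lborel)"
      by (rule integral_abs_bound)
    ultimately have "\<mu> * \<bar>w x\<bar> \<le> \<bar>I\<bar> + (\<integral>y. \<bar>indicator Q y * (w x - w y)\<bar> \<partial>lborel)"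
    proof -
      have "\<mu> * \<bar>w x\<bar> = \<bar>\<mu> * w x\<bar>" using \<mu> by (simp add: abs_mult)
      with \<open>\<mu> * w x = _\<close> have "\<mu> * \<bar>w x\<bar> \<le> \<bar>I\<bar> + \<bar>\<integral>y. indicator Q y * (w x - w y) \<partial>lborel\<bar>"
        using abs_triangle_ineq by metis
      with \<open>_ \<le> (\<integral>y. \<bar>indicator Q y * (w x - w y)\<bar> \<partial>lborel)\<close> show ?thesis by linarith
    qed
    then have "ennreal (\<mu> * \<bar>w x\<bar>) \<le> ennreal (\<bar>I\<bar> + (\<integral>y. \<bar>indicator Q y * (w x - w y)\<bar> \<partial>lborel))"
      by (rule ennreal_leI)
    also have "\<dots> = ennreal \<bar>I\<bar> + ennreal (\<integral>y. \<bar>indicator Q y * (w x - w y)\<bar> \<partial>lborel)"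
      by (intro ennreal_plus Bochner_Integration.integral_nonneg) auto
    also have "ennreal (\<integral>y. \<bar>indicator Q y * (w x - w y)\<bar> \<partial>lborel) =
        (\<integral>\<^sup>+ y. ennreal \<bar>indicator Q y * (w x - w y)\<bar> \<partial>lborel)"
      using intd by (intro nn_integral_eq_integral[symmetric]) auto
    also have "\<dots> \<le> (\<integral>\<^sup>+ y. ennreal \<delta> * indicator Q y + ennreal A * ennreal (gagliardo_kernel s w (x, y)) \<partial>lborel)"
    proof (intro nn_integral_mono)
      fix y
      show "ennreal \<bar>indicator Q y * (w x - w y)\<bar> \<le>
          ennreal \<delta> * indicator Q y + ennreal A * ennreal (gagliardo_kernel s w (x, y))"
      proof (cases "y \<in> Q")
        case True
        have "\<bar>w x - w y\<bar> \<le> \<delta> + A * gagliardo_kernel s w (x, y)"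
          unfolding A_def using d x True s \<delta> by (intro abs_diff_le_gagliardo_kernel) auto
        then show ?thesis using True A \<delta>
          by (simp add: ennreal_leI flip: ennreal_mult' ennreal_plus)
      qed simp
    qed
    also have "\<dots> = ennreal \<delta> * ennreal \<mu> + ennreal A * D x"
      using km1 by (subst nn_integral_add)
        (auto simp: nn_integral_cmult nn_integral_cmult_indicator \<mu>e D_def)
    finally have *: "ennreal (\<mu> * \<bar>w x\<bar>) \<le> ennreal \<bar>I\<bar> + (ennreal \<delta> * ennreal \<mu> + ennreal A * D x)"
      by (simp add: add_left_mono)
    have "ennreal \<bar>w x\<bar> = ennreal (1 / \<mu>) * ennreal (\<mu> * \<bar>w x\<bar>)"
      using \<mu> by (simp flip: ennreal_mult')
    also have "\<dots> \<le> ennreal (1 / \<mu>) * (ennreal \<bar>I\<bar> + (ennreal \<delta> * ennreal \<mu> + ennreal A * D x))"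
      by (intro mult_left_mono *) auto
    also have "\<dots> = ennreal (1 / \<mu>) * ennreal \<bar>I\<bar> + ennreal (1 / \<mu>) * (ennreal \<delta> * ennreal \<mu>) +
        ennreal (1 / \<mu>) * ennreal A * D x"
      by (simp add: distrib_left mult_ac add_ac)
    also have "ennreal (1 / \<mu>) * ennreal \<bar>I\<bar> = ennreal (\<bar>I\<bar> / \<mu>)"
      using \<mu> by (simp flip: ennreal_mult')
    also have "ennreal (1 / \<mu>) * (ennreal \<delta> * ennreal \<mu>) = ennreal \<delta>"
      using \<mu> \<delta> by (simp flip: ennreal_mult')
    also have "ennreal (1 / \<mu>) * ennreal A = ennreal (A / \<mu>)"
      using \<mu> A by (simp flip: ennreal_mult')
    also have "ennreal (\<bar>I\<bar> / \<mu>) + ennreal \<delta> = ennreal (\<bar>I\<bar> / \<mu> + \<delta>)"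
      using \<mu> \<delta> by (simp add: ennreal_plus)
    also have "ennreal (A / \<mu>) * D x \<le> ennreal (A / \<mu>0) * D x"
      using \<mu> \<mu>0 A by (intro mult_right_mono ennreal_leI divide_left_mono) auto
    finally show ?thesis by (simp add: add_left_mono)
  qed
  \<comment> \<open>Since \<open>w\<close> vanishes off \<Omega>, the constant part is charged only
    to Q \<inter> \<Omega>. Summed over the cubes it costs the measure of \<Omega>, a bound
    independent of the grid.\<close>
  have "(\<integral>\<^sup>+ x. ennreal \<bar>w x\<bar> * indicator Q x \<partial>lborel) \<le>
     (\<integral>\<^sup>+ x. ennreal (\<bar>I\<bar> / \<mu> + \<delta>) * indicator (Q \<inter> \<Omega>) x + ennreal (A / \<mu>0) * (D x * indicator Q x) \<partial>lborel)"
  proof (intro nn_integral_mono)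
    fix x
    show "ennreal \<bar>w x\<bar> * indicator Q x \<le>
        ennreal (\<bar>I\<bar> / \<mu> + \<delta>) * indicator (Q \<inter> \<Omega>) x + ennreal (A / \<mu>0) * (D x * indicator Q x)"
      using key[of x] w0[of x] by (cases "x \<in> Q"; cases "x \<in> \<Omega>") auto
  qed
  also have "\<dots> = ennreal (\<bar>I\<bar> / \<mu> + \<delta>) * emeasure lborel (Q \<inter> \<Omega>) +
      ennreal (A / \<mu>0) * (\<integral>\<^sup>+ x. D x * indicator Q x \<partial>lborel)"
    by (subst nn_integral_add) (auto simp: nn_integral_cmult nn_integral_cmult_indicator)
  also have "ennreal (\<bar>I\<bar> / \<mu> + \<delta>) * emeasure lborel (Q \<inter> \<Omega>) =
      ennreal (\<bar>I\<bar> / \<mu>) * emeasure lborel (Q \<inter> \<Omega>) + ennreal \<delta> * emeasure lborel (Q \<inter> \<Omega>)"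
    using \<mu> \<delta> by (simp add: ennreal_plus distrib_right)
  also have "ennreal (\<bar>I\<bar> / \<mu>) * emeasure lborel (Q \<inter> \<Omega>) \<le> ennreal (\<bar>I\<bar> / \<mu>) * ennreal \<mu>"
    unfolding \<mu>e[symmetric] by (intro mult_left_mono emeasure_mono) auto
  also have "ennreal (\<bar>I\<bar> / \<mu>) * ennreal \<mu> = ennreal \<bar>I\<bar>"
    using \<mu> by (simp flip: ennreal_mult')
  finally show ?thesis
    by (simp add: I_def A_def D_def add_right_mono)
qed

text \<open>The one-cell estimate is summed over the finitely many cubes that meet \<Omega>. The
  cubes are disjoint, so the pieces of \<Omega> add up to \<Omega> and the kernel integrals to at
  most the full energy.\<close>

lemma integral_le_cube_means_plus_gagliardo:
  fixes w :: "real ^ 'n \<Rightarrow> real"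
  assumes s: "0 < s" and \<Omega>: "open \<Omega>" "bounded \<Omega>" and [measurable]: "w \<in> borel_measurable borel"
    and w0: "\<And>x. x \<notin> \<Omega> \<Longrightarrow> w x = 0" and int: "integrable lborel w"
    and l: "0 < l" and \<delta>: "0 < \<delta>"
  shows "(\<integral>\<^sup>+ x. ennreal \<bar>w x\<bar> \<partial>lborel) \<le>
     ennreal (\<Sum>z\<in>cube_index l ` \<Omega>. \<bar>\<integral>x. indicator (cube l z) x * w x \<partial>lborel\<bar>)
     + ennreal \<delta> * emeasure lborel \<Omega> +
     ennreal ((real CARD('n) * l) powr (real CARD('n) + 2 * s) /
       (\<delta> * (unit_ball_vol (real CARD('n)) * (l / 2) powr real CARD('n)))) * gagliardo s w"
proof -
  define C where "C = (real CARD('n) * l) powr (real CARD('n) + 2 * s) /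
       (\<delta> * (unit_ball_vol (real CARD('n)) * (l / 2) powr real CARD('n)))"
  define Z where "Z = cube_index l ` \<Omega>"
  have [measurable]: "\<Omega> \<in> sets borel" using \<Omega> by simp
  have fin: "finite Z" unfolding Z_def by (rule finite_cube_index_image[OF l \<Omega>(2)])
  define D where "D x = (\<integral>\<^sup>+ y. ennreal (gagliardo_kernel s w (x, y)) \<partial>lborel)" for x
  have km: "(\<lambda>p. ennreal (gagliardo_kernel s w p)) \<in> borel_measurable (lborel \<Otimes>\<^sub>M lborel)"
    unfolding lborel_prod by measurable
  have Dm [measurable]: "D \<in> borel_measurable borel"
    unfolding D_def using lborel.borel_measurable_nn_integral_fst[OF km] by simp
  have one: "(\<Sum>z\<in>Z. indicator (cube l z) x) = (if cube_index l x \<in> Z then 1 else 0 :: ennreal)" for x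
    using fin by (simp add: cube_def indicator_def)
  have "(\<integral>\<^sup>+ x. ennreal \<bar>w x\<bar> \<partial>lborel) \<le> (\<integral>\<^sup>+ x. (\<Sum>z\<in>Z. ennreal \<bar>w x\<bar> * indicator (cube l z) x) \<partial>lborel)"
  proof (intro nn_integral_mono)
    fix x
    show "ennreal \<bar>w x\<bar> \<le> (\<Sum>z\<in>Z. ennreal \<bar>w x\<bar> * indicator (cube l z) x)"
      using w0[of x] unfolding sum_distrib_left[symmetric] one by (cases "x \<in> \<Omega>") (auto simp: Z_def)
  qed
  also have "\<dots> = (\<Sum>z\<in>Z. \<integral>\<^sup>+ x. ennreal \<bar>w x\<bar> * indicator (cube l z) x \<partial>lborel)"
    by (intro nn_integral_sum) auto
  also have "\<dots> \<le> (\<Sum>z\<in>Z. ennreal \<bar>\<integral>x. indicator (cube l z) x * w x \<partial>lborel\<bar> +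
      ennreal \<delta> * emeasure lborel (cube l z \<inter> \<Omega>) +
      ennreal C * (\<integral>\<^sup>+ x. D x * indicator (cube l z) x \<partial>lborel))"
    unfolding C_def D_def
    using s l \<delta> w0 int emeasure_cube[OF l] norm_diff_cube[OF l]
    by (intro sum_mono integral_le_mean_plus_gagliardo) auto
  also have "\<dots> = (\<Sum>z\<in>Z. ennreal \<bar>\<integral>x. indicator (cube l z) x * w x \<partial>lborel\<bar>) +
      ennreal \<delta> * (\<Sum>z\<in>Z. emeasure lborel (cube l z \<inter> \<Omega>)) +
      ennreal C * (\<Sum>z\<in>Z. \<integral>\<^sup>+ x. D x * indicator (cube l z) x \<partial>lborel)"
    by (simp add: sum.distrib sum_distrib_left)
  also have "(\<Sum>z\<in>Z. ennreal \<bar>\<integral>x. indicator (cube l z) x * w x \<partial>lborel\<bar>) =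
      ennreal (\<Sum>z\<in>Z. \<bar>\<integral>x. indicator (cube l z) x * w x \<partial>lborel\<bar>)"
    by (intro sum_ennreal) auto
  also have "(\<Sum>z\<in>Z. emeasure lborel (cube l z \<inter> \<Omega>)) = emeasure lborel (\<Union>z\<in>Z. cube l z \<inter> \<Omega>)"
    using fin by (intro sum_emeasure) (auto simp: disjoint_family_on_def, auto simp: cube_def)
  also have "(\<Union>z\<in>Z. cube l z \<inter> \<Omega>) = \<Omega>" by (auto simp: Z_def cube_def)
  also have "(\<Sum>z\<in>Z. \<integral>\<^sup>+ x. D x * indicator (cube l z) x \<partial>lborel) =
      (\<integral>\<^sup>+ x. (\<Sum>z\<in>Z. D x * indicator (cube l z) x) \<partial>lborel)"
    by (intro nn_integral_sum[symmetric]) auto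
  also have "\<dots> \<le> (\<integral>\<^sup>+ x. D x \<partial>lborel)"
    unfolding sum_distrib_left[symmetric] one by (intro nn_integral_mono) auto
  also have "\<dots> = gagliardo s w" by (simp add: gagliardo_iterated D_def)
  finally show ?thesis by (simp add: C_def Z_def add_left_mono mult_left_mono)
qed

text \<open>\<bar>u\<bar> is at most \<bar>u\<bar>^q plus the indicator of \<Omega>, and the Sobolev
  inequality bounds the first part in terms of \<open>K\<close> alone. \<open>max 0 K\<close> covers
  negative \<open>K\<close>, where \<open>ennreal K\<close> is 0.\<close>

lemma integral_abs_le_gagliardo:
  fixes s :: real and \<Omega> :: "(real ^ 'n) set"
  assumes s: "0 < s" "4 * s < real CARD('n)" and \<Omega>: "open \<Omega>" "bounded \<Omega>"
  obtains M where
    "\<And>u. u \<in> borel_measurable borel \<Longrightarrow> (\<And>x. x \<notin> \<Omega> \<Longrightarrow> u x = 0) \<Longrightarrow> gagliardo s u \<le> ennreal K \<Longrightarrow>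
      integrable lborel u \<and> (\<integral>x. \<bar>u x\<bar> \<partial>lborel) \<le> M"
proof -
  define q where "q = crit_exp CARD('n) s"
  obtain \<kappa> where \<kappa>: "0 < \<kappa>"
    "\<And>u. u \<in> borel_measurable borel \<Longrightarrow> (\<And>x. x \<notin> \<Omega> \<Longrightarrow> u x = 0) \<Longrightarrow> gagliardo s u < \<infinity> \<Longrightarrow>
      integrable lborel (\<lambda>x. \<bar>u x\<bar> powr q) \<and>
      \<kappa> * (\<integral>x. \<bar>u x\<bar> powr q \<partial>lborel) powr (2 / q) \<le> enn2real (gagliardo s u)"
    using fractional_sobolev[OF s \<Omega>(2)] unfolding q_def by blast
  have q: "2 < q" using crit_exp_facts[of s "CARD('n)"] s by (simp add: q_def)
  define B where "B = (max 0 K / \<kappa>) powr (q / 2)"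
  have B: "0 \<le> B" by (simp add: B_def)
  have \<Omega>m: "\<Omega> \<in> sets borel" using \<Omega> by simp
  have \<Omega>f: "emeasure lborel \<Omega> < \<infinity>" using emeasure_bounded_finite[OF \<Omega>(2)] by simp
  have i\<Omega>: "integrable lborel (\<lambda>x. indicator \<Omega> x :: real)"
    using \<Omega>m \<Omega>f by (intro integrable_real_indicator) auto
  show ?thesis
  proof (rule that[of "B + measure lborel \<Omega>"])
    fix u :: "real ^ 'n \<Rightarrow> real"
    assume [measurable]: "u \<in> borel_measurable borel" and u0: "\<And>x. x \<notin> \<Omega> \<Longrightarrow> u x = 0"
      and g: "gagliardo s u \<le> ennreal K"
    have "gagliardo s u < \<infinity>" using g by (rule le_less_trans) simp
    then have i: "integrable lborel (\<lambda>x. \<bar>u x\<bar> powr q)"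
      and le: "\<kappa> * (\<integral>x. \<bar>u x\<bar> powr q \<partial>lborel) powr (2 / q) \<le> enn2real (gagliardo s u)"
      using \<kappa>(2)[of u] u0 by auto
    note le
    also have "enn2real (gagliardo s u) \<le> enn2real (ennreal K)" using g by (intro enn2real_mono) auto
    also have "\<dots> \<le> max 0 K" by (cases "0 \<le> K") (auto simp: ennreal_neg)
    finally have "(\<integral>x. \<bar>u x\<bar> powr q \<partial>lborel) powr (2 / q) \<le> max 0 K / \<kappa>"
      using \<kappa>(1) by (simp add: pos_le_divide_eq mult.commute)
    then have "((\<integral>x. \<bar>u x\<bar> powr q \<partial>lborel) powr (2 / q)) powr (q / 2) \<le> B"
      unfolding B_def using q by (intro powr_mono2) auto
    moreover have nn: "0 \<le> (\<integral>x. \<bar>u x\<bar> powr q \<partial>lborel)"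
      by (intro Bochner_Integration.integral_nonneg) auto
    ultimately have leB: "(\<integral>x. \<bar>u x\<bar> powr q \<partial>lborel) \<le> B"
      using q by (simp add: powr_powr)
    have pt: "\<bar>u x\<bar> \<le> \<bar>u x\<bar> powr q + indicator \<Omega> x" for x
    proof (cases "x \<in> \<Omega>")
      case True
      show ?thesis
      proof (cases "\<bar>u x\<bar> \<le> 1")
        case False
        then have "\<bar>u x\<bar> powr 1 \<le> \<bar>u x\<bar> powr q" using q by (intro powr_mono) auto
        then show ?thesis using True False by auto
      next
        case 1: True
        then show ?thesis using True by (simp add: add_increasing)
      qed
    qed (use u0 in simp)
    have isum: "integrable lborel (\<lambda>x. \<bar>u x\<bar> powr q + indicator \<Omega> x)"
      using i i\<Omega> by (rule Bochner_Integration.integrable_add)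
    have iu: "integrable lborel u"
    proof (rule Bochner_Integration.integrable_bound[OF isum])
      show "AE x in lborel. norm (u x) \<le> norm (\<bar>u x\<bar> powr q + indicator \<Omega> x)"
        using order_trans[OF pt abs_ge_self] by auto
    qed simp
    have "(\<integral>x. \<bar>u x\<bar> \<partial>lborel) \<le> (\<integral>x. \<bar>u x\<bar> powr q + indicator \<Omega> x \<partial>lborel)"
      using iu isum pt by (intro integral_mono) auto
    also have "\<dots> = (\<integral>x. \<bar>u x\<bar> powr q \<partial>lborel) + measure lborel \<Omega>"
      using i i\<Omega> by (subst Bochner_Integration.integral_add) auto
    also have "\<dots> \<le> B + measure lborel \<Omega>" using leB by simp
    finally show "integrable lborel u \<and> (\<integral>x. \<bar>u x\<bar> \<partial>lborel) \<le> B + measure lborel \<Omega>"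
      using iu by simp
  qed
qed

text \<open>The numerator is of order l^(N + 2s) and the denominator of order l^N; the surplus
  l^(2s) tends to 0 with the mesh l = 1/(k+1). This is where s > 0 gives compactness.\<close>

lemma cube_constant_tendsto_0:
  fixes N s c \<delta> :: real
  assumes "0 < s" "0 < N" "0 < c" "0 < \<delta>"
  shows "(\<lambda>k. (N * (1 / real (Suc k))) powr (N + 2 * s) / (\<delta> * (c * (1 / real (Suc k) / 2) powr N))) \<longlonglongrightarrow> 0"
proof -
  define l where "l k = 1 / real (Suc k)" for k
  have l: "0 < l k" for k by (simp add: l_def)
  have "(N * l k) powr (N + 2 * s) / (\<delta> * (c * (l k / 2) powr N)) =
      N powr (N + 2 * s) * 2 powr N / (\<delta> * c) * l k powr (2 * s)" for k
    using l[of k] assms by (simp add: powr_mult powr_divide powr_add field_simps)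
  moreover have "l \<longlonglongrightarrow> 0" unfolding l_def using LIMSEQ_inverse_real_of_nat by (simp add: inverse_eq_divide)
  then have "(\<lambda>k. l k powr (2 * s)) \<longlonglongrightarrow> 0 powr (2 * s)"
    using assms l by (intro tendsto_powr' tendsto_const) (auto intro!: always_eventually less_imp_le)
  then have "(\<lambda>k. N powr (N + 2 * s) * 2 powr N / (\<delta> * c) * l k powr (2 * s)) \<longlonglongrightarrow>
      N powr (N + 2 * s) * 2 powr N / (\<delta> * c) * 0"
    using assms by (intro tendsto_mult tendsto_const) auto
  ultimately show ?thesis unfolding l_def by simp
qed

lemma gagliardo_compact:
  fixes f :: "nat \<Rightarrow> real ^ 'n \<Rightarrow> real"
  assumes s: "0 < s" "4 * s < real CARD('n)" and \<Omega>: "open \<Omega>" "bounded \<Omega>"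
    and f [measurable]: "\<And>n. f n \<in> borel_measurable borel"
    and f0: "\<And>n x. x \<notin> \<Omega> \<Longrightarrow> f n x = 0"
    and K: "\<And>n. gagliardo s (f n) \<le> ennreal K"
  obtains r u where "strict_mono r" "u \<in> borel_measurable borel" "\<And>x. x \<notin> \<Omega> \<Longrightarrow> u x = 0"
    "AE x in lborel. (\<lambda>n. f (r n) x) \<longlonglongrightarrow> u x"
proof -
  obtain M where M0: "\<And>u. u \<in> borel_measurable borel \<Longrightarrow> (\<And>x. x \<notin> \<Omega> \<Longrightarrow> u x = 0) \<Longrightarrow> gagliardo s u \<le> ennreal K \<Longrightarrow>
      integrable lborel u \<and> (\<integral>x. \<bar>u x\<bar> \<partial>lborel) \<le> M"
    using integral_abs_le_gagliardo[OF s \<Omega>, of K] by blast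
  have int: "integrable lborel (f n)" and M: "(\<integral>x. \<bar>f n x\<bar> \<partial>lborel) \<le> M" for n
    using M0[OF f f0 K] by auto
  define l where "l k = 1 / real (Suc k)" for k
  have l: "0 < l k" for k by (simp add: l_def)
  define F where "F n p = (\<integral>x. indicator (cube (l (fst p)) (snd p)) x * f n x \<partial>lborel)"
    for n and p :: "nat \<times> (int ^ 'n)"
  have intc: "integrable lborel (\<lambda>x. indicator (cube a z) x * f n x)" for a z n
    using integrable_mult_indicator[OF _ int, of "cube a z" n] by simp
  have FM: "norm (F n p) \<le> M" for n p
  proof -
    have "norm (F n p) \<le> (\<integral>x. \<bar>indicator (cube (l (fst p)) (snd p)) x * f n x\<bar> \<partial>lborel)"
      unfolding F_def real_norm_def by (rule integral_abs_bound)
    also have "\<dots> \<le> (\<integral>x. \<bar>f n x\<bar> \<partial>lborel)"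
      using intc int by (intro integral_mono integrable_abs) (auto simp: indicator_def)
    finally show ?thesis using M[of n] by simp
  qed
  \<comment> \<open>Diagonal extraction: the pairs of a grid level and a cube are countable, and
    each integral is bounded by \<open>M\<close>, so one subsequence makes all of them
    converge.\<close>
  obtain r where r: "strict_mono r" "\<And>p. \<exists>L. (\<lambda>n. F (r n) p) \<longlonglongrightarrow> L"
  proof (rule function_convergent_subsequence[of UNIV F M])
    show "countable (UNIV :: (nat \<times> (int ^ 'n)) set)" by simp
  qed (use FM in auto)
  define C where "C \<delta> k = (real CARD('n) * l k) powr (real CARD('n) + 2 * s) /
       (\<delta> * (unit_ball_vol (real CARD('n)) * (l k / 2) powr real CARD('n)))" for \<delta> k
  define m where "m = measure lborel \<Omega>"
  have m: "emeasure lborel \<Omega> = ennreal m" "0 \<le> m"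
    unfolding m_def using emeasure_bounded_finite[OF \<Omega>(2)] by (auto intro!: emeasure_eq_ennreal_measure)
  define K' where "K' = max 0 K"
  have K': "0 \<le> K'" "gagliardo s (f n) \<le> ennreal K'" for n
    using K[of n] by (auto simp: K'_def intro: order_trans[OF _ ennreal_leI])
  have cauchy: "\<exists>n0. \<forall>i\<ge>n0. \<forall>j\<ge>n0. (\<integral>x. norm (f (r i) x - f (r j) x) \<partial>lborel) < e" if e: "0 < e" for e :: real
  proof -
    \<comment> \<open>The order of choices matters: \<delta> makes the measure term small, then a
      fine grid \<open>k\<close> makes the energy term small for this \<delta>, and only then do the
      finitely many cubes of grid \<open>k\<close> fix the index. 4K' bounds the energy of a
      difference of two members; each + 1 in a denominator avoids division by 0.\<close>
    define \<delta> where "\<delta> = e / (4 * (m + 1))"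
    have \<delta>: "0 < \<delta>" "\<delta> * m \<le> e / 4" using e m by (auto simp: \<delta>_def field_simps)
    have "(\<lambda>k. C \<delta> k) \<longlonglongrightarrow> 0"
      unfolding C_def l_def using s \<delta> by (intro cube_constant_tendsto_0) auto
    moreover have "0 < e / (4 * (4 * K' + 1))" using e K' by simp
    ultimately have "\<forall>\<^sub>F k in sequentially. C \<delta> k < e / (4 * (4 * K' + 1))"
      by (rule order_tendstoD)
    then obtain k where k: "C \<delta> k < e / (4 * (4 * K' + 1))"
      using eventually_happens' sequentially_bot by blast
    have C0: "0 \<le> C \<delta> k" using \<delta> l[of k] by (auto simp: C_def)
    have "C \<delta> k * (4 * K' + 1) \<le> e / 4" using k K' by (simp add: field_simps)
    moreover have "C \<delta> k * (4 * K') \<le> C \<delta> k * (4 * K' + 1)" using C0 by (intro mult_left_mono) auto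
    ultimately have Ck: "C \<delta> k * (4 * K') \<le> e / 4" by simp
    define Z where "Z = cube_index (l k) ` \<Omega>"
    have finZ: "finite Z" unfolding Z_def by (rule finite_cube_index_image[OF l \<Omega>(2)])
    have "\<exists>n0. \<forall>i\<ge>n0. \<forall>j\<ge>n0. norm (F (r i) (k, z) - F (r j) (k, z)) < e / (4 * (card Z + 1))" for z
    proof -
      have "Cauchy (\<lambda>n. F (r n) (k, z))" using r(2)[of "(k, z)"] LIMSEQ_imp_Cauchy by blast
      then show ?thesis using e by (simp add: Cauchy_iff)
    qed
    then obtain n0 where n0: "\<And>z i j. n0 z \<le> i \<Longrightarrow> n0 z \<le> j \<Longrightarrow>
        norm (F (r i) (k, z) - F (r j) (k, z)) < e / (4 * (card Z + 1))" by metis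
    define n1 where "n1 = Max (insert 0 (n0 ` Z))"
    have n1: "n0 z \<le> n1" if "z \<in> Z" for z unfolding n1_def using finZ that by (intro Max_ge) auto
    show ?thesis
    proof (intro exI[of _ n1] allI impI)
      fix i j assume ij: "n1 \<le> i" "n1 \<le> j"
      define w where "w x = f (r i) x - f (r j) x" for x
      have [measurable]: "w \<in> borel_measurable borel" unfolding w_def by measurable
      have wint: "integrable lborel w" unfolding w_def using int by auto
      have wF: "(\<integral>x. indicator (cube (l k) z) x * w x \<partial>lborel) = F (r i) (k, z) - F (r j) (k, z)" for z
        unfolding w_def F_def right_diff_distrib
        using intc by (subst Bochner_Integration.integral_diff) auto
      have sum: "(\<Sum>z\<in>Z. \<bar>\<integral>x. indicator (cube (l k) z) x * w x \<partial>lborel\<bar>) \<le> e / 4"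
      proof -
        have "(\<Sum>z\<in>Z. \<bar>\<integral>x. indicator (cube (l k) z) x * w x \<partial>lborel\<bar>) \<le> (\<Sum>z\<in>Z. e / (4 * (card Z + 1)))"
          unfolding wF
        proof (intro sum_mono)
          fix z assume "z \<in> Z"
          then show "\<bar>F (r i) (k, z) - F (r j) (k, z)\<bar> \<le> e / (4 * (card Z + 1))"
            using n0[of z i j] n1[of z] ij by simp
        qed
        also have "\<dots> \<le> e / 4" using e by (simp add: field_simps)
        finally show ?thesis .
      qed
      have "gagliardo s w \<le> 2 * gagliardo s (f (r i)) + 2 * gagliardo s (f (r j))"
        unfolding w_def by (rule gagliardo_diff_le) auto
      also have "\<dots> \<le> 2 * ennreal K' + 2 * ennreal K'"
        by (intro add_mono mult_left_mono K') auto
      also have "\<dots> = ennreal (4 * K')" using K'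
        by (simp flip: ennreal_plus ennreal_numeral ennreal_mult')
      finally have gw: "gagliardo s w \<le> ennreal (4 * K')" .
      have "ennreal (\<integral>x. \<bar>w x\<bar> \<partial>lborel) = (\<integral>\<^sup>+ x. ennreal \<bar>w x\<bar> \<partial>lborel)"
        using wint by (intro nn_integral_eq_integral[symmetric]) auto
      also have "\<dots> \<le> ennreal (\<Sum>z\<in>Z. \<bar>\<integral>x. indicator (cube (l k) z) x * w x \<partial>lborel\<bar>)
          + ennreal \<delta> * emeasure lborel \<Omega> + ennreal (C \<delta> k) * gagliardo s w"
        unfolding C_def Z_def
        by (rule integral_le_cube_means_plus_gagliardo[OF s(1) \<Omega> _ _ wint l \<delta>(1)]) (auto simp: w_def f0)
      also have "\<dots> \<le> ennreal (e / 4) + ennreal \<delta> * ennreal m + ennreal (C \<delta> k) * ennreal (4 * K')"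
        unfolding m(1) by (intro add_mono ennreal_leI sum order_refl mult_left_mono gw) auto
      also have "\<dots> = ennreal (e / 4 + \<delta> * m + C \<delta> k * (4 * K'))"
        using e \<delta> m C0 K' by (simp add: ennreal_mult' ennreal_plus)
      finally have "(\<integral>x. \<bar>w x\<bar> \<partial>lborel) \<le> e / 4 + \<delta> * m + C \<delta> k * (4 * K')"
        using e \<delta> m C0 K' by (subst (asm) ennreal_le_iff) auto
      also have "\<dots> < e" using \<delta>(2) Ck e by linarith
      finally show "(\<integral>x. norm (f (r i) x - f (r j) x) \<partial>lborel) < e" by (simp add: w_def)
    qed
  qed
  obtain r' where r': "strict_mono r'" "AE x in lborel. Cauchy (\<lambda>i. f (r (r' i)) x)"
    by (rule cauchy_L1_AE_cauchy_subseq[of lborel "\<lambda>n. f (r n)"]) (use int cauchy in auto)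
  \<comment> \<open>The default 0 makes the limit total and Borel. Off \<Omega> the sequence is
    constantly 0, so \<open>u\<close> vanishes there at every point and not just almost
    everywhere.\<close>
  define u where "u x = (if Cauchy (\<lambda>i. f (r (r' i)) x) then lim (\<lambda>i. f (r (r' i)) x) else 0)" for x
  show ?thesis
  proof (rule that)
    show "strict_mono (r \<circ> r')" using r(1) r'(1) by (rule strict_mono_o)
    show "u \<in> borel_measurable borel" unfolding u_def by measurable
    show "u x = 0" if "x \<notin> \<Omega>" for x
      using f0[OF that] by (simp add: u_def)
    show "AE x in lborel. (\<lambda>n. f ((r \<circ> r') n) x) \<longlonglongrightarrow> u x"
      using r'(2)
    proof eventually_elim
      case (elim x)
      then have "convergent (\<lambda>i. f (r (r' i)) x)" by (simp add: Cauchy_convergent_iff)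
      then show ?case using elim by (simp add: u_def convergent_LIMSEQ_iff)
    qed
  qed
qed

section \<open>Functions of finite Gagliardo energy\<close>

text \<open>The kernel vanishes unless x or y lies in \<open>B\<close>. On either part the integral
  over the other variable is at most \<open>T\<close>, uniformly, and symmetry of the kernel lets
  one bound serve both. The lemma supplies a nonzero element of \<open>X0\<close>.\<close>

lemma gagliardo_finiteI:
  fixes u :: "real ^ 'n \<Rightarrow> real"
  assumes s: "0 < s" "s < 1" and [measurable]: "u \<in> borel_measurable borel"
    and B: "bounded B" "B \<in> sets borel" "\<And>x. x \<notin> B \<Longrightarrow> u x = 0"
    and lip: "\<And>x y. \<bar>u x - u y\<bar> \<le> norm (x - y)" and bd: "\<And>x y. \<bar>u x - u y\<bar> \<le> R"
  shows "gagliardo s u < \<infinity>"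
proof -
  note [measurable] = B(2)
  define \<alpha> where "\<alpha> = real CARD('n) + 2 * s"
  define c where "c = unit_ball_vol (real CARD('n))"
  have c: "0 < c" by (simp add: c_def)
  have R: "0 \<le> R" using bd[of 0 0] by simp
  txt \<open>Dyadic shells: \<open>a\<close> bounds the kernel for \<open>\<bar>x - y\<bar> \<le> 1\<close>, where \<open>s < 1\<close> makes it summable, and \<open>b\<close> beyond.\<close>
  define a where "a j = ((1/2) ^ j)\<^sup>2 / ((1/2) ^ Suc j) powr \<alpha>" for j :: nat
  define b where "b j = R\<^sup>2 / (2 ^ j) powr \<alpha>" for j :: nat
  \<comment> \<open>Each shell is enlarged to the ball containing it. The two series are then
    geometric with ratios 2^(2s - 2) and 2^(-2s), which are below 1 because s < 1 and s > 0.\<close>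
  define T where "T = (\<Sum>j. ennreal (a j * (c * ((1/2) ^ j) ^ CARD('n)))) + (\<Sum>j. ennreal (b j * (c * (2 ^ Suc j) ^ CARD('n))))"
  have a0: "0 \<le> a j" and b0: "0 \<le> b j" for j by (auto simp: a_def b_def)
  have pw: "(r ^ j) powr t = (r powr t) ^ j" if "0 < r" for r t :: real and j :: nat
    using that by (simp add: powr_realpow[symmetric] powr_powr mult.commute)
  have T: "T < \<infinity>"
  proof -
    have "a j * (c * ((1/2) ^ j) ^ CARD('n)) = c * 2 powr \<alpha> * ((1/2) powr (2 - 2 * s)) ^ j" for j
    proof -
      have h: "((1/2::real) ^ Suc j) powr \<alpha> = (1/2) powr \<alpha> * ((1/2) powr \<alpha>) ^ j"
        using pw[of "1/2" "Suc j" \<alpha>] by simp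
      have "(1/2::real) powr (2 - 2 * s) = (1/2) powr 2 * (1/2) powr (real CARD('n)) / (1/2) powr \<alpha>"
        unfolding powr_add[symmetric] powr_diff[symmetric] by (simp add: \<alpha>_def)
      also have "\<dots> = (1/2)\<^sup>2 * (1/2) ^ CARD('n) / (1/2) powr \<alpha>"
      proof -
        have "(1/2::real) powr 2 = (1/2)\<^sup>2" "(1/2::real) powr real CARD('n) = (1/2) ^ CARD('n)"
          by (rule powr_numeral powr_realpow; simp)+
        then show ?thesis by (simp only:)
      qed
      finally have "((1/2::real) powr (2 - 2 * s)) ^ j =
          ((1/2) ^ j)\<^sup>2 * ((1/2) ^ j) ^ CARD('n) / ((1/2) powr \<alpha>) ^ j"
        by (simp only: power_mult_distrib power_divide power_mult[symmetric] mult.commute)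
      moreover have "1 / (1/2::real) powr \<alpha> = 2 powr \<alpha>"
        by (simp add: powr_divide)
      ultimately show ?thesis unfolding a_def h
        by (simp add: field_simps)
    qed
    moreover have "summable (\<lambda>j. c * 2 powr \<alpha> * ((1/2) powr (2 - 2 * s)) ^ j)"
    proof (intro summable_mult summable_geometric)
      have "(1/2::real) powr (2 - 2 * s) < (1/2) powr 0" using s by (intro powr_less_mono') auto
      then show "norm ((1/2::real) powr (2 - 2 * s)) < 1" by simp
    qed
    ultimately have 1: "summable (\<lambda>j. a j * (c * ((1/2) ^ j) ^ CARD('n)))" by (simp only:)
    have "b j * (c * (2 ^ Suc j) ^ CARD('n)) = R\<^sup>2 * c * 2 ^ CARD('n) * (2 powr (- 2 * s)) ^ j" for j
    proof -
      have "2 powr (- 2 * s) = 2 powr (real CARD('n)) / 2 powr \<alpha>"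
        unfolding powr_diff[symmetric] by (simp add: \<alpha>_def)
      also have "\<dots> = 2 ^ CARD('n) / 2 powr \<alpha>" by (simp add: powr_realpow)
      finally have "(2 powr (- 2 * s)) ^ j = (2 ^ j) ^ CARD('n) / (2 powr \<alpha>) ^ j"
        by (simp only: power_divide power_mult[symmetric] mult.commute)
      then show ?thesis using pw[of 2 j \<alpha>] unfolding b_def
        by (simp add: power_mult_distrib)
    qed
    moreover have "summable (\<lambda>j. R\<^sup>2 * c * 2 ^ CARD('n) * (2 powr (- 2 * s)) ^ j)"
    proof (intro summable_mult summable_geometric)
      have "(2::real) powr (- 2 * s) < 2 powr 0" using s by (intro powr_less_mono) auto
      then show "norm ((2::real) powr (- 2 * s)) < 1" by simp
    qed
    ultimately have 2: "summable (\<lambda>j. b j * (c * (2 ^ Suc j) ^ CARD('n)))" by (simp only:)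
    have "(\<Sum>j. ennreal (a j * (c * ((1/2) ^ j) ^ CARD('n)))) \<noteq> top"
      using a0 c by (intro ennreal_suminf_neq_top 1) auto
    moreover have "(\<Sum>j. ennreal (b j * (c * (2 ^ Suc j) ^ CARD('n)))) \<noteq> top"
      using b0 c by (intro ennreal_suminf_neq_top 2) auto
    ultimately show ?thesis by (simp add: T_def less_top)
  qed
  have term_le: "g j \<le> (\<Sum>j. g j)" for g :: "nat \<Rightarrow> ennreal" and j
    using sum_le_suminf[of g "{j}"] by simp
  have ptw: "ennreal (gagliardo_kernel s u (x, y)) \<le>
      (\<Sum>j. ennreal (a j) * indicator (cball x ((1/2) ^ j)) y) + (\<Sum>j. ennreal (b j) * indicator (cball x (2 ^ Suc j)) y)"
    for x y
  proof (cases "x = y")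
    case True
    then show ?thesis by (simp add: gagliardo_kernel_def)
  next
    case False
    define h where "h = norm (x - y)"
    have h: "0 < h" using False by (simp add: h_def)
    have \<alpha>: "0 < \<alpha>" using s by (simp add: \<alpha>_def)
    have k: "gagliardo_kernel s u (x, y) = \<bar>u x - u y\<bar>\<^sup>2 / h powr \<alpha>"
      by (simp add: gagliardo_kernel_def h_def \<alpha>_def)
    show ?thesis
    proof (cases "h \<le> 1")
      case True
      \<comment> \<open>The shell of \<open>y\<close> has index j = k - 1; k is not 0 because h
        \<le> 1. One term of the series already bounds the kernel there.\<close>
      define k where "k = (LEAST k. (1/2) ^ k < h)"
      have ex: "\<exists>k. (1/2) ^ k < h" using real_arch_pow_inv[OF h, of "1/2"] by auto
      have k1: "(1/2) ^ k < h" unfolding k_def using ex by (rule LeastI_ex)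
      then have "k \<noteq> 0" using True by (auto intro: ccontr)
      then obtain j where j: "k = Suc j" by (cases k) auto
      have "\<not> (1/2) ^ j < h" using not_less_Least[of j "\<lambda>k. (1/2) ^ k < h"] j by (auto simp: k_def)
      then have j1: "h \<le> (1/2) ^ j" "(1/2) ^ Suc j < h" using k1 j by auto
      have "\<bar>u x - u y\<bar>\<^sup>2 \<le> ((1/2) ^ j)\<^sup>2"
        using lip[of x y] j1 by (intro power_mono) (auto simp: h_def)
      moreover have "((1/2) ^ Suc j) powr \<alpha> \<le> h powr \<alpha>"
        using j1 \<alpha> by (intro powr_mono2) auto
      ultimately have "gagliardo_kernel s u (x, y) \<le> a j"
        unfolding k a_def by (intro frac_le) auto
      then have "ennreal (gagliardo_kernel s u (x, y)) \<le> ennreal (a j) * indicator (cball x ((1/2) ^ j)) y"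
        using j1 by (auto simp: indicator_def h_def dist_norm intro!: ennreal_leI)
      also have "\<dots> \<le> (\<Sum>j. ennreal (a j) * indicator (cball x ((1/2) ^ j)) y)"
        by (rule term_le[of "\<lambda>j. ennreal (a j) * indicator (cball x ((1/2) ^ j)) y"])
      finally show ?thesis by (rule order_trans) simp
    next
      case False
      define k where "k = (LEAST k. h < 2 ^ k)"
      have ex: "\<exists>k. h < 2 ^ k" using real_arch_pow[of 2 h] by auto
      have k1: "h < 2 ^ k" unfolding k_def using ex by (rule LeastI_ex)
      then have "k \<noteq> 0" using False by (auto intro: ccontr)
      then obtain j where j: "k = Suc j" by (cases k) auto
      have "\<not> h < 2 ^ j" using not_less_Least[of j "\<lambda>k. h < 2 ^ k"] j by (auto simp: k_def)
      then have j1: "2 ^ j \<le> h" "h < 2 ^ Suc j" using k1 j by auto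
      have "\<bar>u x - u y\<bar>\<^sup>2 \<le> R\<^sup>2"
        using bd[of x y] by (intro power_mono) auto
      moreover have "(2 ^ j) powr \<alpha> \<le> h powr \<alpha>"
        using j1 \<alpha> by (intro powr_mono2) auto
      ultimately have "gagliardo_kernel s u (x, y) \<le> b j"
        unfolding k b_def by (intro frac_le) auto
      then have "ennreal (gagliardo_kernel s u (x, y)) \<le> ennreal (b j) * indicator (cball x (2 ^ Suc j)) y"
        using j1 by (auto simp: indicator_def h_def dist_norm intro!: ennreal_leI)
      also have "\<dots> \<le> (\<Sum>j. ennreal (b j) * indicator (cball x (2 ^ Suc j)) y)"
        by (rule term_le[of "\<lambda>j. ennreal (b j) * indicator (cball x (2 ^ Suc j)) y"])
      finally show ?thesis by (rule order_trans) simp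
    qed
  qed
  define D where "D x = (\<integral>\<^sup>+ y. ennreal (gagliardo_kernel s u (x, y)) \<partial>lborel)" for x
  have DT: "D x \<le> T" for x
  proof -
    have "D x \<le> (\<integral>\<^sup>+ y. (\<Sum>j. ennreal (a j) * indicator (cball x ((1/2) ^ j)) y) +
        (\<Sum>j. ennreal (b j) * indicator (cball x (2 ^ Suc j)) y) \<partial>lborel)"
      unfolding D_def by (intro nn_integral_mono ptw)
    also have "\<dots> = (\<Sum>j. \<integral>\<^sup>+ y. ennreal (a j) * indicator (cball x ((1/2) ^ j)) y \<partial>lborel) +
        (\<Sum>j. \<integral>\<^sup>+ y. ennreal (b j) * indicator (cball x (2 ^ Suc j)) y \<partial>lborel)"
    proof -
      have m: "(\<lambda>y. ennreal k * indicator (cball x t) y) \<in> borel_measurable lborel" for k t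
      proof -
        have [measurable]: "cball x t \<in> sets borel" by simp
        show ?thesis by measurable
      qed
      show ?thesis
        by (subst nn_integral_add) (intro borel_measurable_suminf_order m, intro borel_measurable_suminf_order m,
            simp only: nn_integral_suminf[OF m])
    qed
    also have "\<dots> = T"
      unfolding T_def using a0 b0 c
      by (simp add: nn_integral_cmult_indicator emeasure_cball c_def ennreal_mult' del: power_Suc)
    finally show ?thesis .
  qed
  have km: "(\<lambda>p. ennreal (gagliardo_kernel s u p)) \<in> borel_measurable (lborel \<Otimes>\<^sub>M lborel)"
    unfolding lborel_prod by measurable
  have sym: "gagliardo_kernel s u (x, y) = gagliardo_kernel s u (y, x)" for x y
    by (simp add: gagliardo_kernel_def norm_minus_commute abs_minus_commute power2_commute)
  have m1: "(\<lambda>p. indicator B (fst p) * ennreal (gagliardo_kernel s u p)) \<in> borel_measurable (lborel \<Otimes>\<^sub>M lborel)"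
    and m2: "(\<lambda>p. indicator B (snd p) * ennreal (gagliardo_kernel s u p)) \<in> borel_measurable (lborel \<Otimes>\<^sub>M lborel)"
    by (intro borel_measurable_times_ennreal km; measurable)+
  have "gagliardo s u = (\<integral>\<^sup>+ p. ennreal (gagliardo_kernel s u p) \<partial>(lborel \<Otimes>\<^sub>M lborel))"
    by (simp add: gagliardo_def lborel_prod)
  also have "\<dots> \<le> (\<integral>\<^sup>+ p. indicator B (fst p) * ennreal (gagliardo_kernel s u p) +
      indicator B (snd p) * ennreal (gagliardo_kernel s u p) \<partial>(lborel \<Otimes>\<^sub>M lborel))"
  proof (intro nn_integral_mono)
    fix p :: "(real ^ 'n) \<times> (real ^ 'n)"
    show "ennreal (gagliardo_kernel s u p) \<le> indicator B (fst p) * ennreal (gagliardo_kernel s u p) +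
      indicator B (snd p) * ennreal (gagliardo_kernel s u p)"
      using B(3)[of "fst p"] B(3)[of "snd p"]
      by (cases p; cases "fst p \<in> B"; cases "snd p \<in> B") (auto simp: gagliardo_kernel_def)
  qed
  also have "\<dots> = (\<integral>\<^sup>+ p. indicator B (fst p) * ennreal (gagliardo_kernel s u p) \<partial>(lborel \<Otimes>\<^sub>M lborel)) +
      (\<integral>\<^sup>+ p. indicator B (snd p) * ennreal (gagliardo_kernel s u p) \<partial>(lborel \<Otimes>\<^sub>M lborel))"
    by (intro nn_integral_add m1 m2)
  also have "(\<integral>\<^sup>+ p. indicator B (fst p) * ennreal (gagliardo_kernel s u p) \<partial>(lborel \<Otimes>\<^sub>M lborel)) =
      (\<integral>\<^sup>+ x. \<integral>\<^sup>+ y. indicator B x * ennreal (gagliardo_kernel s u (x, y)) \<partial>lborel \<partial>lborel)"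
    by (subst lborel.nn_integral_fst[OF m1, symmetric]) simp
  also have "\<dots> \<le> (\<integral>\<^sup>+ x. T * indicator B x \<partial>lborel)"
    by (intro nn_integral_mono) (use DT in \<open>auto simp: indicator_def D_def\<close>)
  also have "(\<integral>\<^sup>+ p. indicator B (snd p) * ennreal (gagliardo_kernel s u p) \<partial>(lborel \<Otimes>\<^sub>M lborel)) =
      (\<integral>\<^sup>+ y. \<integral>\<^sup>+ x. indicator B y * ennreal (gagliardo_kernel s u (x, y)) \<partial>lborel \<partial>lborel)"
    by (subst lborel_pair.nn_integral_snd[symmetric]) (use m2 in \<open>auto simp: case_prod_beta\<close>)
  also have "\<dots> \<le> (\<integral>\<^sup>+ x. T * indicator B x \<partial>lborel)"
  proof (intro nn_integral_mono)
    fix y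
    have "(\<integral>\<^sup>+ x. indicator B y * ennreal (gagliardo_kernel s u (x, y)) \<partial>lborel) =
        (\<integral>\<^sup>+ x. indicator B y * ennreal (gagliardo_kernel s u (y, x)) \<partial>lborel)"
      by (intro nn_integral_cong) (simp only: sym[of _ y])
    then show "(\<integral>\<^sup>+ x. indicator B y * ennreal (gagliardo_kernel s u (x, y)) \<partial>lborel) \<le> T * indicator B y"
      using DT[of y] by (auto simp: indicator_def D_def)
  qed
  also have "(\<integral>\<^sup>+ x. T * indicator B x \<partial>lborel) = T * emeasure lborel B"
    by (simp add: nn_integral_cmult_indicator)
  finally have "gagliardo s u \<le> T * emeasure lborel B + T * emeasure lborel B"
    by (simp add: add_left_mono add_right_mono)
  also have "\<dots> < \<infinity>"
    using T emeasure_bounded_finite[OF B(1)] by (simp add: ennreal_mult_less_top)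
  finally show ?thesis .
qed

section \<open>The space \<open>X\<^sub>0\<close> and the Sobolev constant\<close>

lemma X0_norm_borel:
  fixes u :: "real ^ 'n \<Rightarrow> real"
  assumes [measurable]: "u \<in> borel_measurable borel" and u0: "\<And>x. x \<notin> \<Omega> \<Longrightarrow> u x = 0"
  shows "set_integrable lebesgue (Q_set \<Omega>) (gagliardo_kernel s u) \<longleftrightarrow> gagliardo s u < \<infinity>"
    and "(X0_norm s \<Omega> u)\<^sup>2 = enn2real (gagliardo s u)"
proof -
  have ind: "(\<lambda>p. indicator (Q_set \<Omega>) p *\<^sub>R gagliardo_kernel s u p) = gagliardo_kernel s u"
  proof
    fix p :: "(real ^ 'n) \<times> (real ^ 'n)"
    show "indicator (Q_set \<Omega>) p *\<^sub>R gagliardo_kernel s u p = gagliardo_kernel s u p"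
      using u0 by (cases p) (auto simp: Q_set_def indicator_def gagliardo_kernel_def)
  qed
  show "set_integrable lebesgue (Q_set \<Omega>) (gagliardo_kernel s u) \<longleftrightarrow> gagliardo s u < \<infinity>"
    unfolding set_integrable_def ind gagliardo_def
    by (subst integrable_completion) (simp_all add: integrable_iff_bounded)
  have "set_lebesgue_integral lebesgue (Q_set \<Omega>) (gagliardo_kernel s u) = enn2real (gagliardo s u)"
    unfolding set_lebesgue_integral_def ind gagliardo_def
    by (subst integral_completion) (simp_all add: integral_eq_nn_integral)
  then show "(X0_norm s \<Omega> u)\<^sup>2 = enn2real (gagliardo s u)" by (simp add: X0_norm_def)
qed

lemma Lq_norm_borel:
  fixes u :: "real ^ 'n \<Rightarrow> real"
  assumes [measurable]: "u \<in> borel_measurable borel" and u0: "\<And>x. x \<notin> \<Omega> \<Longrightarrow> u x = 0"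
  shows "Lq_norm q \<Omega> u = (\<integral>x. \<bar>u x\<bar> powr q \<partial>lborel) powr (1 / q)"
proof -
  have ind: "(\<lambda>x. indicator \<Omega> x *\<^sub>R \<bar>u x\<bar> powr q) = (\<lambda>x. \<bar>u x\<bar> powr q)"
  proof
    fix x show "indicator \<Omega> x *\<^sub>R \<bar>u x\<bar> powr q = \<bar>u x\<bar> powr q"
      by (cases "x \<in> \<Omega>") (auto simp: u0)
  qed
  show ?thesis
    unfolding Lq_norm_def set_lebesgue_integral_def ind by (subst integral_completion) simp_all
qed

lemma Lq_norm_powr:
  fixes u :: "real ^ 'n \<Rightarrow> real"
  assumes "u \<in> borel_measurable borel" "\<And>x. x \<notin> \<Omega> \<Longrightarrow> u x = 0" and q: "0 < q"
  shows "Lq_norm q \<Omega> u powr q = (\<integral>x. \<bar>u x\<bar> powr q \<partial>lborel)"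
    and "(Lq_norm q \<Omega> u)\<^sup>2 = (\<integral>x. \<bar>u x\<bar> powr q \<partial>lborel) powr (2 / q)"
proof -
  have nn: "0 \<le> (\<integral>x. \<bar>u x\<bar> powr q \<partial>lborel)" by (intro Bochner_Integration.integral_nonneg) auto
  have L: "Lq_norm q \<Omega> u = (\<integral>x. \<bar>u x\<bar> powr q \<partial>lborel) powr (1 / q)"
    by (rule Lq_norm_borel) (use assms in auto)
  show "Lq_norm q \<Omega> u powr q = (\<integral>x. \<bar>u x\<bar> powr q \<partial>lborel)"
    using nn q by (simp add: L powr_powr)
  show "(Lq_norm q \<Omega> u)\<^sup>2 = (\<integral>x. \<bar>u x\<bar> powr q \<partial>lborel) powr (2 / q)"
    unfolding L power2_eq_square by (simp flip: powr_add)
qed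

text \<open>Square integrability comes from the energy: the Sobolev inequality gives L^q, and u^2
  \<le> \<bar>u\<bar>^q + 1 on the bounded set \<Omega>.\<close>

lemma X0_borel_iff:
  fixes u :: "real ^ 'n \<Rightarrow> real"
  assumes s: "0 < s" "4 * s < real CARD('n)" and \<Omega>: "open \<Omega>" "bounded \<Omega>"
    and [measurable]: "u \<in> borel_measurable borel" and u0: "\<And>x. x \<notin> \<Omega> \<Longrightarrow> u x = 0"
  shows "u \<in> X0 s \<Omega> \<longleftrightarrow> gagliardo s u < \<infinity>"
proof
  assume "u \<in> X0 s \<Omega>"
  then show "gagliardo s u < \<infinity>" using X0_norm_borel(1)[of u \<Omega> s] u0 by (simp add: X0_def)
next
  assume fin: "gagliardo s u < \<infinity>"
  define q where "q = crit_exp CARD('n) s"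
  have q: "2 < q" using crit_exp_facts[of s "CARD('n)"] s by (simp add: q_def)
  have i: "integrable lborel (\<lambda>x. \<bar>u x\<bar> powr q)"
    unfolding q_def by (rule integrable_crit_powr[OF s \<Omega>(2)]) (use u0 fin in auto)
  have i\<Omega>: "integrable lborel (\<lambda>x. indicator \<Omega> x :: real)"
    using \<Omega>(1) emeasure_bounded_finite[OF \<Omega>(2)] by (intro integrable_real_indicator) auto
  have [measurable]: "\<Omega> \<in> sets borel" using \<Omega> by simp
  have "integrable lborel (\<lambda>x. indicator \<Omega> x *\<^sub>R (u x)\<^sup>2)"
  proof (rule Bochner_Integration.integrable_bound)
    show "integrable lborel (\<lambda>x. \<bar>u x\<bar> powr q + indicator \<Omega> x)"
      using i i\<Omega> by (rule Bochner_Integration.integrable_add)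
    show "AE x in lborel. norm (indicator \<Omega> x *\<^sub>R (u x)\<^sup>2) \<le> norm (\<bar>u x\<bar> powr q + indicator \<Omega> x)"
    proof (intro AE_I2)
      fix x
      have "(u x)\<^sup>2 \<le> \<bar>u x\<bar> powr q + 1"
      proof (cases "\<bar>u x\<bar> \<le> 1")
        case True
        then have "(u x)\<^sup>2 \<le> 1" by (simp add: abs_square_le_1)
        then show ?thesis by (simp add: add_increasing)
      next
        case False
        then have "\<bar>u x\<bar> powr 2 \<le> \<bar>u x\<bar> powr q" using q by (intro powr_mono) auto
        then show ?thesis using False by (simp add: powr_numeral)
      qed
      then show "norm (indicator \<Omega> x *\<^sub>R (u x)\<^sup>2) \<le> norm (\<bar>u x\<bar> powr q + indicator \<Omega> x)"
        by (auto simp: indicator_def)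
    qed
  qed measurable
  then have "set_integrable lebesgue \<Omega> (\<lambda>x. (u x)\<^sup>2)"
    unfolding set_integrable_def by (subst integrable_completion) simp_all
  moreover have "u \<in> borel_measurable lebesgue" by (intro measurable_completion) simp
  ultimately show "u \<in> X0 s \<Omega>"
    using X0_norm_borel(1)[of u \<Omega> s] u0 fin by (simp add: X0_def)
qed

text \<open>An exceptional set N in one variable becomes the union of N x UNIV and UNIV x N, both
  null in the product. This carries a.e. statements about functions over to difference
  quotients.\<close>

lemma AE_lborel_pair:
  assumes "AE x in (lborel :: 'a::euclidean_space measure). P x"
  shows "AE p in (lborel :: ('a \<times> 'a) measure). P (fst p) \<and> P (snd p)"
proof -
  obtain N :: "'a set" where N: "N \<in> null_sets lborel" "{x. \<not> P x} \<subseteq> N"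
    using assms by (auto elim!: AE_E simp: null_sets_def)
  have [measurable]: "N \<in> sets borel" using N by (auto simp: null_sets_def)
  have N0: "emeasure lborel N = 0" using N by auto
  have "emeasure (lborel \<Otimes>\<^sub>M lborel) (N \<times> (UNIV :: 'a set)) = 0"
    by (subst lborel.emeasure_pair_measure_Times) (auto simp: N0)
  then have 1: "N \<times> UNIV \<in> null_sets (lborel :: ('a \<times> 'a) measure)"
    unfolding lborel_prod[symmetric] by (intro null_setsI) auto
  have "emeasure (lborel \<Otimes>\<^sub>M lborel) ((UNIV :: 'a set) \<times> N) = 0"
    by (subst lborel.emeasure_pair_measure_Times) (auto simp: N0)
  then have 2: "UNIV \<times> N \<in> null_sets (lborel :: ('a \<times> 'a) measure)"
    unfolding lborel_prod[symmetric] by (intro null_setsI) auto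
  show ?thesis
    by (rule AE_I'[OF null_sets.Un[OF 1 2]]) (use N in auto)
qed

text \<open>A Lebesgue measurable function is a.e. equal to a Borel one; multiplying by the
  indicator of \<Omega> turns vanishing a.e. outside into vanishing everywhere outside. Norms are
  integrals and do not notice.\<close>

lemma X0_representative:
  fixes u :: "real ^ 'n \<Rightarrow> real"
  assumes \<Omega>: "open \<Omega>" and u: "u \<in> X0 s \<Omega>"
  obtains v where "v \<in> borel_measurable borel" "\<And>x. x \<notin> \<Omega> \<Longrightarrow> v x = 0" "AE x in lebesgue. u x = v x"
    "v \<in> X0 s \<Omega>" "X0_norm s \<Omega> u = X0_norm s \<Omega> v" "\<And>q. Lq_norm q \<Omega> u = Lq_norm q \<Omega> v"
proof -
  have [measurable]: "\<Omega> \<in> sets borel" using \<Omega> by simp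
  have um [measurable]: "u \<in> borel_measurable lebesgue" and u0: "AE x in lebesgue. x \<notin> \<Omega> \<longrightarrow> u x = 0"
    using u by (auto simp: X0_def)
  obtain w where [measurable]: "w \<in> borel_measurable lborel" and w: "AE x in lborel. u x = w x"
    using completion_ex_borel_measurable_real[OF um] by auto
  define v where "v x = indicator \<Omega> x * w x" for x
  have vm [measurable]: "v \<in> borel_measurable borel" unfolding v_def by measurable
  have v0: "v x = 0" if "x \<notin> \<Omega>" for x using that by (simp add: v_def)
  have uv: "AE x in lborel. u x = v x"
    using w u0[unfolded AE_completion_iff] by eventually_elim (auto simp: v_def indicator_def)
  have uvl: "AE x in lebesgue. u x = v x" using uv by (rule AE_completion)
  have k: "AE p in lebesgue. indicator (Q_set \<Omega>) p *\<^sub>R gagliardo_kernel s u p =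
      indicator (Q_set \<Omega>) p *\<^sub>R gagliardo_kernel s v p"
  proof (rule AE_completion)
    show "AE p in lborel. indicator (Q_set \<Omega>) p *\<^sub>R gagliardo_kernel s u p =
      indicator (Q_set \<Omega>) p *\<^sub>R gagliardo_kernel s v p"
      using AE_lborel_pair[OF uv] by eventually_elim (auto simp: gagliardo_kernel_def)
  qed
  have ki: "integrable lebesgue (\<lambda>p. indicator (Q_set \<Omega>) p *\<^sub>R gagliardo_kernel s u p)"
    using u by (simp add: X0_def set_integrable_def)
  have [measurable]: "Q_set \<Omega> \<in> sets borel"
  proof -
    have "Q_set \<Omega> = \<Omega> \<times> UNIV \<union> UNIV \<times> \<Omega>" by (auto simp: Q_set_def)
    also have "open \<dots>" using \<Omega> by (intro open_Un open_Times) auto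
    finally show ?thesis by simp
  qed
  have kvm: "(\<lambda>p. indicator (Q_set \<Omega>) p *\<^sub>R gagliardo_kernel s v p) \<in> borel_measurable lebesgue"
    by (intro measurable_completion) simp
  have "integrable lebesgue (\<lambda>p. indicator (Q_set \<Omega>) p *\<^sub>R gagliardo_kernel s v p)"
    using integrable_cong_AE_imp[OF ki kvm] k by simp
  moreover have "X0_norm s \<Omega> u = X0_norm s \<Omega> v"
    unfolding X0_norm_def set_lebesgue_integral_def
    using integral_cong_AE[OF _ kvm k] ki by simp
  moreover have "Lq_norm q \<Omega> u = Lq_norm q \<Omega> v" for q
  proof -
    have vl: "v \<in> borel_measurable lebesgue" by (intro measurable_completion) simp
    have "(\<integral>x. indicator \<Omega> x *\<^sub>R \<bar>u x\<bar> powr q \<partial>lebesgue) = (\<integral>x. indicator \<Omega> x *\<^sub>R \<bar>v x\<bar> powr q \<partial>lebesgue)"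
    proof (rule integral_cong_AE)
      have [measurable]: "\<Omega> \<in> sets lebesgue" using \<Omega> by simp
      show "(\<lambda>x. indicator \<Omega> x *\<^sub>R \<bar>u x\<bar> powr q) \<in> borel_measurable lebesgue" by measurable
      show "(\<lambda>x. indicator \<Omega> x *\<^sub>R \<bar>v x\<bar> powr q) \<in> borel_measurable lebesgue" using vl by measurable
      show "AE x in lebesgue. indicator \<Omega> x *\<^sub>R \<bar>u x\<bar> powr q = indicator \<Omega> x *\<^sub>R \<bar>v x\<bar> powr q"
        using uvl by eventually_elim simp
    qed
    then show ?thesis by (simp add: Lq_norm_def set_lebesgue_integral_def)
  qed
  moreover have "v \<in> X0 s \<Omega>"
  proof -
    have vl [measurable]: "v \<in> borel_measurable lebesgue" by (intro measurable_completion) simp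
    have [measurable]: "\<Omega> \<in> sets lebesgue" using \<Omega> by simp
    have "integrable lebesgue (\<lambda>x. indicator \<Omega> x *\<^sub>R (u x)\<^sup>2)"
      using u by (simp add: X0_def set_integrable_def)
    then have "integrable lebesgue (\<lambda>x. indicator \<Omega> x *\<^sub>R (v x)\<^sup>2)"
    proof (rule integrable_cong_AE_imp)
      show "(\<lambda>x. indicator \<Omega> x *\<^sub>R (v x)\<^sup>2) \<in> borel_measurable lebesgue"
        by (intro borel_measurable_scaleR borel_measurable_indicator borel_measurable_power vl) simp
      show "AE x in lebesgue. indicator \<Omega> x *\<^sub>R (u x)\<^sup>2 = indicator \<Omega> x *\<^sub>R (v x)\<^sup>2"
        using uvl by eventually_elim simp
    qed
    then show ?thesis
      using calculation(1) v0 vl by (simp add: X0_def set_integrable_def)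
  qed
  ultimately show ?thesis using that[OF vm v0 uvl] by simp
qed

text \<open>A tent function over a ball in \<Omega>: it is 1-Lipschitz with oscillation at most r.
  It keeps the infimum defining \<open>sobolev_const\<close> from running over the empty set and
  yields a competitor of negative energy.\<close>

lemma X0_nonzero_exists:
  fixes \<Omega> :: "(real ^ 'n) set"
  assumes s: "0 < s" "s < 1" "4 * s < real CARD('n)" and \<Omega>: "open \<Omega>" "bounded \<Omega>" "\<Omega> \<noteq> {}"
  shows "X0_nonzero s \<Omega> \<noteq> {}"
proof -
  obtain x0 where "x0 \<in> \<Omega>" using \<Omega> by auto
  then obtain r where r: "0 < r" "ball x0 r \<subseteq> \<Omega>" using \<Omega>(1) openE by blast
  define u :: "real ^ 'n \<Rightarrow> real" where "u x = max 0 (r - dist x0 x)" for x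
  have [measurable]: "u \<in> borel_measurable borel" unfolding u_def by measurable
  have u0: "u x = 0" if "x \<notin> ball x0 r" for x using that by (simp add: u_def)
  have "gagliardo s u < \<infinity>"
  proof (rule gagliardo_finiteI[OF s(1,2), where B = "ball x0 r" and R = r])
    fix x y
    have "dist x0 x \<le> dist x0 y + dist x y" "dist x0 y \<le> dist x0 x + dist x y"
      using dist_triangle[of x0 x y] dist_triangle[of x0 y x] by (auto simp: dist_commute)
    moreover have "\<bar>max 0 (r - a) - max 0 (r - b)\<bar> \<le> d" if "a \<le> b + d" "b \<le> a + d" "0 \<le> d" for a b d :: real
      using that unfolding max_def by auto
    ultimately show "\<bar>u x - u y\<bar> \<le> norm (x - y)"
      unfolding u_def dist_norm[symmetric] by (metis zero_le_dist)
    have "\<bar>max 0 (r - a) - max 0 (r - b)\<bar> \<le> r" if "0 \<le> a" "0 \<le> b" for a b :: real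
      using that r(1) unfolding max_def by auto
    then show "\<bar>u x - u y\<bar> \<le> r" unfolding u_def by (metis zero_le_dist)
  qed (use u0 in auto)
  then have "u \<in> X0 s \<Omega>"
    using subsetD[OF r(2)] by (subst X0_borel_iff[OF s(1,3) \<Omega>(1,2)]) (auto intro: u0)
  moreover have "\<not> (AE x in lebesgue. u x = 0)"
  proof
    assume "AE x in lebesgue. u x = 0"
    then have "AE x in lborel. u x = 0" by (simp add: AE_completion_iff)
    then have "AE x in lborel. x \<notin> ball x0 r"
      by eventually_elim (auto simp: u_def max_def split: if_splits)
    then have "emeasure lborel (ball x0 r) = 0"
      by (subst (asm) AE_iff_measurable[OF _ refl]) (auto simp: ball_def)
    then show False using r unit_ball_vol_pos[of "real CARD('n)"] by (simp add: emeasure_ball)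
  qed
  ultimately show ?thesis by (auto simp: X0_nonzero_def)
qed

text \<open>Every quotient is at least the \<kappa> of the Sobolev inequality. Nonzero functions
  have positive L^q norm, so no quotient is a division by 0; for null functions the second claim
  holds because their L^q norm is 0.\<close>

lemma sobolev_const_pos:
  fixes \<Omega> :: "(real ^ 'n) set" and s :: real
  defines "q \<equiv> crit_exp CARD('n) s"
  assumes s: "0 < s" "s < 1" "4 * s < real CARD('n)" and \<Omega>: "open \<Omega>" "bounded \<Omega>" "\<Omega> \<noteq> {}"
  shows "0 < sobolev_const s \<Omega>"
    and "\<And>u. u \<in> X0 s \<Omega> \<Longrightarrow> sobolev_const s \<Omega> * (Lq_norm q \<Omega> u)\<^sup>2 \<le> (X0_norm s \<Omega> u)\<^sup>2"
proof -
  obtain \<kappa> where \<kappa>: "0 < \<kappa>" "\<And>u. u \<in> borel_measurable borel \<Longrightarrow> (\<And>x. x \<notin> \<Omega> \<Longrightarrow> u x = 0) \<Longrightarrow> gagliardo s u < \<infinity> \<Longrightarrow>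
      integrable lborel (\<lambda>x. \<bar>u x\<bar> powr q) \<and>
      \<kappa> * (\<integral>x. \<bar>u x\<bar> powr q \<partial>lborel) powr (2 / q) \<le> enn2real (gagliardo s u)"
    using fractional_sobolev[OF s(1,3) \<Omega>(2)] unfolding q_def by blast
  have q: "2 < q" using crit_exp_facts[of s "CARD('n)"] s by (simp add: q_def)
  have le: "\<kappa> * (Lq_norm q \<Omega> u)\<^sup>2 \<le> (X0_norm s \<Omega> u)\<^sup>2" if u: "u \<in> X0 s \<Omega>" for u
  proof -
    obtain v where v: "v \<in> borel_measurable borel" "\<And>x. x \<notin> \<Omega> \<Longrightarrow> v x = 0" "v \<in> X0 s \<Omega>"
      "X0_norm s \<Omega> u = X0_norm s \<Omega> v" "\<And>q. Lq_norm q \<Omega> u = Lq_norm q \<Omega> v"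
      using X0_representative[OF \<Omega>(1) u] by metis
    have "gagliardo s v < \<infinity>" using X0_borel_iff[OF s(1,3) \<Omega>(1,2) v(1,2)] v(3) by simp
    then show ?thesis
      using \<kappa>(2)[OF v(1,2)] q X0_norm_borel(2)[OF v(1,2)] Lq_norm_powr(2)[OF v(1,2), where q = q]
      by (simp add: v(4,5))
  qed
  have pos: "0 < Lq_norm q \<Omega> u" if u: "u \<in> X0_nonzero s \<Omega>" for u
  proof -
    have u': "u \<in> X0 s \<Omega>" using u by (simp add: X0_nonzero_def)
    obtain v where v: "v \<in> borel_measurable borel" "\<And>x. x \<notin> \<Omega> \<Longrightarrow> v x = 0" "v \<in> X0 s \<Omega>"
      "AE x in lebesgue. u x = v x" "\<And>q. Lq_norm q \<Omega> u = Lq_norm q \<Omega> v"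
      using X0_representative[OF \<Omega>(1) u'] by metis
    have "gagliardo s v < \<infinity>" using X0_borel_iff[OF s(1,3) \<Omega>(1,2) v(1,2)] v(3) by simp
    then have i: "integrable lborel (\<lambda>x. \<bar>v x\<bar> powr q)" using \<kappa>(2)[OF v(1,2)] by simp
    have "(\<integral>x. \<bar>v x\<bar> powr q \<partial>lborel) \<noteq> 0"
    proof
      assume "(\<integral>x. \<bar>v x\<bar> powr q \<partial>lborel) = 0"
      then have "AE x in lborel. \<bar>v x\<bar> powr q = 0"
        using integral_nonneg_eq_0_iff_AE[OF i] by simp
      then have "AE x in lebesgue. v x = 0" unfolding AE_completion_iff by eventually_elim simp
      then have "AE x in lebesgue. u x = 0" using v(4) by eventually_elim simp
      then show False using u by (simp add: X0_nonzero_def)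
    qed
    then show ?thesis by (simp add: v(5) Lq_norm_borel[OF v(1,2)] less_le)
  qed
  let ?R = "\<lambda>u. (X0_norm s \<Omega> u)\<^sup>2 / (Lq_norm q \<Omega> u)\<^sup>2"
  have ne: "X0_nonzero s \<Omega> \<noteq> {}" by (rule X0_nonzero_exists[OF s \<Omega>])
  have "\<kappa> \<le> ?R u" if "u \<in> X0_nonzero s \<Omega>" for u
    using le[of u] pos[OF that] that by (simp add: X0_nonzero_def pos_le_divide_eq)
  then have "\<kappa> \<le> sobolev_const s \<Omega>"
    unfolding sobolev_const_def q_def[symmetric] by (intro cINF_greatest ne) auto
  then show S: "0 < sobolev_const s \<Omega>" using \<kappa> by simp
  fix u assume u: "u \<in> X0 s \<Omega>"
  show "sobolev_const s \<Omega> * (Lq_norm q \<Omega> u)\<^sup>2 \<le> (X0_norm s \<Omega> u)\<^sup>2"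
  proof (cases "u \<in> X0_nonzero s \<Omega>")
    case True
    have "sobolev_const s \<Omega> \<le> ?R u"
      unfolding sobolev_const_def q_def[symmetric]
      using True by (intro cINF_lower bdd_belowI2[of _ 0]) auto
    then show ?thesis using pos[OF True] by (simp add: pos_le_divide_eq)
  next
    case False
    then have "AE x in lebesgue. u x = 0" using u by (simp add: X0_nonzero_def)
    then have "AE x in lebesgue. indicator \<Omega> x *\<^sub>R \<bar>u x\<bar> powr q = 0"
      by eventually_elim simp
    then have "(\<integral>x. indicator \<Omega> x *\<^sub>R \<bar>u x\<bar> powr q \<partial>lebesgue) = 0"
      by (rule integral_eq_zero_AE)
    then have "Lq_norm q \<Omega> u = 0" by (simp add: Lq_norm_def set_lebesgue_integral_def)
    then show ?thesis by simp
  qed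
qed

section \<open>The primitive of the nonlinearity\<close>

text \<open>\<open>h x t\<close> is the limit of \<open>h x (\<lfloor>kt\<rfloor>/k)\<close>, which only involves countably many values of the second argument.\<close>

lemma caratheodory_joint_measurable:
  fixes h :: "'a \<Rightarrow> real \<Rightarrow> real"
  assumes m [measurable]: "\<And>t. (\<lambda>x. h x t) \<in> borel_measurable M"
    and c: "\<And>x. x \<in> space M \<Longrightarrow> continuous_on UNIV (h x)"
  shows "(\<lambda>p. h (fst p) (snd p)) \<in> borel_measurable (M \<Otimes>\<^sub>M lborel)"
proof (rule borel_measurable_LIMSEQ_real)
  define d where "d k t = real_of_int \<lfloor>real (Suc k) * t\<rfloor> / real (Suc k)" for k t
  show "(\<lambda>p. h (fst p) (d k (snd p))) \<in> borel_measurable (M \<Otimes>\<^sub>M lborel)" for k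
    unfolding d_def
  proof (rule measurable_compose_countable[where f = "\<lambda>i p. h (fst p) (real_of_int i / real (Suc k))"
        and g = "\<lambda>p. \<lfloor>real (Suc k) * snd p\<rfloor>"])
    show "(\<lambda>p. h (fst p) (real_of_int i / real (Suc k))) \<in> borel_measurable (M \<Otimes>\<^sub>M lborel)" for i
      by measurable
    show "(\<lambda>p. \<lfloor>real (Suc k) * snd p\<rfloor>) \<in> M \<Otimes>\<^sub>M lborel \<rightarrow>\<^sub>M count_space UNIV"
      by measurable
  qed
  have dt: "(\<lambda>k. d k t) \<longlonglongrightarrow> t" for t
  proof (rule tendsto_sandwich)
    show "\<forall>\<^sub>F k in sequentially. t - 1 / real (Suc k) \<le> d k t"
    proof (intro always_eventually allI)
      fix k
      have "real (Suc k) * t - 1 \<le> real_of_int \<lfloor>real (Suc k) * t\<rfloor>" by linarith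
      then have "(real (Suc k) * t - 1) / real (Suc k) \<le> d k t"
        unfolding d_def by (intro divide_right_mono) auto
      then show "t - 1 / real (Suc k) \<le> d k t" by (simp add: diff_divide_distrib)
    qed
    show "\<forall>\<^sub>F k in sequentially. d k t \<le> t"
    proof (intro always_eventually allI)
      fix k
      have "real_of_int \<lfloor>real (Suc k) * t\<rfloor> / real (Suc k) \<le> real (Suc k) * t / real (Suc k)"
        by (intro divide_right_mono) auto
      then show "d k t \<le> t" by (simp add: d_def)
    qed
    have "(\<lambda>k. t - inverse (real (Suc k))) \<longlonglongrightarrow> t - 0"
      by (intro tendsto_diff tendsto_const LIMSEQ_inverse_real_of_nat)
    then show "(\<lambda>k. t - 1 / real (Suc k)) \<longlonglongrightarrow> t" by (simp add: inverse_eq_divide)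
  qed auto
  show "(\<lambda>k. h (fst p) (d k (snd p))) \<longlonglongrightarrow> h (fst p) (snd p)" if "p \<in> space (M \<Otimes>\<^sub>M lborel)" for p
  proof -
    have "fst p \<in> space M" using that by (auto simp: space_pair_measure)
    then have "isCont (h (fst p)) (snd p)" using c by (simp add: continuous_on_eq_continuous_at)
    then show ?thesis using dt by (rule isCont_tendsto_compose)
  qed
qed

text \<open>One of the two integrals is over the empty set; the form avoids a case distinction on the sign of \<open>t\<close>.\<close>

lemma primitive_eq_diff:
  "primitive g x t = (\<integral>\<tau>. indicator {0<..<t} \<tau> * g x \<tau> \<partial>lborel) - (\<integral>\<tau>. indicator {t<..<0} \<tau> * g x \<tau> \<partial>lborel)"
proof (cases "0 \<le> t")
  case True
  then have "{t<..<0} = {}" by auto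
  then show ?thesis using True
    by (simp add: primitive_def interval_lebesgue_integral_def zero_ereal_def set_lebesgue_integral_def)
next
  case False
  then have "{0<..<t} = {}" by auto
  then show ?thesis using False
    by (simp add: primitive_def interval_lebesgue_integral_def zero_ereal_def set_lebesgue_integral_def)
qed

text \<open>The primitive is a parameter integral with moving endpoint \<open>u x\<close>, so
  measurability comes from joint measurability of the integrand, which in turn rests on continuity
  in the second variable.\<close>

lemma measurable_primitive:
  fixes u :: "real ^ 'n \<Rightarrow> real"
  assumes car: "caratheodory \<Omega> g" and \<Omega>: "open \<Omega>" and u: "u \<in> borel_measurable lebesgue"
  shows "(\<lambda>x. indicator \<Omega> x *\<^sub>R primitive g x (u x)) \<in> borel_measurable lebesgue"
proof -
  have \<Omega>m: "\<Omega> \<inter> space lebesgue \<in> sets lebesgue" using \<Omega> by simp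
  obtain N where N: "N \<in> null_sets (lebesgue_on \<Omega>)" "{x \<in> space (lebesgue_on \<Omega>). \<not> continuous_on UNIV (g x)} \<subseteq> N"
    using car unfolding caratheodory_def by (auto elim!: AE_E simp: null_sets_def)
  have [measurable]: "N \<in> sets (lebesgue_on \<Omega>)" using N by auto
  \<comment> \<open>Continuity is known only for almost every x. Setting \<open>g\<close> to 0 on
    the null set \<open>N\<close> gives continuity for every x and changes the primitive only on
    \<open>N\<close>.\<close>
  define h where "h x t = (if x \<in> N then 0 else g x t)" for x t
  have gm [measurable]: "(\<lambda>x. g x t) \<in> borel_measurable (lebesgue_on \<Omega>)" for t
    using car by (simp add: caratheodory_def)
  have [measurable]: "(\<lambda>x. h x t) \<in> borel_measurable (lebesgue_on \<Omega>)" for t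
    unfolding h_def by measurable
  have hc: "continuous_on UNIV (h x)" if "x \<in> space (lebesgue_on \<Omega>)" for x
    using N(2) that by (cases "x \<in> N") (auto simp: h_def[abs_def])
  have hj [measurable]: "(\<lambda>p. h (fst p) (snd p)) \<in> borel_measurable (lebesgue_on \<Omega> \<Otimes>\<^sub>M lborel)"
    by (rule caratheodory_joint_measurable) (use hc in auto)
  have um [measurable]: "u \<in> borel_measurable (lebesgue_on \<Omega>)"
    using u by (rule measurable_restrict_space1)
  have 1: "(\<lambda>x. \<integral>\<tau>. indicator {0<..<u x} \<tau> * h x \<tau> \<partial>lborel) \<in> borel_measurable (lebesgue_on \<Omega>)"
  proof (rule lborel.borel_measurable_lebesgue_integral)
    have "(\<lambda>p. (if 0 < snd p \<and> snd p < u (fst p) then 1 else 0) * h (fst p) (snd p)) \<in>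
        borel_measurable (lebesgue_on \<Omega> \<Otimes>\<^sub>M lborel)" by measurable
    then show "(\<lambda>(x, \<tau>). indicator {0<..<u x} \<tau> * h x \<tau>) \<in> borel_measurable (lebesgue_on \<Omega> \<Otimes>\<^sub>M lborel)"
      by (rule measurable_cong[THEN iffD1, rotated]) (auto simp: indicator_def)
  qed
  have 2: "(\<lambda>x. \<integral>\<tau>. indicator {u x<..<0} \<tau> * h x \<tau> \<partial>lborel) \<in> borel_measurable (lebesgue_on \<Omega>)"
  proof (rule lborel.borel_measurable_lebesgue_integral)
    have "(\<lambda>p. (if u (fst p) < snd p \<and> snd p < 0 then 1 else 0) * h (fst p) (snd p)) \<in>
        borel_measurable (lebesgue_on \<Omega> \<Otimes>\<^sub>M lborel)" by measurable
    then show "(\<lambda>(x, \<tau>). indicator {u x<..<0} \<tau> * h x \<tau>) \<in> borel_measurable (lebesgue_on \<Omega> \<Otimes>\<^sub>M lborel)"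
      by (rule measurable_cong[THEN iffD1, rotated]) (auto simp: indicator_def)
  qed
  have "(\<lambda>x. primitive h x (u x)) \<in> borel_measurable (lebesgue_on \<Omega>)"
    unfolding primitive_eq_diff using 1 2 by (rule borel_measurable_diff)
  then have "(\<lambda>x. indicator \<Omega> x *\<^sub>R primitive h x (u x)) \<in> borel_measurable lebesgue"
    by (rule borel_measurable_restrict_space_iff[OF \<Omega>m, THEN iffD1])
  moreover have "AE x in lebesgue. indicator \<Omega> x *\<^sub>R primitive h x (u x) = indicator \<Omega> x *\<^sub>R primitive g x (u x)"
  proof -
    have "AE x in lebesgue_on \<Omega>. x \<notin> N" using N(1) by (rule AE_not_in)
    then have "AE x in lebesgue. x \<in> \<Omega> \<longrightarrow> x \<notin> N" by (subst (asm) AE_restrict_space_iff[OF \<Omega>m])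
    then show ?thesis by eventually_elim (auto simp: primitive_eq_diff h_def indicator_def)
  qed
  ultimately show ?thesis by (rule borel_measurable_AE)
qed

section \<open>Pointwise behaviour of the primitive: continuity, sign and growth\<close>

lemma primitive_antiderivative:
  assumes "continuous_on UNIV (g x)"
  obtains F where "\<And>t. (F has_real_derivative g x t) (at t)" "\<And>t. primitive g x t = F t - F 0"
proof -
  have "\<exists>F. \<forall>t. -\<infinity> < ereal t \<longrightarrow> ereal t < \<infinity> \<longrightarrow> (F has_vector_derivative g x t) (at t)"
    by (rule einterval_antiderivative) (use assms in \<open>auto simp: continuous_on_eq_continuous_at\<close>)
  then obtain F where F: "\<And>t. (F has_vector_derivative g x t) (at t)" by auto
  have "primitive g x t = F t - F 0" for t
    unfolding primitive_def zero_ereal_def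
    by (rule interval_integral_FTC_finite)
      (use assms F in \<open>auto intro: continuous_on_subset has_vector_derivative_at_within\<close>)
  moreover have "(F has_real_derivative g x t) (at t)" for t
    using F by (simp add: has_real_derivative_iff_has_vector_derivative)
  ultimately show ?thesis by (rule that[rotated])
qed

lemma primitive_0 [simp]: "primitive g x 0 = 0"
  by (simp add: primitive_eq_diff)

text \<open>\<open>0 < z * t\<close> places z strictly on the same side of 0 as t. It treats both
  signs at once and lets the sign condition on \<open>g\<close> act on t * g x z.\<close>

lemma primitive_mean_value:
  assumes "continuous_on UNIV (g x)" "t \<noteq> 0"
  obtains z where "\<bar>z\<bar> \<le> \<bar>t\<bar>" "0 < z * t" "primitive g x t = t * g x z"
proof -
  obtain F where F: "\<And>t. (F has_real_derivative g x t) (at t)" "\<And>t. primitive g x t = F t - F 0"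
    using primitive_antiderivative[where g = g and x = x, OF assms(1)] by metis
  show ?thesis
  proof (cases "0 < t")
    case True
    obtain z where "0 < z" "z < t" "F t - F 0 = (t - 0) * g x z"
      using MVT2[OF True, of F "g x"] F(1) by auto
    then show ?thesis using that[of z] F(2) by auto
  next
    case False
    then have "t < 0" using assms by simp
    then obtain z where z: "t < z" "z < 0" "F 0 - F t = (0 - t) * g x z"
      using MVT2[of t 0 F "g x"] F(1) by auto
    then show ?thesis using that[of z] F(2)[of t] by (auto simp: mult_neg_neg)
  qed
qed

lemma isCont_primitive:
  assumes "continuous_on UNIV (g x)"
  shows "isCont (primitive g x) t"
proof -
  obtain F where F: "\<And>t. (F has_real_derivative g x t) (at t)" "\<And>t. primitive g x t = F t - F 0"
    using primitive_antiderivative[where g = g and x = x, OF assms] by metis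
  have "primitive g x = (\<lambda>t. F t - F 0)" using F(2) by auto
  then show ?thesis using DERIV_isCont[OF F(1)] by (auto intro!: continuous_intros)
qed

lemma primitive_pos:
  assumes "continuous_on UNIV (g x)" "(\<forall>t>0. g x t > 0) \<and> (\<forall>t<0. g x t < 0)" "t \<noteq> 0"
  shows "0 < primitive g x t"
proof -
  obtain z where z: "0 < z * t" "primitive g x t = t * g x z"
    using primitive_mean_value[where g = g and x = x and t = t, OF assms(1,3)] by metis
  then show ?thesis
    using assms(2) by (cases "0 < t") (auto simp: zero_less_mult_iff)
qed

lemma primitive_le:
  assumes "continuous_on UNIV (g x)" "\<And>t. \<bar>g x t\<bar> \<le> c * (1 + \<bar>t\<bar> powr (p - 1))" "1 < p" "0 < c"
  shows "primitive g x t \<le> c * (\<bar>t\<bar> + \<bar>t\<bar> powr p)"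
proof (cases "t = 0")
  case False
  obtain z where z: "\<bar>z\<bar> \<le> \<bar>t\<bar>" "primitive g x t = t * g x z"
    using primitive_mean_value[where g = g and x = x and t = t, OF assms(1) False] by metis
  have "primitive g x t \<le> \<bar>t\<bar> * \<bar>g x z\<bar>" unfolding z(2) abs_mult[symmetric] by (rule abs_ge_self)
  also have "\<dots> \<le> \<bar>t\<bar> * (c * (1 + \<bar>t\<bar> powr (p - 1)))"
  proof (intro mult_left_mono)
    have "\<bar>g x z\<bar> \<le> c * (1 + \<bar>z\<bar> powr (p - 1))" by (rule assms)
    also have "\<dots> \<le> c * (1 + \<bar>t\<bar> powr (p - 1))"
      using z(1) assms by (intro mult_left_mono add_left_mono powr_mono2) auto
    finally show "\<bar>g x z\<bar> \<le> c * (1 + \<bar>t\<bar> powr (p - 1))" .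
  qed simp
  also have "\<dots> = c * (\<bar>t\<bar> + \<bar>t\<bar> powr p)"
    using False by (simp add: powr_diff algebra_simps)
  finally show ?thesis .
qed (simp add: primitive_eq_diff)

text \<open>Beyond \<open>T\<close> the factor r^(q-p) exceeds 2c/\<epsilon>, so the q-th power
  absorbs both terms, each at most c r^p; below \<open>T\<close> a constant does. It serves for the
  growth of \<open>g\<close> and, with exponents q/2 < 2, for coercivity.\<close>

lemma subcritical_growth:
  fixes c p q \<epsilon> :: real
  assumes "0 < c" "1 < p" "p < q" "0 < \<epsilon>"
  obtains C where "0 \<le> C" "\<And>t. c * (\<bar>t\<bar> + \<bar>t\<bar> powr p) \<le> C + \<epsilon> * \<bar>t\<bar> powr q"
proof -
  define T where "T = max 1 ((2 * c / \<epsilon>) powr (1 / (q - p)))"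
  have T: "1 \<le> T" by (simp add: T_def)
  have "c * (r + r powr p) \<le> c * (T + T powr p) + \<epsilon> * r powr q" if r: "0 \<le> r" for r
  proof (cases "r \<le> T")
    case True
    then have "c * (r + r powr p) \<le> c * (T + T powr p)"
      using r assms by (intro mult_left_mono add_mono powr_mono2) auto
    moreover have "0 \<le> \<epsilon> * r powr q" using assms by simp
    ultimately show ?thesis by linarith
  next
    case False
    then have r1: "1 < r" using T by simp
    have "2 * c / \<epsilon> = ((2 * c / \<epsilon>) powr (1 / (q - p))) powr (q - p)"
      using assms by (simp add: powr_powr)
    also have "\<dots> \<le> r powr (q - p)"
      using False assms by (intro powr_mono2) (auto simp: T_def)
    finally have "2 * c \<le> \<epsilon> * r powr (q - p)"
      using assms by (simp add: pos_divide_le_eq mult.commute)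
    then have "2 * c * r powr p \<le> \<epsilon> * r powr (q - p) * r powr p" by (intro mult_right_mono) auto
    also have "\<dots> = \<epsilon> * r powr q" using r1 by (simp flip: powr_add)
    finally have 1: "2 * c * r powr p \<le> \<epsilon> * r powr q" .
    have "r powr 1 \<le> r powr p" using r1 assms by (intro powr_mono) auto
    then have "c * (r + r powr p) \<le> c * (2 * r powr p)" using assms r1 by (intro mult_left_mono) auto
    moreover have "0 \<le> c * (T + T powr p)" using assms T by (intro mult_nonneg_nonneg add_nonneg_nonneg) auto
    ultimately show ?thesis using 1 by linarith
  qed
  then have "\<And>t. c * (\<bar>t\<bar> + \<bar>t\<bar> powr p) \<le> c * (T + T powr p) + \<epsilon> * \<bar>t\<bar> powr q" by simp
  moreover have "0 \<le> c * (T + T powr p)" using assms T by (intro mult_nonneg_nonneg add_nonneg_nonneg) auto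
  ultimately show ?thesis using that by blast
qed

section \<open>The integral of the primitive along a.e. convergent sequences\<close>

lemma integral_primitive_le:
  fixes v :: "real ^ 'n \<Rightarrow> real"
  assumes car: "caratheodory \<Omega> g" and \<Omega>: "open \<Omega>" "bounded \<Omega>" and v: "v \<in> borel_measurable lebesgue"
    and g: "AE x in lebesgue. x \<in> \<Omega> \<longrightarrow> (\<forall>t. 0 \<le> primitive g x t \<and> primitive g x t \<le> C + \<epsilon> * \<bar>t\<bar> powr q)"
    and C: "0 \<le> C" "0 \<le> \<epsilon>" and int: "integrable lebesgue (\<lambda>x. \<bar>v x\<bar> powr q)"
  shows "integrable lebesgue (\<lambda>x. indicator \<Omega> x *\<^sub>R primitive g x (v x))"
    and "(\<integral>x. indicator \<Omega> x *\<^sub>R primitive g x (v x) \<partial>lebesgue) \<le>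
           C * measure lebesgue \<Omega> + \<epsilon> * (\<integral>x. \<bar>v x\<bar> powr q \<partial>lebesgue)"
proof -
  have i\<Omega>: "integrable lebesgue (\<lambda>x. indicator \<Omega> x :: real)"
    using \<Omega>(1) emeasure_bounded_finite[OF \<Omega>(2)] by (intro integrable_real_indicator) auto
  have isum: "integrable lebesgue (\<lambda>x. C * indicator \<Omega> x + \<epsilon> * \<bar>v x\<bar> powr q)"
    using i\<Omega> int by auto
  have le: "AE x in lebesgue. indicator \<Omega> x *\<^sub>R primitive g x (v x) \<le> C * indicator \<Omega> x + \<epsilon> * \<bar>v x\<bar> powr q"
    using g by eventually_elim (use C in \<open>auto simp: indicator_def\<close>)
  have nn: "AE x in lebesgue. 0 \<le> indicator \<Omega> x *\<^sub>R primitive g x (v x)"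
    using g by eventually_elim (auto simp: indicator_def)
  show i: "integrable lebesgue (\<lambda>x. indicator \<Omega> x *\<^sub>R primitive g x (v x))"
  proof (rule Bochner_Integration.integrable_bound[OF isum measurable_primitive[OF car \<Omega>(1) v]])
    show "AE x in lebesgue. norm (indicator \<Omega> x *\<^sub>R primitive g x (v x)) \<le> norm (C * indicator \<Omega> x + \<epsilon> * \<bar>v x\<bar> powr q)"
      using le nn by eventually_elim simp
  qed
  have "(\<integral>x. indicator \<Omega> x *\<^sub>R primitive g x (v x) \<partial>lebesgue) \<le> (\<integral>x. C * indicator \<Omega> x + \<epsilon> * \<bar>v x\<bar> powr q \<partial>lebesgue)"
    by (rule integral_mono_AE[OF i isum le])
  also have "\<dots> = C * measure lebesgue \<Omega> + \<epsilon> * (\<integral>x. \<bar>v x\<bar> powr q \<partial>lebesgue)"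
    using i\<Omega> int \<Omega> by (subst Bochner_Integration.integral_add) auto
  finally show "(\<integral>x. indicator \<Omega> x *\<^sub>R primitive g x (v x) \<partial>lebesgue) \<le>
           C * measure lebesgue \<Omega> + \<epsilon> * (\<integral>x. \<bar>v x\<bar> powr q \<partial>lebesgue)" .
qed

text \<open>Fatou is applied to the nonnegative function C + \<delta>\<bar>u\<bar>^q - G(x, u) on
  \<Omega>, extended by \<delta>\<bar>u\<bar>^q outside. The \<delta>-term costs at most \<delta>M <
  e, so a bound in the critical norm suffices. Only the upper estimate is sought, since the term is
  subtracted in the energy.\<close>

lemma integral_primitive_upper_semicontinuous:
  fixes v :: "nat \<Rightarrow> real ^ 'n \<Rightarrow> real"
  assumes car: "caratheodory \<Omega> g" and \<Omega>: "open \<Omega>" "bounded \<Omega>"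
    and v: "\<And>n. v n \<in> borel_measurable lebesgue" "w \<in> borel_measurable lebesgue"
    and g: "\<And>\<epsilon>. 0 < \<epsilon> \<Longrightarrow> \<exists>C\<ge>0. AE x in lebesgue. x \<in> \<Omega> \<longrightarrow>
              (\<forall>t. 0 \<le> primitive g x t \<and> primitive g x t \<le> C + \<epsilon> * \<bar>t\<bar> powr q)"
    and cont: "AE x in lebesgue. x \<in> \<Omega> \<longrightarrow> continuous_on UNIV (g x)" and q: "0 < q"
    and int: "\<And>n. integrable lebesgue (\<lambda>x. \<bar>v n x\<bar> powr q)" "\<And>n. (\<integral>x. \<bar>v n x\<bar> powr q \<partial>lebesgue) \<le> M"
    and intw: "integrable lebesgue (\<lambda>x. \<bar>w x\<bar> powr q)"
    and lim: "AE x in lebesgue. (\<lambda>n. v n x) \<longlonglongrightarrow> w x" and e: "0 < e"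
  shows "\<forall>\<^sub>F n in sequentially. (\<integral>x. indicator \<Omega> x *\<^sub>R primitive g x (v n x) \<partial>lebesgue) \<le>
            (\<integral>x. indicator \<Omega> x *\<^sub>R primitive g x (w x) \<partial>lebesgue) + e"
proof (rule ccontr)
  define I where "I u = (\<integral>x. indicator \<Omega> x *\<^sub>R primitive g x (u x) \<partial>lebesgue)" for u
  define V where "V u = (\<integral>x. \<bar>u x\<bar> powr q \<partial>lebesgue)" for u :: "real ^ 'n \<Rightarrow> real"
  assume "\<not> ?thesis"
  then have fr: "\<exists>\<^sub>F n in sequentially. I w + e < I (v n)"
    by (simp add: frequently_def not_less I_def)
  have V0: "0 \<le> V u" for u unfolding V_def by (intro Bochner_Integration.integral_nonneg) auto
  have VM: "V (v n) \<le> M" for n using int(2) by (simp add: V_def)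
  have M: "0 \<le> M" using V0[of "v 0"] VM[of 0] by linarith
  define \<delta> where "\<delta> = e / (2 * (M + 1))"
  have "0 \<le> e * M" using e M by simp
  then have \<delta>: "0 < \<delta>" "\<delta> * M < e"
    using e M by (auto simp: \<delta>_def pos_divide_less_eq distrib_left intro: add_nonneg_pos)
  obtain C where C: "0 \<le> C" "AE x in lebesgue. x \<in> \<Omega> \<longrightarrow>
              (\<forall>t. 0 \<le> primitive g x t \<and> primitive g x t \<le> C + \<delta> * \<bar>t\<bar> powr q)" using g[OF \<delta>(1)] by auto
  have i\<Omega>: "integrable lebesgue (\<lambda>x. indicator \<Omega> x :: real)"
    using \<Omega>(1) emeasure_bounded_finite[OF \<Omega>(2)] by (intro integrable_real_indicator) auto
  define f where "f u x = C * indicator \<Omega> x + \<delta> * \<bar>u x\<bar> powr q - indicator \<Omega> x *\<^sub>R primitive g x (u x)"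
    for u x
  have fi: "integrable lebesgue (f u)" "integral\<^sup>L lebesgue (f u) = C * measure lebesgue \<Omega> + \<delta> * V u - I u"
    if "u \<in> borel_measurable lebesgue" "integrable lebesgue (\<lambda>x. \<bar>u x\<bar> powr q)" for u
  proof -
    have ip: "integrable lebesgue (\<lambda>x. indicator \<Omega> x *\<^sub>R primitive g x (u x))"
      using integral_primitive_le(1)[OF car \<Omega> that(1) C(2) C(1) less_imp_le[OF \<delta>(1)] that(2)] .
    show "integrable lebesgue (f u)"
      unfolding f_def using i\<Omega> that(2) ip
      by (intro Bochner_Integration.integrable_diff Bochner_Integration.integrable_add integrable_mult_right)
    have "integral\<^sup>L lebesgue (f u) = (\<integral>x. C * indicator \<Omega> x + \<delta> * \<bar>u x\<bar> powr q \<partial>lebesgue) - I u"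
      unfolding f_def I_def using i\<Omega> that(2) ip
      by (intro Bochner_Integration.integral_diff Bochner_Integration.integrable_add integrable_mult_right)
    also have "(\<integral>x. C * indicator \<Omega> x + \<delta> * \<bar>u x\<bar> powr q \<partial>lebesgue) = C * measure lebesgue \<Omega> + \<delta> * V u"
      unfolding V_def using i\<Omega> that(2) \<Omega> by (subst Bochner_Integration.integral_add) auto
    finally show "integral\<^sup>L lebesgue (f u) = C * measure lebesgue \<Omega> + \<delta> * V u - I u" .
  qed
  have "integral\<^sup>L lebesgue (f w) \<le> C * measure lebesgue \<Omega> + \<delta> * M - (I w + e)"
  proof (rule fatou_real(2)[where f = "\<lambda>n. f (v n)"])
    show "f (v n) \<in> borel_measurable lebesgue" "integrable lebesgue (f (v n))" for n
      using fi(1)[OF v(1) int(1), of n] by auto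
    show "f w \<in> borel_measurable lebesgue" using fi(1)[OF v(2) intw] by auto
    show "AE x in lebesgue. (\<lambda>n. f (v n) x) \<longlonglongrightarrow> f w x"
      using lim cont
    proof eventually_elim
      case (elim x)
      have 1: "(\<lambda>n. \<bar>v n x\<bar> powr q) \<longlonglongrightarrow> \<bar>w x\<bar> powr q"
        using q by (intro tendsto_powr' tendsto_rabs tendsto_const elim) auto
      have 2: "(\<lambda>n. indicator \<Omega> x *\<^sub>R primitive g x (v n x)) \<longlonglongrightarrow> indicator \<Omega> x *\<^sub>R primitive g x (w x)"
      proof (cases "x \<in> \<Omega>")
        case True
        then have "isCont (primitive g x) (w x)" using elim(2) by (intro isCont_primitive) simp
        then have "(\<lambda>n. primitive g x (v n x)) \<longlonglongrightarrow> primitive g x (w x)"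
          using elim(1) by (rule isCont_tendsto_compose)
        then show ?thesis by (rule tendsto_scaleR[OF tendsto_const])
      qed simp
      show ?case unfolding f_def by (intro tendsto_diff tendsto_add tendsto_mult tendsto_const 1 2)
    qed
    show "AE x in lebesgue. 0 \<le> f (v n) x" for n
      using C(2)
    proof eventually_elim
      case (elim x)
      then show ?case using C(1) \<delta>(1) by (cases "x \<in> \<Omega>") (auto simp: f_def)
    qed
    show "\<exists>\<^sub>F n in sequentially. integral\<^sup>L lebesgue (f (v n)) \<le> C * measure lebesgue \<Omega> + \<delta> * M - (I w + e)"
      using fr
    proof (rule frequently_elim1)
      fix n assume "I w + e < I (v n)"
      moreover have "\<delta> * V (v n) \<le> \<delta> * M" using VM \<delta> by (intro mult_left_mono) auto
      ultimately show "integral\<^sup>L lebesgue (f (v n)) \<le> C * measure lebesgue \<Omega> + \<delta> * M - (I w + e)"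
        unfolding fi(2)[OF v(1) int(1)] by linarith
    qed
  qed
  then have "\<delta> * V w + e \<le> \<delta> * M" unfolding fi(2)[OF v(2) intw] by linarith
  moreover have "0 \<le> \<delta> * V w" using \<delta> V0 by simp
  ultimately show False using \<delta>(2) by linarith
qed

section \<open>Minimization of the energy\<close>

text \<open>
  Here \<open>\<alpha> = (N - 4s) / (2s)\<close>, so that \<open>q / 2 = 1 + \<theta>\<close> and \<open>h\<close> is the condition on \<open>a\<close>, \<open>b\<close> of the theorem. It is
  exactly what the weighted arithmetic-geometric mean inequality with weights \<open>1 - \<theta>\<close>, \<open>\<theta>\<close> needs.
\<close>

lemma young_critical:
  fixes a b S \<alpha> B :: real
  defines "\<theta> \<equiv> 1 / (\<alpha> + 1)"
  assumes pos: "0 < a" "0 < b" "0 < S" "0 < \<alpha>" and B: "0 \<le> B"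
    and h: "2 * \<alpha> powr \<alpha> / ((\<alpha> + 2) powr (\<alpha> + 1) * S powr (\<alpha> + 2)) \<le> a powr \<alpha> * b"
  shows "1 / (2 * (1 + \<theta>)) * (B / S) powr (1 + \<theta>) \<le> a / 2 * B + b / 4 * B\<^sup>2"
proof (cases "B = 0")
  case False
  then have B0: "0 < B" using B by simp
  have \<theta>: "0 < \<theta>" "\<theta> < 1" "1 - \<theta> = \<alpha> * \<theta>" "(\<alpha> + 1) * \<theta> = 1"
    using pos by (auto simp: \<theta>_def field_simps)
  \<comment> \<open>Chosen such that (1 - \<theta>)X + \<theta>Y = a/2 + b/4 B, the right-hand side
    of the claim divided by B.\<close>
  define X where "X = a / (2 * (1 - \<theta>))"
  define Y where "Y = b * B / (4 * \<theta>)"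
  have X: "0 < X" and Y: "0 < Y" using \<theta> pos B0 by (auto simp: X_def Y_def)
  have "X powr (1 - \<theta>) * Y powr \<theta> \<le> (1 - \<theta>) * X + \<theta> * Y"
    using \<theta> X Y by (intro Youngs_inequality_0) auto
  also have "\<dots> = a / 2 + b / 4 * B"
  proof -
    have t: "t * (c / (k * t)) = c / k" if "t \<noteq> 0" for t c k :: real using that by simp
    show ?thesis using \<theta>(1,2) unfolding X_def Y_def by (subst (1 2) t) auto
  qed
  finally have young: "X powr (1 - \<theta>) * Y powr \<theta> \<le> a / 2 + b / 4 * B" .
  define K where "K = 1 / (2 * (1 + \<theta>)) * (1 / S) powr (1 + \<theta>)"
  have K: "0 < K" using \<theta> pos by (simp add: K_def)
  have XY: "X powr (1 - \<theta>) * Y powr \<theta> = (X powr \<alpha> * (b / (4 * \<theta>))) powr \<theta> * B powr \<theta>"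
  proof -
    have "X powr (1 - \<theta>) = (X powr \<alpha>) powr \<theta>" unfolding \<theta>(3) by (simp add: powr_powr)
    moreover have "Y powr \<theta> = (b / (4 * \<theta>)) powr \<theta> * B powr \<theta>"
    proof -
      have "Y = (b / (4 * \<theta>)) * B" by (simp add: Y_def)
      then show ?thesis using pos \<theta> B0 by (simp only: powr_mult)
    qed
    moreover have "(X powr \<alpha> * (b / (4 * \<theta>))) powr \<theta> = (X powr \<alpha>) powr \<theta> * (b / (4 * \<theta>)) powr \<theta>"
      by (rule powr_mult)
    ultimately show ?thesis by simp
  qed
  \<comment> \<open>The claim becomes K \<le> (X^\<alpha> b/(4\<theta>))^\<theta>, as the powers of
    B agree on both sides. Raising to the power \<alpha> + 1 = 1/\<theta> removes the outer exponent
    and leaves, up to the common factor P(\<alpha> + 1)/(4QR), the hypothesis.\<close>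
  have KR: "K powr (\<alpha> + 1) \<le> X powr \<alpha> * (b / (4 * \<theta>))"
  proof -
    have e1: "1 / (2 * (1 + \<theta>)) = (\<alpha> + 1) / (2 * (\<alpha> + 2))" using pos by (simp add: \<theta>_def field_simps)
    have e2: "(1 + \<theta>) * (\<alpha> + 1) = \<alpha> + 2" using pos by (simp add: \<theta>_def field_simps)
    have e3: "2 * (1 - \<theta>) = 2 * \<alpha> / (\<alpha> + 1)" using pos by (simp add: \<theta>_def field_simps)
    have "K powr (\<alpha> + 1) = ((\<alpha> + 1) / (2 * (\<alpha> + 2))) powr (\<alpha> + 1) * ((1 / S) powr (1 + \<theta>)) powr (\<alpha> + 1)"
      unfolding K_def e1 by (rule powr_mult)
    also have "((1 / S) powr (1 + \<theta>)) powr (\<alpha> + 1) = 1 / S powr (\<alpha> + 2)"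
      unfolding powr_powr e2 using pos by (simp add: powr_divide)
    also have "((\<alpha> + 1) / (2 * (\<alpha> + 2))) powr (\<alpha> + 1) =
        (\<alpha> + 1) powr (\<alpha> + 1) / (2 powr (\<alpha> + 1) * (\<alpha> + 2) powr (\<alpha> + 1))"
      using pos by (simp only: powr_divide powr_mult)
    finally have K1: "K powr (\<alpha> + 1) =
        (\<alpha> + 1) powr (\<alpha> + 1) / (2 powr (\<alpha> + 1) * (\<alpha> + 2) powr (\<alpha> + 1)) * (1 / S powr (\<alpha> + 2))" .
    define P Q R T U where "P = (\<alpha> + 1) powr \<alpha>" and "Q = 2 powr \<alpha>" and "R = \<alpha> powr \<alpha>"
      and "T = (\<alpha> + 2) powr (\<alpha> + 1)" and "U = S powr (\<alpha> + 2)"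
    have p: "0 < P" "0 < Q" "0 < R" "0 < T" "0 < U" using pos by (auto simp: P_def Q_def R_def T_def U_def)
    have K2: "K powr (\<alpha> + 1) = P * (\<alpha> + 1) / (Q * 2 * T * U)"
      unfolding K1 using pos by (simp add: powr_add P_def Q_def T_def U_def mult_ac)
    have Xa: "X powr \<alpha> = a powr \<alpha> * P / (Q * R)"
    proof -
      have "X = a * (\<alpha> + 1) / (2 * \<alpha>)" unfolding X_def e3 by simp
      then show ?thesis using pos by (simp add: powr_divide powr_mult P_def Q_def R_def)
    qed
    have b4: "b / (4 * \<theta>) = b * (\<alpha> + 1) / 4" by (simp add: \<theta>_def)
    have "P * (\<alpha> + 1) / (Q * 2 * T * U) = (2 * R / (T * U)) * (P * (\<alpha> + 1) / (4 * Q * R))"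
      using p by (simp add: field_simps)
    also have "\<dots> \<le> (a powr \<alpha> * b) * (P * (\<alpha> + 1) / (4 * Q * R))"
      using h p pos unfolding R_def T_def U_def by (intro mult_right_mono) auto
    also have "\<dots> = X powr \<alpha> * (b / (4 * \<theta>))" unfolding Xa b4 by (simp add: mult_ac)
    finally show ?thesis unfolding K2 .
  qed
  have "K = (K powr (\<alpha> + 1)) powr \<theta>" using K \<theta> by (simp add: powr_powr)
  also have "\<dots> \<le> (X powr \<alpha> * (b / (4 * \<theta>))) powr \<theta>"
    using KR \<theta> by (intro powr_mono2) auto
  finally have "K * B powr \<theta> \<le> a / 2 + b / 4 * B"
    using young XY B0 by (metis mult_right_mono order_trans powr_ge_zero)
  then have "K * B powr \<theta> * B \<le> (a / 2 + b / 4 * B) * B" using B by (rule mult_right_mono)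
  moreover have "1 / (2 * (1 + \<theta>)) * (B / S) powr (1 + \<theta>) = K * B powr \<theta> * B"
  proof -
    have "B / S = B * (1 / S)" by simp
    then have "(B / S) powr (1 + \<theta>) = B powr (1 + \<theta>) * (1 / S) powr (1 + \<theta>)" by (simp only: powr_mult)
    moreover have "B powr (1 + \<theta>) = B powr \<theta> * B" using B0 by (simp add: powr_add)
    ultimately show ?thesis unfolding K_def by (simp only: mult_ac)
  qed
  ultimately show ?thesis by (simp add: power2_eq_square algebra_simps)
qed (use B in simp)

text \<open>With N = 2s(\<alpha> + 2) all exponents of \<open>L_const\<close> become \<alpha>,
  \<alpha> + 1 and \<alpha> + 2, the powers of 2s cancel, and the constant of the Young estimate
  remains.\<close>

lemma critical_term_le:
  fixes a b s S N B :: real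
  assumes pos: "0 < a" "0 < b" "0 < S" "0 < s" "4 * s < N" and B: "0 \<le> B"
    and ab: "4 * s * (N - 4 * s) powr ((N - 4 * s) / (2 * s)) / (N powr ((N - 2 * s) / (2 * s)) * S powr (N / (2 * s)))
      \<le> a powr ((N - 4 * s) / (2 * s)) * b"
    and q: "q = 2 * N / (N - 2 * s)"
  shows "1 / q * (B / S) powr (q / 2) \<le> a / 2 * B + b / 4 * B\<^sup>2"
proof -
  define \<alpha> where "\<alpha> = (N - 4 * s) / (2 * s)"
  have \<alpha>: "0 < \<alpha>" using pos by (simp add: \<alpha>_def)
  have N: "N = 2 * s * (\<alpha> + 2)" "N - 4 * s = 2 * s * \<alpha>" "(N - 2 * s) / (2 * s) = \<alpha> + 1" "N / (2 * s) = \<alpha> + 2"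
    "N - 2 * s = 2 * s * (\<alpha> + 1)"
    using pos by (auto simp: \<alpha>_def field_simps)
  have q1: "q / 2 = 1 + 1 / (\<alpha> + 1)"
  proof -
    have "2 * N / D / 2 = N / D" for D by simp
    then have "q / 2 = N / (N - 2 * s)" unfolding q .
    also have "\<dots> = (2 * s * (\<alpha> + 2)) / (2 * s * (\<alpha> + 1))" using N(1,5) by metis
    also have "\<dots> = (\<alpha> + 2) / (\<alpha> + 1)" using pos by simp
    also have "\<dots> = 1 + 1 / (\<alpha> + 1)" using \<alpha> by (simp add: field_simps)
    finally show ?thesis .
  qed
  then have q2: "q = 2 * (1 + 1 / (\<alpha> + 1))" by simp
  have "4 * s * (2 * s * \<alpha>) powr \<alpha> / ((2 * s * (\<alpha> + 2)) powr (\<alpha> + 1) * S powr (\<alpha> + 2)) =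
      2 * \<alpha> powr \<alpha> / ((\<alpha> + 2) powr (\<alpha> + 1) * S powr (\<alpha> + 2))"
  proof -
    have "(2 * s * \<alpha>) powr \<alpha> = (2 * s) powr \<alpha> * \<alpha> powr \<alpha>" by (rule powr_mult)
    moreover have "(2 * s * (\<alpha> + 2)) powr (\<alpha> + 1) = (2 * s) powr (\<alpha> + 1) * (\<alpha> + 2) powr (\<alpha> + 1)" by (rule powr_mult)
    moreover have "(2 * s) powr (\<alpha> + 1) = (2 * s) powr \<alpha> * (2 * s)" using pos by (simp add: powr_add)
    moreover have "4 * s * (p * r) / (p * (2 * s) * t * w) = 2 * r / (t * w)" if "p \<noteq> 0" for p r t w :: real
      using that pos by simp
    moreover have "(2 * s) powr \<alpha> \<noteq> 0" using pos by simp
    ultimately show ?thesis by metis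
  qed
  moreover have "4 * s * (N - 4 * s) powr \<alpha> / (N powr (\<alpha> + 1) * S powr (\<alpha> + 2)) \<le> a powr \<alpha> * b"
    using ab unfolding \<alpha>_def[symmetric] N(3,4) .
  ultimately have "2 * \<alpha> powr \<alpha> / ((\<alpha> + 2) powr (\<alpha> + 1) * S powr (\<alpha> + 2)) \<le> a powr \<alpha> * b"
    using N(1,2) by metis
  from young_critical[OF pos(1,2,3) \<alpha> B this] show ?thesis unfolding q1 using q2 by simp
qed

text \<open>The energy is the squared L^2 norm, on the product space, of the weighted difference
  quotient \<open>d\<close>. As \<open>d\<close> is linear in the function, the Brezis-Lieb lemma
  with exponent 2 splits the energy. On the diagonal \<open>d\<close> is 0 by division by 0, so
  convergence there is trivial.\<close>

lemma gagliardo_brezis_lieb: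
  fixes f :: "nat \<Rightarrow> real ^ 'n \<Rightarrow> real"
  assumes [measurable]: "\<And>n. f n \<in> borel_measurable borel" "w \<in> borel_measurable borel"
    and lim: "AE x in lborel. (\<lambda>n. f n x) \<longlonglongrightarrow> w x"
    and K: "\<And>n. gagliardo s (f n) \<le> ennreal K" "0 \<le> K"
  shows "gagliardo s w < \<infinity>" "\<And>n. gagliardo s (\<lambda>x. f n x - w x) < \<infinity>"
    "(\<lambda>n. enn2real (gagliardo s (f n)) - enn2real (gagliardo s (\<lambda>x. f n x - w x))) \<longlonglongrightarrow> enn2real (gagliardo s w)"
proof -
  define d where "d u p = (u (fst p) - u (snd p)) / norm (fst p - snd p) powr ((real CARD('n) + 2 * s) / 2)"
    for u :: "real ^ 'n \<Rightarrow> real" and p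
  have dk: "\<bar>d u p\<bar> powr 2 = gagliardo_kernel s u p" for u p
  proof -
    have "(norm (fst p - snd p) powr ((real CARD('n) + 2 * s) / 2))\<^sup>2 = norm (fst p - snd p) powr (real CARD('n) + 2 * s)"
      by (simp add: power2_eq_square flip: powr_add)
    then show ?thesis
      by (simp add: d_def gagliardo_kernel_def case_prod_beta abs_divide power_divide powr_numeral)
  qed
  have dm [measurable]: "d u \<in> borel_measurable lborel" if [measurable]: "u \<in> borel_measurable borel" for u
  proof -
    have "d u \<in> borel_measurable (borel \<Otimes>\<^sub>M borel)" unfolding d_def by measurable
    then show ?thesis by (simp add: borel_prod)
  qed
  have dd: "d (f n) p - d w p = d (\<lambda>x. f n x - w x) p" for n p
    by (simp add: d_def diff_divide_distrib)
  have gi: "integrable lborel (\<lambda>p. \<bar>d u p\<bar> powr 2) \<longleftrightarrow> gagliardo s u < \<infinity>"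
    "(\<integral>p. \<bar>d u p\<bar> powr 2 \<partial>lborel) = enn2real (gagliardo s u)"
    if [measurable]: "u \<in> borel_measurable borel" for u
    unfolding dk gagliardo_def by (simp_all add: integrable_iff_bounded integral_eq_nn_integral)
  have fin: "gagliardo s (f n) < \<infinity>" for n using K(1)[of n] by (rule le_less_trans) simp
  have le: "enn2real (gagliardo s (f n)) \<le> K" for n
    using enn2real_mono[OF K(1)[of n]] K(2) by simp
  have lim2: "AE p in lborel. (\<lambda>n. d (f n) p) \<longlonglongrightarrow> d w p"
    using AE_lborel_pair[OF lim]
  proof eventually_elim
    case (elim p)
    show ?case
    proof (cases "fst p = snd p")
      case False
      then show ?thesis unfolding d_def
        by (intro tendsto_divide tendsto_diff tendsto_const) (use elim in auto)
    qed (simp add: d_def)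
  qed
  have 1: "(1::real) < 2" by simp
  note bl = brezis_lieb[OF 1, of "\<lambda>n. d (f n)" lborel "d w" K]
  have i: "integrable lborel (\<lambda>p. \<bar>d (f n) p\<bar> powr 2)" for n using gi(1)[of "f n"] fin by simp
  have l: "(\<integral>p. \<bar>d (f n) p\<bar> powr 2 \<partial>lborel) \<le> K" for n using gi(2)[of "f n"] le by simp
  show "gagliardo s w < \<infinity>" using bl(1)[OF _ _ lim2 i l] gi(1)[of w] by simp
  show "gagliardo s (\<lambda>x. f n x - w x) < \<infinity>" for n
    using bl(2)[OF _ _ lim2 i l, of n] gi(1)[of "\<lambda>x. f n x - w x"] unfolding dd by simp
  show "(\<lambda>n. enn2real (gagliardo s (f n)) - enn2real (gagliardo s (\<lambda>x. f n x - w x))) \<longlonglongrightarrow> enn2real (gagliardo s w)"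
    using bl(3)[OF _ _ lim2 i l] gi(2)[of w] gi(2)[of "f n" for n] gi(2)[of "\<lambda>x. f n x - w x" for n]
    unfolding dd by simp
qed

section \<open>The energy on Borel representatives and existence of a minimizer\<close>

definition primitive_integral :: "(real ^ 'n) set \<Rightarrow> (real ^ 'n \<Rightarrow> real \<Rightarrow> real) \<Rightarrow> (real ^ 'n \<Rightarrow> real) \<Rightarrow> real" where
  "primitive_integral \<Omega> g u = (\<integral>x. indicator \<Omega> x *\<^sub>R primitive g x (u x) \<partial>lebesgue)"

lemma energy_borel:
  fixes u :: "real ^ 'n \<Rightarrow> real" and s :: real
  defines "q \<equiv> crit_exp CARD('n) s"
  assumes "0 < q" "u \<in> borel_measurable borel" "\<And>x. x \<notin> \<Omega> \<Longrightarrow> u x = 0"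
  shows "energy s \<Omega> g a b lam u = a / 2 * enn2real (gagliardo s u) + b / 4 * (enn2real (gagliardo s u))\<^sup>2
    - 1 / q * (\<integral>x. \<bar>u x\<bar> powr q \<partial>lborel) - lam * primitive_integral \<Omega> g u"
proof -
  have A: "(X0_norm s \<Omega> u)\<^sup>2 = enn2real (gagliardo s u)" by (rule X0_norm_borel(2)) (use assms in auto)
  have "X0_norm s \<Omega> u ^ 4 = ((X0_norm s \<Omega> u)\<^sup>2)\<^sup>2" by simp
  then have A2: "X0_norm s \<Omega> u ^ 4 = (enn2real (gagliardo s u))\<^sup>2" unfolding A .
  have V: "Lq_norm q \<Omega> u powr q = (\<integral>x. \<bar>u x\<bar> powr q \<partial>lborel)" by (rule Lq_norm_powr(1)) (use assms in auto)
  show ?thesis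
    unfolding energy_def Let_def q_def[symmetric] A A2 V primitive_integral_def set_lebesgue_integral_def ..
qed

lemma X0_energy_representative:
  fixes u :: "real ^ 'n \<Rightarrow> real"
  assumes s: "0 < s" "4 * s < real CARD('n)" and \<Omega>: "open \<Omega>" "bounded \<Omega>" and car: "caratheodory \<Omega> g"
    and u: "u \<in> X0_nonzero s \<Omega>"
  obtains v where "v \<in> borel_measurable borel" "\<And>x. x \<notin> \<Omega> \<Longrightarrow> v x = 0" "gagliardo s v < \<infinity>"
    "\<not> (AE x in lborel. v x = 0)" "energy s \<Omega> g a b lam u = energy s \<Omega> g a b lam v"
proof -
  have u0: "u \<in> X0 s \<Omega>" "\<not> (AE x in lebesgue. u x = 0)" using u by (auto simp: X0_nonzero_def)
  obtain v where v: "v \<in> borel_measurable borel" "\<And>x. x \<notin> \<Omega> \<Longrightarrow> v x = 0" "AE x in lebesgue. u x = v x"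
    "v \<in> X0 s \<Omega>" "X0_norm s \<Omega> u = X0_norm s \<Omega> v" "\<And>q. Lq_norm q \<Omega> u = Lq_norm q \<Omega> v"
    using X0_representative[OF \<Omega>(1) u0(1)] by metis
  have "(\<integral>x. indicator \<Omega> x *\<^sub>R primitive g x (u x) \<partial>lebesgue) = (\<integral>x. indicator \<Omega> x *\<^sub>R primitive g x (v x) \<partial>lebesgue)"
  proof (rule integral_cong_AE)
    show "(\<lambda>x. indicator \<Omega> x *\<^sub>R primitive g x (u x)) \<in> borel_measurable lebesgue"
      "(\<lambda>x. indicator \<Omega> x *\<^sub>R primitive g x (v x)) \<in> borel_measurable lebesgue"
      using u0(1) v(4) by (intro measurable_primitive[OF car \<Omega>(1)]; simp add: X0_def)+
    show "AE x in lebesgue. indicator \<Omega> x *\<^sub>R primitive g x (u x) = indicator \<Omega> x *\<^sub>R primitive g x (v x)"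
      using v(3) by eventually_elim simp
  qed
  then have "energy s \<Omega> g a b lam u = energy s \<Omega> g a b lam v"
    by (simp add: energy_def v(5,6) set_lebesgue_integral_def)
  moreover have "gagliardo s v < \<infinity>" using X0_borel_iff[OF s \<Omega> v(1,2)] v(4) by simp
  moreover have "\<not> (AE x in lborel. v x = 0)"
  proof
    assume "AE x in lborel. v x = 0"
    then have "AE x in lebesgue. v x = 0" by (rule AE_completion)
    then have "AE x in lebesgue. u x = 0" using v(3) by eventually_elim simp
    then show False using u0 by simp
  qed
  ultimately show ?thesis using that v(1,2) by blast
qed

text \<open>\<open>neg\<close> does more than make the infimum negative: negative energies bound the
  minimizing sequence through \<open>K0\<close>, and they keep the limit from being null, as a null
  function has energy 0.\<close>

lemma energy_minimizer_exists:
  fixes \<Omega> :: "(real ^ 'n) set" and s :: real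
  defines "q \<equiv> crit_exp CARD('n) s"
  assumes s: "0 < s" "s < 1" "4 * s < real CARD('n)"
    and \<Omega>: "open \<Omega>" "bounded \<Omega>" "\<Omega> \<noteq> {}" and car: "caratheodory \<Omega> g"
    and cont: "AE x in lebesgue. x \<in> \<Omega> \<longrightarrow> continuous_on UNIV (g x)"
    and grow: "\<And>\<epsilon>. 0 < \<epsilon> \<Longrightarrow> \<exists>C\<ge>0. AE x in lebesgue. x \<in> \<Omega> \<longrightarrow>
              (\<forall>t. 0 \<le> primitive g x t \<and> primitive g x t \<le> C + \<epsilon> * \<bar>t\<bar> powr q)"
    and ab: "0 < a" "0 < b" "L_const s \<Omega> \<le> a powr ((real CARD('n) - 4 * s) / (2 * s)) * b"
    and lam: "0 < lam"
    and neg: "\<exists>u\<in>X0_nonzero s \<Omega>. energy s \<Omega> g a b lam u < 0"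
  shows "\<exists>w\<in>X0_nonzero s \<Omega>. \<forall>u\<in>X0_nonzero s \<Omega>. energy s \<Omega> g a b lam w \<le> energy s \<Omega> g a b lam u"
proof -
  define E where "E = energy s \<Omega> g a b lam"
  define A where "A u = enn2real (gagliardo s u)" for u :: "real ^ 'n \<Rightarrow> real"
  define V where "V u = (\<integral>x. \<bar>u x\<bar> powr q \<partial>lborel)" for u :: "real ^ 'n \<Rightarrow> real"
  define I where "I = primitive_integral \<Omega> g"
  define S where "S = sobolev_const s \<Omega>"
  define adm where "adm u \<longleftrightarrow> u \<in> borel_measurable borel \<and> (\<forall>x. x \<notin> \<Omega> \<longrightarrow> u x = 0) \<and> gagliardo s u < \<infinity>"
    for u :: "real ^ 'n \<Rightarrow> real"
  have q: "2 < q" "q < 4" using crit_exp_facts[of s "CARD('n)"] s by (auto simp: q_def)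
  have S: "0 < S" unfolding S_def by (rule sobolev_const_pos(1)[OF s \<Omega>])
  have A0: "0 \<le> A u" for u by (simp add: A_def)
  have V0: "0 \<le> V u" for u unfolding V_def by (intro Bochner_Integration.integral_nonneg) auto
  have Eq: "E u = a / 2 * A u + b / 4 * (A u)\<^sup>2 - 1 / q * V u - lam * I u" if "adm u" for u
    unfolding E_def A_def V_def I_def q_def
    by (rule energy_borel) (use that q in \<open>auto simp: adm_def q_def\<close>)
  have iV: "integrable lborel (\<lambda>x. \<bar>u x\<bar> powr q)" if "adm u" for u
    unfolding q_def by (rule integrable_crit_powr[OF s(1,3) \<Omega>(2)]) (use that in \<open>auto simp: adm_def\<close>)
  have VA: "V u \<le> (A u / S) powr (q / 2)" if "adm u" for u
  proof -
    have u: "u \<in> borel_measurable borel" "\<And>x. x \<notin> \<Omega> \<Longrightarrow> u x = 0" "gagliardo s u < \<infinity>"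
      using that by (auto simp: adm_def)
    have "u \<in> X0 s \<Omega>" using X0_borel_iff[OF s(1,3) \<Omega>(1,2) u(1,2)] u(3) by simp
    from sobolev_const_pos(2)[OF s \<Omega> this]
    have "S * V u powr (2 / q) \<le> A u"
      using X0_norm_borel(2)[OF u(1,2), where s = s] Lq_norm_powr(2)[OF u(1,2), where q = q] q
      by (simp add: S_def V_def A_def q_def[symmetric])
    then have "V u powr (2 / q) \<le> A u / S" using S by (simp add: pos_le_divide_eq mult.commute)
    then have "(V u powr (2 / q)) powr (q / 2) \<le> (A u / S) powr (q / 2)"
      using q by (intro powr_mono2) auto
    then show ?thesis using q V0 by (simp add: powr_powr)
  qed
  \<comment> \<open>To be applied to the remainders f n - w. It says that a function has nonnegative
    energy apart from its \<lambda>-term.\<close>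
  have crit: "1 / q * V u \<le> a / 2 * A u + b / 4 * (A u)\<^sup>2" if "adm u" for u
  proof -
    have "1 / q * V u \<le> 1 / q * (A u / S) powr (q / 2)"
      using VA[OF that] q by (intro mult_left_mono) auto
    also have "\<dots> \<le> a / 2 * A u + b / 4 * (A u)\<^sup>2"
      by (rule critical_term_le[where s = s and N = "real CARD('n)"])
        (use ab s S A0 in \<open>auto simp: L_const_def Let_def S_def q_def crit_exp_def\<close>)
    finally show ?thesis .
  qed
  have lm: "u \<in> borel_measurable lebesgue" if "u \<in> borel_measurable borel" for u :: "real ^ 'n \<Rightarrow> real"
    using that by (intro measurable_completion) simp
  have iVl: "integrable lebesgue (\<lambda>x. \<bar>u x\<bar> powr q)" "(\<integral>x. \<bar>u x\<bar> powr q \<partial>lebesgue) = V u" if "adm u" for u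
  proof -
    have [measurable]: "u \<in> borel_measurable borel" using that by (simp add: adm_def)
    show "integrable lebesgue (\<lambda>x. \<bar>u x\<bar> powr q)" "(\<integral>x. \<bar>u x\<bar> powr q \<partial>lebesgue) = V u"
      using iV[OF that] unfolding V_def by (simp_all add: integrable_completion integral_completion)
  qed
  \<comment> \<open>Coercivity: V is at most (A/S)^(q/2) with q/2 < 2, so half of the quartic
    coefficient b/4 absorbs the critical term and the \<lambda>-term together, and b/8
    remains.\<close>
  obtain K0 where K0: "\<And>u. adm u \<Longrightarrow> b / 8 * (A u)\<^sup>2 - K0 \<le> E u" "0 \<le> K0"
  proof -
    have "\<exists>C\<ge>0. AE x in lebesgue. x \<in> \<Omega> \<longrightarrow>
        (\<forall>t. 0 \<le> primitive g x t \<and> primitive g x t \<le> C + 1 * \<bar>t\<bar> powr q)"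
      by (rule grow) simp
    then obtain C where C: "0 \<le> C" "AE x in lebesgue. x \<in> \<Omega> \<longrightarrow>
        (\<forall>t. 0 \<le> primitive g x t \<and> primitive g x t \<le> C + 1 * \<bar>t\<bar> powr q)" by blast
    define c where "c = (1 / q + lam) / S powr (q / 2)"
    have c: "0 < c" using q lam S by (simp add: c_def add_pos_pos)
    obtain D where D: "0 \<le> D" "\<And>t. c * (\<bar>t\<bar> + \<bar>t\<bar> powr (q / 2)) \<le> D + b / 8 * \<bar>t\<bar> powr 2"
    proof -
      have "1 < q / 2" "q / 2 < 2" "0 < b / 8" using q ab by auto
      then show ?thesis by (rule subcritical_growth[OF c _ _ _ that])
    qed
    show ?thesis
    proof (rule that[of "D + lam * (C * measure lebesgue \<Omega>)"])
      fix u assume u: "adm u"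
      have "I u \<le> C * measure lebesgue \<Omega> + 1 * V u"
      proof -
        have ul: "u \<in> borel_measurable lebesgue" by (rule lm) (use u in \<open>simp add: adm_def\<close>)
        show ?thesis
          using integral_primitive_le(2)[OF car \<Omega>(1,2) ul C(2) C(1) zero_le_one iVl(1)[OF u]]
          unfolding iVl(2)[OF u] I_def primitive_integral_def .
      qed
      then have "lam * I u \<le> lam * (C * measure lebesgue \<Omega> + V u)" using lam by (intro mult_left_mono) auto
      moreover have "(1 / q + lam) * V u \<le> D + b / 8 * (A u)\<^sup>2"
      proof -
        have "(1 / q + lam) * V u \<le> (1 / q + lam) * (A u / S) powr (q / 2)"
          using VA[OF u] q lam by (intro mult_left_mono) auto
        also have "\<dots> = c * A u powr (q / 2)" by (simp add: c_def powr_divide)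
        also have "\<dots> \<le> c * (\<bar>A u\<bar> + \<bar>A u\<bar> powr (q / 2))" using c A0[of u] by (intro mult_left_mono) auto
        also have "\<dots> \<le> D + b / 8 * \<bar>A u\<bar> powr 2" by (rule D)
        finally show ?thesis using A0[of u] by (simp add: powr_numeral)
      qed
      moreover have "0 \<le> a / 2 * A u" using ab A0 by simp
      ultimately show "b / 8 * (A u)\<^sup>2 - (D + lam * (C * measure lebesgue \<Omega>)) \<le> E u"
        unfolding Eq[OF u] by (simp add: algebra_simps)
    next
      show "0 \<le> D + lam * (C * measure lebesgue \<Omega>)" using D(1) C(1) lam by simp
    qed
  qed
  have rep: "\<exists>v. adm v \<and> E v = E u" if unz: "u \<in> X0_nonzero s \<Omega>" for u
  proof -
    obtain v where "v \<in> borel_measurable borel" "\<And>x. x \<notin> \<Omega> \<Longrightarrow> v x = 0" "gagliardo s v < \<infinity>"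
      "energy s \<Omega> g a b lam u = energy s \<Omega> g a b lam v"
      using X0_energy_representative[OF s(1,3) \<Omega>(1,2) car unz] by metis
    then show ?thesis by (intro exI[of _ v]) (simp add: adm_def E_def)
  qed
  have lower: "- K0 \<le> E u" if "u \<in> X0_nonzero s \<Omega>" for u
  proof -
    from rep[OF that] obtain v where v: "adm v" "E v = E u" by auto
    have "0 \<le> b / 8 * (A v)\<^sup>2" using ab by simp
    then show ?thesis using K0(1)[OF v(1)] v(2) by linarith
  qed
  define m where "m = Inf (E ` X0_nonzero s \<Omega>)"
  have bdd: "bdd_below (E ` X0_nonzero s \<Omega>)" using lower by (intro bdd_belowI2) auto
  have ne: "E ` X0_nonzero s \<Omega> \<noteq> {}" using neg by auto
  have mle: "m \<le> E u" if "u \<in> X0_nonzero s \<Omega>" for u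
    unfolding m_def using bdd that by (intro cInf_lower) auto
  have m0: "m < 0" using neg mle unfolding E_def by fastforce
  have "\<exists>v. adm v \<and> E v < 0 \<and> E v < m + 1 / real (Suc n)" for n
  proof -
    have "Inf (E ` X0_nonzero s \<Omega>) < min 0 (m + 1 / real (Suc n))" using m0 by (simp add: m_def)
    from cInf_lessD[OF ne this] obtain u where u: "u \<in> X0_nonzero s \<Omega>" "E u < min 0 (m + 1 / real (Suc n))"
      by blast
    from rep[OF u(1)] obtain v where "adm v" "E v = E u" by blast
    then show ?thesis using u(2) by (intro exI[of _ v]) auto
  qed
  then obtain v where v: "\<And>n. adm (v n)" "\<And>n. E (v n) < 0" "\<And>n. E (v n) < m + 1 / real (Suc n)"
    by metis
  define K where "K = sqrt (8 * K0 / b)"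
  have K: "0 \<le> K" using K0(2) ab by (simp add: K_def)
  have AK: "A (v n) \<le> K" for n
  proof -
    have "b / 8 * (A (v n))\<^sup>2 \<le> K0" using K0(1)[OF v(1), of n] v(2)[of n] by linarith
    then have "(A (v n))\<^sup>2 \<le> 8 * K0 / b" using ab by (simp add: field_simps)
    then show ?thesis unfolding K_def by (rule real_le_rsqrt)
  qed
  have gK: "gagliardo s (v n) \<le> ennreal K" for n
  proof -
    have "gagliardo s (v n) = ennreal (A (v n))" using v(1)[of n] by (simp add: A_def adm_def)
    then show ?thesis using AK by (simp add: ennreal_leI)
  qed
  obtain r w where r: "strict_mono r" and wm: "w \<in> borel_measurable borel" and w0: "\<And>x. x \<notin> \<Omega> \<Longrightarrow> w x = 0"
    and lim: "AE x in lborel. (\<lambda>n. v (r n) x) \<longlonglongrightarrow> w x"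
    by (rule gagliardo_compact[OF s(1,3) \<Omega>(1,2), of v K]) (use v(1) gK in \<open>auto simp: adm_def\<close>)
  define f where "f n = v (r n)" for n
  have fa: "adm (f n)" for n by (simp add: f_def v(1))
  have fm: "f n \<in> borel_measurable borel" for n using fa by (simp add: adm_def)
  have fg: "gagliardo s (f n) \<le> ennreal K" and fK: "A (f n) \<le> K" for n by (simp_all add: f_def gK AK)
  have lim': "AE x in lborel. (\<lambda>n. f n x) \<longlonglongrightarrow> w x" using lim by (simp add: f_def)
  note gbl = gagliardo_brezis_lieb[OF fm wm lim' fg K]
  have wa: "adm w" using wm w0 gbl(1) by (simp add: adm_def)
  define d where "d n x = f n x - w x" for n x
  have da: "adm (d n)" for n
    unfolding adm_def
  proof (intro conjI allI impI)
    show "d n \<in> borel_measurable borel" unfolding d_def using fm wm by measurable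
    show "gagliardo s (d n) < \<infinity>" using gbl(2)[of n] by (simp add: d_def[abs_def])
    show "d n x = 0" if "x \<notin> \<Omega>" for x using fa[of n] wa that by (simp add: d_def adm_def)
  qed
  define x where "x n = A (f n) - A (d n) - A w" for n
  have x: "x \<longlonglongrightarrow> 0"
    using tendsto_diff[OF gbl(3) tendsto_const[of "A w"]] by (simp add: x_def[abs_def] A_def d_def[abs_def])
  define M where "M = (K / S) powr (q / 2)"
  have VM: "V (f n) \<le> M" for n
  proof -
    have "(A (f n) / S) powr (q / 2) \<le> M" unfolding M_def
      using fK[of n] A0[of "f n"] S q by (intro powr_mono2 divide_right_mono) auto
    then show ?thesis using VA[OF fa[of n]] by linarith
  qed
  have q1: "1 < q" using q by simp
  define y where "y n = V (f n) - V (d n) - V w" for n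
  have y: "y \<longlonglongrightarrow> 0"
  proof -
    have "(\<lambda>n. V (f n) - V (d n)) \<longlonglongrightarrow> V w"
      using brezis_lieb(3)[OF q1, of f lborel w M] fm wm lim' iV[OF fa] VM
      by (simp add: V_def d_def[abs_def])
    from tendsto_diff[OF this tendsto_const[of "V w"]] show ?thesis by (simp add: y_def[abs_def])
  qed
  \<comment> \<open>The error in the squared energies: with A (f n) = A w + A (d n) + x n, the
    square of A (f n) is that of A w + A (d n) plus z n. It tends to 0 because A (f n) stays
    bounded.\<close>
  define z where "z n = x n * (2 * A (f n) - x n)" for n
  have z: "z \<longlonglongrightarrow> 0"
  proof (rule Lim_null_comparison)
    show "\<forall>\<^sub>F n in sequentially. norm (z n) \<le> \<bar>x n\<bar> * (2 * K + \<bar>x n\<bar>)"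
    proof (intro always_eventually allI)
      fix n
      have "\<bar>2 * A (f n) - x n\<bar> \<le> 2 * K + \<bar>x n\<bar>" using fK[of n] A0[of "f n"] by linarith
      then show "norm (z n) \<le> \<bar>x n\<bar> * (2 * K + \<bar>x n\<bar>)"
        unfolding z_def real_norm_def abs_mult by (intro mult_left_mono) auto
    qed
    have "(\<lambda>n. \<bar>x n\<bar> * (2 * K + \<bar>x n\<bar>)) \<longlonglongrightarrow> \<bar>0\<bar> * (2 * K + \<bar>0\<bar>)"
      by (intro tendsto_mult tendsto_add tendsto_const tendsto_rabs x)
    then show "(\<lambda>n. \<bar>x n\<bar> * (2 * K + \<bar>x n\<bar>)) \<longlonglongrightarrow> 0" by simp
  qed
  have Ew: "E w \<le> m + e" if e: "0 < e" for e
  proof -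
    define h where "h n = m + 1 / real (Suc n) - a / 2 * x n - b / 4 * z n + 1 / q * y n + e" for n
    have ev: "\<forall>\<^sub>F n in sequentially. I (f n) \<le> I w + e / lam"
      unfolding I_def primitive_integral_def
    proof (rule integral_primitive_upper_semicontinuous[OF car \<Omega>(1,2) _ _ grow cont])
      show "f n \<in> borel_measurable lebesgue" for n by (rule lm[OF fm])
      show "w \<in> borel_measurable lebesgue" by (rule lm[OF wm])
      show "integrable lebesgue (\<lambda>x. \<bar>f n x\<bar> powr q)" "(\<integral>x. \<bar>f n x\<bar> powr q \<partial>lebesgue) \<le> M" for n
        using iVl(1)[OF fa[of n]] iVl(2)[OF fa[of n]] VM[of n] by simp_all
      show "integrable lebesgue (\<lambda>x. \<bar>w x\<bar> powr q)" by (rule iVl(1)[OF wa])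
      show "AE x in lebesgue. (\<lambda>n. f n x) \<longlonglongrightarrow> w x" using lim' by (rule AE_completion)
      show "0 < q" "0 < e / lam" using q e lam by auto
    qed
    have "\<forall>\<^sub>F n in sequentially. E w \<le> h n"
      using ev
    proof eventually_elim
      case (elim n)
      have Af: "A (f n) = A w + A (d n) + x n" by (simp add: x_def)
      have Vf: "V (f n) = V w + V (d n) + y n" by (simp add: y_def)
      have "(A (f n))\<^sup>2 = (A w + A (d n))\<^sup>2 + z n"
        unfolding z_def Af by (simp add: power2_eq_square algebra_simps)
      \<comment> \<open>The cross term is dropped here, which needs b > 0 and the nonnegativity of
        both energies.\<close>
      moreover have "(A w)\<^sup>2 + (A (d n))\<^sup>2 \<le> (A w + A (d n))\<^sup>2"
        using A0[of w] A0[of "d n"] by (simp add: power2_sum)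
      ultimately have "(A w)\<^sup>2 + (A (d n))\<^sup>2 + z n \<le> (A (f n))\<^sup>2" by simp
      then have "b / 4 * ((A w)\<^sup>2 + (A (d n))\<^sup>2 + z n) \<le> b / 4 * (A (f n))\<^sup>2"
        using ab by (intro mult_left_mono) auto
      then have 1: "b / 4 * (A w)\<^sup>2 + b / 4 * (A (d n))\<^sup>2 + b / 4 * z n \<le> b / 4 * (A (f n))\<^sup>2"
        by (simp add: distrib_left)
      have 2: "a / 2 * A (f n) = a / 2 * A w + a / 2 * A (d n) + a / 2 * x n"
        unfolding Af by (simp add: distrib_left)
      have 3: "1 / q * V (f n) = 1 / q * V w + 1 / q * V (d n) + 1 / q * y n"
        unfolding Vf by (simp only: distrib_left)
      have "lam * I (f n) \<le> lam * (I w + e / lam)" using elim lam by (intro mult_left_mono) auto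
      then have 4: "lam * I (f n) \<le> lam * I w + e" using lam by (simp add: distrib_left)
      have "1 / real (Suc (r n)) \<le> 1 / real (Suc n)"
        using seq_suble[OF r, of n] by (intro divide_left_mono) auto
      then have 5: "E (f n) \<le> m + 1 / real (Suc n)" using v(3)[of "r n"] by (simp add: f_def)
      \<comment> \<open>The estimates 1 to 5 leave the energy of \<open>w\<close> plus the a-, b-
        and critical terms of \<open>d n\<close>, and the latter are nonnegative in sum by
        \<open>crit\<close>.\<close>
      show ?case
        using 1 2 3 4 5 crit[OF da[of n]] unfolding h_def Eq[OF fa[of n]] Eq[OF wa] by linarith
    qed
    moreover have "h \<longlonglongrightarrow> m + 0 - a / 2 * 0 - b / 4 * 0 + 1 / q * 0 + e"
      unfolding h_def[abs_def] using LIMSEQ_inverse_real_of_nat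
      by (intro tendsto_add tendsto_diff tendsto_mult tendsto_const x y z) (simp add: inverse_eq_divide)
    ultimately show ?thesis
      using tendsto_le[OF sequentially_bot _ tendsto_const[of "E w"], of h] by fastforce
  qed
  have Em: "E w \<le> m" using Ew by (rule field_le_epsilon)
  have "\<not> (AE x in lebesgue. w x = 0)"
  proof
    assume "AE x in lebesgue. w x = 0"
    then have wz: "AE x in lborel. w x = 0" by (simp add: AE_completion_iff)
    have "AE p in lborel. ennreal (gagliardo_kernel s w p) = 0"
      using AE_lborel_pair[OF wz] by eventually_elim (auto simp: gagliardo_kernel_def case_prod_beta)
    then have "gagliardo s w = (\<integral>\<^sup>+ p. 0 \<partial>(lborel :: ((real ^ 'n) \<times> (real ^ 'n)) measure))"
      unfolding gagliardo_def by (rule nn_integral_cong_AE)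
    then have "A w = 0" by (simp add: A_def)
    moreover have "V w = 0"
      unfolding V_def by (rule integral_eq_zero_AE) (use wz in eventually_elim, simp)
    moreover have "I w = 0"
      unfolding I_def primitive_integral_def
      by (rule integral_eq_zero_AE) (use AE_completion[OF wz] in eventually_elim, simp)
    ultimately have "E w = 0" unfolding Eq[OF wa] by simp
    then show False using Em m0 by simp
  qed
  moreover have "w \<in> X0 s \<Omega>" using X0_borel_iff[OF s(1,3) \<Omega>(1,2) wm w0] gbl(1) by simp
  ultimately have "w \<in> X0_nonzero s \<Omega>" by (simp add: X0_nonzero_def)
  then show ?thesis using Em mle unfolding E_def by (meson order_trans)
qed

lemma primitive_integral_pos:
  fixes v :: "real ^ 'n \<Rightarrow> real"
  assumes int: "integrable lebesgue (\<lambda>x. indicator \<Omega> x *\<^sub>R primitive g x (v x))"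
    and g: "AE x in lebesgue. x \<in> \<Omega> \<longrightarrow> continuous_on UNIV (g x) \<and> (\<forall>t>0. g x t > 0) \<and> (\<forall>t<0. g x t < 0)"
    and v: "\<And>x. x \<notin> \<Omega> \<Longrightarrow> v x = 0" "\<not> (AE x in lebesgue. v x = 0)"
  shows "0 < primitive_integral \<Omega> g v"
proof -
  have pos: "AE x in lebesgue. x \<in> \<Omega> \<longrightarrow> (\<forall>t. t \<noteq> 0 \<longrightarrow> 0 < primitive g x t)"
    using g by eventually_elim (auto intro!: primitive_pos)
  have nn: "AE x in lebesgue. 0 \<le> indicator \<Omega> x *\<^sub>R primitive g x (v x)"
    using pos
  proof eventually_elim
    case (elim x)
    then show ?case by (cases "x \<in> \<Omega>"; cases "v x = 0") (auto intro: less_imp_le)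
  qed
  have "primitive_integral \<Omega> g v \<noteq> 0"
  proof
    assume "primitive_integral \<Omega> g v = 0"
    then have "AE x in lebesgue. indicator \<Omega> x *\<^sub>R primitive g x (v x) = 0"
      unfolding primitive_integral_def using integral_nonneg_eq_0_iff_AE[OF int nn] by blast
    then have "AE x in lebesgue. v x = 0"
      using pos
    proof eventually_elim
      case (elim x)
      then show ?case using v(1)[of x] by (cases "x \<in> \<Omega>"; cases "v x = 0") auto
    qed
    then show False using v(2) by simp
  qed
  moreover have "0 \<le> primitive_integral \<Omega> g v" unfolding primitive_integral_def by (rule integral_nonneg_AE[OF nn])
  ultimately show ?thesis by simp
qed

theorem theorem1p2:
  fixes \<Omega> :: "(real ^ 'n) set"
    and g :: "real ^ 'n \<Rightarrow> real \<Rightarrow> real"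
    and s a b :: real
  assumes s: "0 < s" "s < 1"
    and N: "real CARD('n) > 4 * s"
    and Omega: "bounded_lipschitz_domain \<Omega>"
    and H1: "caratheodory \<Omega> g" "AE x in lebesgue_on \<Omega>. g x 0 = 0"
    and H2_sign: "AE x in lebesgue_on \<Omega>. (\<forall>t>0. g x t > 0) \<and> (\<forall>t<0. g x t < 0)"
    and H2_lower: "\<exists>\<mu>>0. \<exists>I. I \<noteq> {} \<and> open I \<and> is_interval I \<and> I \<subseteq> {0<..} \<and>
                     (AE x in lebesgue_on \<Omega>. \<forall>t\<in>I. g x t \<ge> \<mu>)"
    and H3: "\<exists>c>0. \<exists>p. 2 < p \<and> p < crit_exp CARD('n) s \<and>
               (AE x in lebesgue_on \<Omega>. \<forall>t. \<bar>g x t\<bar> \<le> c * (1 + \<bar>t\<bar> powr (p - 1)))"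
    and H4: "uniform_limit \<Omega> (\<lambda>t x. g x t / \<bar>t\<bar>) (\<lambda>x. 0) (at 0)"
    and ab: "a > 0" "b > 0"
      "a powr ((real CARD('n) - 4 * s) / (2 * s)) * b \<ge> L_const s \<Omega>"
  shows "\<exists>lam0\<ge>0. \<forall>lam>lam0. \<exists>u \<in> X0_nonzero s \<Omega>.
           ereal (energy s \<Omega> g a b lam u) = iota s \<Omega> g a b lam \<and> iota s \<Omega> g a b lam < 0"
proof -
  define q where "q = crit_exp CARD('n) s"
  have q: "2 < q" using crit_exp_facts[of s "CARD('n)"] s N by (simp add: q_def)
  have \<Omega>: "open \<Omega>" "bounded \<Omega>" "\<Omega> \<noteq> {}" using Omega by (auto simp: bounded_lipschitz_domain_def)
  have \<Omega>m: "\<Omega> \<inter> space lebesgue \<in> sets lebesgue" using \<Omega> by simp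
  note AE_\<Omega> = AE_restrict_space_iff[OF \<Omega>m, THEN iffD1]
  have cont: "AE x in lebesgue. x \<in> \<Omega> \<longrightarrow> continuous_on UNIV (g x)"
    using H1(1) by (intro AE_\<Omega>) (simp add: caratheodory_def)
  note sgn = AE_\<Omega>[OF H2_sign]
  obtain c p where c: "0 < c" and p: "2 < p" "p < q"
    and gr: "AE x in lebesgue_on \<Omega>. \<forall>t. \<bar>g x t\<bar> \<le> c * (1 + \<bar>t\<bar> powr (p - 1))"
    using H3 unfolding q_def by blast
  have grow: "\<exists>C\<ge>0. AE x in lebesgue. x \<in> \<Omega> \<longrightarrow>
      (\<forall>t. 0 \<le> primitive g x t \<and> primitive g x t \<le> C + \<epsilon> * \<bar>t\<bar> powr q)" if \<epsilon>: "0 < \<epsilon>" for \<epsilon>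
  proof -
    have p1: "1 < p" using p by simp
    obtain C where C: "0 \<le> C" "\<And>t. c * (\<bar>t\<bar> + \<bar>t\<bar> powr p) \<le> C + \<epsilon> * \<bar>t\<bar> powr q"
      by (rule subcritical_growth[OF c p1 p(2) \<epsilon>], rule that)
    have "AE x in lebesgue. x \<in> \<Omega> \<longrightarrow> (\<forall>t. 0 \<le> primitive g x t \<and> primitive g x t \<le> C + \<epsilon> * \<bar>t\<bar> powr q)"
      using cont sgn AE_\<Omega>[OF gr]
    proof eventually_elim
      case (elim x)
      show ?case
      proof (intro impI allI conjI)
        fix t assume x: "x \<in> \<Omega>"
        show "0 \<le> primitive g x t"
          using elim x by (cases "t = 0") (auto intro!: less_imp_le[OF primitive_pos])
        have "primitive g x t \<le> c * (\<bar>t\<bar> + \<bar>t\<bar> powr p)"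
          using elim x p1 c by (intro primitive_le) auto
        also note C(2)
        finally show "primitive g x t \<le> C + \<epsilon> * \<bar>t\<bar> powr q" .
      qed
    qed
    then show ?thesis using C(1) by blast
  qed
  \<comment> \<open>Any nonzero element serves as competitor: the primitive is positive off 0, so
    its integral along \<open>v\<close> is positive and a large \<lambda> makes the energy of
    \<open>v\<close> negative.\<close>
  obtain u where "u \<in> X0_nonzero s \<Omega>" using X0_nonzero_exists[OF s N \<Omega>] by auto
  then obtain v where v: "v \<in> borel_measurable borel" "\<And>x. x \<notin> \<Omega> \<Longrightarrow> v x = 0" "gagliardo s v < \<infinity>"
    "\<not> (AE x in lborel. v x = 0)"
    using X0_energy_representative[OF s(1) N \<Omega>(1,2) H1(1)] by metis
  have vX: "v \<in> X0_nonzero s \<Omega>"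
    using X0_borel_iff[OF s(1) N \<Omega>(1,2) v(1,2)] v(3,4) by (simp add: X0_nonzero_def AE_completion_iff)
  have "0 < primitive_integral \<Omega> g v"
  proof (rule primitive_integral_pos)
    have "integrable lborel (\<lambda>x. \<bar>v x\<bar> powr q)"
      unfolding q_def by (rule integrable_crit_powr[OF s(1) N \<Omega>(2) v(1-3)])
    then have i: "integrable lebesgue (\<lambda>x. \<bar>v x\<bar> powr q)"
      using v(1) by (subst integrable_completion) auto
    have vl: "v \<in> borel_measurable lebesgue" using v(1) by (intro measurable_completion) simp
    obtain C where C: "0 \<le> C" "AE x in lebesgue. x \<in> \<Omega> \<longrightarrow>
      (\<forall>t. 0 \<le> primitive g x t \<and> primitive g x t \<le> C + 1 * \<bar>t\<bar> powr q)"
      using grow[OF zero_less_one] by blast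
    show "integrable lebesgue (\<lambda>x. indicator \<Omega> x *\<^sub>R primitive g x (v x))"
      by (rule integral_primitive_le(1)[OF H1(1) \<Omega>(1,2) vl C(2) C(1) zero_le_one i])
    show "AE x in lebesgue. x \<in> \<Omega> \<longrightarrow> continuous_on UNIV (g x) \<and> (\<forall>t>0. g x t > 0) \<and> (\<forall>t<0. g x t < 0)"
      using cont sgn by eventually_elim blast
    show "\<not> (AE x in lebesgue. v x = 0)" using v(4) by (simp add: AE_completion_iff)
  qed (rule v(2))
  \<comment> \<open>For fixed \<open>v\<close> the energy is affine in \<lambda> with negative
    slope, and the quotient is its zero. The maximum with 0 also ensures \<lambda> > 0, as the upper
    estimate of the primitive integral requires.\<close>
  define lam0 where "lam0 = max 0 (energy s \<Omega> g a b 0 v / primitive_integral \<Omega> g v)"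
  show ?thesis
  proof (intro exI[of _ lam0] conjI allI impI)
    show "0 \<le> lam0" by (simp add: lam0_def)
    fix lam assume "lam0 < lam"
    then have lam: "0 < lam" "energy s \<Omega> g a b 0 v < lam * primitive_integral \<Omega> g v"
      using \<open>0 < primitive_integral \<Omega> g v\<close> by (auto simp: lam0_def pos_divide_less_eq)
    have "energy s \<Omega> g a b lam v = energy s \<Omega> g a b 0 v - lam * primitive_integral \<Omega> g v"
      by (simp add: energy_def Let_def primitive_integral_def set_lebesgue_integral_def)
    then have neg: "energy s \<Omega> g a b lam v < 0" using lam by simp
    obtain w where w: "w \<in> X0_nonzero s \<Omega>"
      "\<And>u. u \<in> X0_nonzero s \<Omega> \<Longrightarrow> energy s \<Omega> g a b lam w \<le> energy s \<Omega> g a b lam u"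
      using energy_minimizer_exists[OF s N \<Omega> H1(1) cont grow[unfolded q_def] ab lam(1)] vX neg by blast
    have "iota s \<Omega> g a b lam = ereal (energy s \<Omega> g a b lam w)"
      unfolding iota_def using w by (intro antisym INF_lower INF_greatest) auto
    then show "\<exists>u\<in>X0_nonzero s \<Omega>. ereal (energy s \<Omega> g a b lam u) = iota s \<Omega> g a b lam \<and> iota s \<Omega> g a b lam < 0"
      using w(1) w(2)[OF vX] neg by (intro bexI[of _ w]) (auto simp: zero_ereal_def)
  qed
qed

end
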